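(* Let $n\ge2$, let $\Omega\subset\mathbb{R}^n$ be a bounded Lipschitz domain, let $\frac12<s<1$, $\phi\in H^{-s+\frac12}(\partial\Omega)$ and $u=\mathcal{S}_s\phi$. Then $$\hat u(\xi)=|\xi|^{-2s}\langle\phi,e^{2\pi i\xi\cdot(\,\cdot\,)}\rangle,$$ i.e. the Fourier transform of $u$ is the function $\xi\mapsto|\xi|^{-2s}\langle\phi,Q\mapsto e^{2\pi i\xi\cdot Q}\rangle$.
   Context: $\partial\Omega$ carries surface measure $dQ$. $\Gamma_{2s}(x)=c(n,s)|x|^{-(n-2s)}$ is the Riesz kernel of order $2s$, with $c(n,s)>0$ chosen so that its Fourier transform is $|\xi|^{-2s}$. For $0<\alpha<1$, $H^\alpha(\partial\Omega)$ is the space of $\phi\in L^2(\partial\Omega)$ with $\int_{\partial\Omega}\int_{\partial\Omega}\frac{|\phi(P)-\phi(Q)|^2}{|P-Q|^{n-1+2\alpha}}dPdQ<\infty$, and $H^{-\alpha}(\partial\Omega)=(H^\alpha(\partial\Omega))^*$ with (bilinear) pairing $\langle\cdot,\cdot\rangle$, extended to complex-valued test functions; for $\phi\in L^2(\partial\Omega)$, $\langle\phi,g\rangle=\int_{\partial\Omega}\phi g\,dQ$. $\mathcal{S}_s\phi(x)=\langle\phi,\Gamma_{2s}(x-\cdot)\rangle$ for $x\in\mathbb{R}^n\setminus\partial\Omega$. The Fourier transform is taken in the sense of tempered distributions with the convention $\hat v(\xi)=\int_{\mathbb{R}^n}e^{2\pi i x\cdot\xi}v(x)\,dx$. *)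

theory Defs
  imports "HOL-Analysis.Analysis"
begin

text \<open>Normalized d-dimensional Hausdorff outer measure (Carath\'eodory construction with
  countable covers by bounded sets of diameter at most delta), normalized so that it agrees
  with Lebesgue measure for integer d.\<close>

definition hausdorff_pre :: "real \<Rightarrow> real \<Rightarrow> 'a::euclidean_space set \<Rightarrow> ennreal" where
  "hausdorff_pre d \<delta> A =
     (INF C \<in> {C :: nat \<Rightarrow> 'a set. A \<subseteq> (\<Union>i. C i) \<and> (\<forall>i. bounded (C i) \<and> diameter (C i) \<le> \<delta>)}.
        (\<Sum>i. ennreal (unit_ball_vol d / 2 powr d * diameter (C i) powr d)))"

definition hausdorff_outer :: "real \<Rightarrow> 'a::euclidean_space set \<Rightarrow> ennreal" where
  "hausdorff_outer d A = (SUP \<delta> \<in> {0<..}. hausdorff_pre d \<delta> A)"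

definition hausdorff_measure :: "real \<Rightarrow> 'a::euclidean_space measure" where
  "hausdorff_measure d = measure_of UNIV (sets borel) (hausdorff_outer d)"

definition surface_measure :: "(real^'n) set \<Rightarrow> (real^'n) measure" where
  "surface_measure \<Omega> = restrict_space (hausdorff_measure (real CARD('n) - 1)) (frontier \<Omega>)"

definition lipschitz_domain :: "(real^'n) set \<Rightarrow> bool" where
  "lipschitz_domain \<Omega> \<longleftrightarrow> open \<Omega> \<and> connected \<Omega> \<and> \<Omega> \<noteq> {} \<and> bounded \<Omega> \<and>
    (\<forall>P\<in>frontier \<Omega>. \<exists>e r h L (f :: real^'n \<Rightarrow> real).
       norm e = 1 \<and> r > 0 \<and> h > 0 \<and> L-lipschitz_on {y. y \<bullet> e = 0} f \<and>
       (let cyl = {x. norm ((x - P) - ((x - P) \<bullet> e) *\<^sub>R e) < r \<and> \<bar>(x - P) \<bullet> e\<bar> < h} in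
          \<Omega> \<inter> cyl = {x \<in> cyl. (x - P) \<bullet> e > f ((x - P) - ((x - P) \<bullet> e) *\<^sub>R e)} \<and>
          frontier \<Omega> \<inter> cyl = {x \<in> cyl. (x - P) \<bullet> e = f ((x - P) - ((x - P) \<bullet> e) *\<^sub>R e)}))"

definition gagliardo :: "(real^'n) set \<Rightarrow> real \<Rightarrow> (real^'n \<Rightarrow> complex) \<Rightarrow> ennreal" where
  "gagliardo \<Omega> \<alpha> g =
     (\<integral>\<^sup>+ z. ennreal ((cmod (g (fst z) - g (snd z)))\<^sup>2 /
               dist (fst z) (snd z) powr (real CARD('n) - 1 + 2 * \<alpha>))
        \<partial>(surface_measure \<Omega> \<Otimes>\<^sub>M surface_measure \<Omega>))"

definition sobolev_bdry :: "(real^'n) set \<Rightarrow> real \<Rightarrow> (real^'n \<Rightarrow> complex) set" where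
  "sobolev_bdry \<Omega> \<alpha> = {g. g \<in> borel_measurable (surface_measure \<Omega>) \<and>
      integrable (surface_measure \<Omega>) (\<lambda>Q. (cmod (g Q))\<^sup>2) \<and> gagliardo \<Omega> \<alpha> g < \<infinity>}"

definition sobolev_bdry_norm :: "(real^'n) set \<Rightarrow> real \<Rightarrow> (real^'n \<Rightarrow> complex) \<Rightarrow> real" where
  "sobolev_bdry_norm \<Omega> \<alpha> g =
     sqrt ((\<integral>Q. (cmod (g Q))\<^sup>2 \<partial>surface_measure \<Omega>) + enn2real (gagliardo \<Omega> \<alpha> g))"

text \<open>H^{-alpha}(boundary) = dual of the (real) space H^alpha, each element represented by its
  complex-linear extension to complex-valued test functions (the bilinear pairing).\<close>

definition neg_sobolev_bdry :: "(real^'n) set \<Rightarrow> real \<Rightarrow> ((real^'n \<Rightarrow> complex) \<Rightarrow> complex) set" where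
  "neg_sobolev_bdry \<Omega> \<alpha> = {T.
     (\<forall>g\<in>sobolev_bdry \<Omega> \<alpha>. \<forall>h\<in>sobolev_bdry \<Omega> \<alpha>. T (\<lambda>x. g x + h x) = T g + T h) \<and>
     (\<forall>c. \<forall>g\<in>sobolev_bdry \<Omega> \<alpha>. T (\<lambda>x. c * g x) = c * T g) \<and>
     (\<exists>C. \<forall>g\<in>sobolev_bdry \<Omega> \<alpha>. cmod (T g) \<le> C * sobolev_bdry_norm \<Omega> \<alpha> g) \<and>
     (\<forall>g\<in>sobolev_bdry \<Omega> \<alpha>. (\<forall>x. g x \<in> \<real>) \<longrightarrow> T g \<in> \<real>)}"

text \<open>c(n,s) = Gamma(n/2 - s) pi^(2s - n/2) / Gamma(s): the constant making the Fourier
  transform of c |x|^(-(n-2s)) equal to |xi|^(-2s).\<close>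

definition riesz_const :: "nat \<Rightarrow> real \<Rightarrow> real" where
  "riesz_const n s = Gamma (real n / 2 - s) * pi powr (2 * s - real n / 2) / Gamma s"

definition riesz_kernel :: "real \<Rightarrow> real^'n \<Rightarrow> real" where
  "riesz_kernel s x = riesz_const CARD('n) s * norm x powr (-(real CARD('n) - 2 * s))"

definition single_layer :: "(real^'n) set \<Rightarrow> real \<Rightarrow> ((real^'n \<Rightarrow> complex) \<Rightarrow> complex)
    \<Rightarrow> real^'n \<Rightarrow> complex" where
  "single_layer \<Omega> s T x = T (\<lambda>Q. complex_of_real (riesz_kernel s (x - Q)))"

fun partial_iter :: "(real^'n) list \<Rightarrow> (real^'n \<Rightarrow> complex) \<Rightarrow> real^'n \<Rightarrow> complex" where
  "partial_iter [] f = f"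
| "partial_iter (v # vs) f = (\<lambda>x. vector_derivative (\<lambda>t. partial_iter vs f (x + t *\<^sub>R v)) (at 0))"

definition schwartz :: "(real^'n \<Rightarrow> complex) \<Rightarrow> bool" where
  "schwartz f \<longleftrightarrow> (\<forall>vs. set vs \<subseteq> Basis \<longrightarrow>
      continuous_on UNIV (partial_iter vs f) \<and>
      (\<forall>v\<in>Basis. \<forall>x. ((\<lambda>t. partial_iter vs f (x + t *\<^sub>R v))
          has_vector_derivative partial_iter (v # vs) f x) (at 0)) \<and>
      (\<forall>k::nat. bounded (range (\<lambda>x. (1 + norm x) ^ k *\<^sub>R partial_iter vs f x))))"

definition fourier :: "(real^'n \<Rightarrow> complex) \<Rightarrow> real^'n \<Rightarrow> complex" where
  "fourier f \<xi> = (\<integral>x. cis (2 * pi * (x \<bullet> \<xi>)) * f x \<partial>lborel)"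

definition distr_fourier_is :: "(real^'n \<Rightarrow> complex) \<Rightarrow> (real^'n \<Rightarrow> complex) \<Rightarrow> bool" where
  "distr_fourier_is u m \<longleftrightarrow> (\<forall>\<psi>. schwartz \<psi> \<longrightarrow>
      integrable lborel (\<lambda>x. u x * fourier \<psi> x) \<and>
      integrable lborel (\<lambda>\<xi>. m \<xi> * \<psi> \<xi>) \<and>
      (\<integral>x. u x * fourier \<psi> x \<partial>lborel) = (\<integral>\<xi>. m \<xi> * \<psi> \<xi> \<partial>lborel))"

end

theory Submission
  imports Defs "HOL-Probability.Probability"
begin

text \<open>Only Lipschitz test functions occur. A Lipschitz graph carries at most C t^(n-1) Hausdorff measure
  in a ball of radius t, and since 2s - 1 < 1 this bounds the H^(s-1/2) norm of g by
  C sqrt (A (A + L)) whenever |g| \<le> A and g is L-Lipschitz on the boundary. Hence the pairing with phi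
  commutes with integrals of families that are continuous in the supremum norm and uniformly Lipschitz.

  For a bounded integrable h the Riesz potential of h is Lipschitz because the kernel has order
  n - 2s < n - 1. Cutting off the kernel near the boundary gives first the integrability of u h, by duality, and
  then that its integral is the pairing of phi with the Riesz potential of h. For h the Fourier transform of a
  Schwartz function psi, this potential at Q is the integral of |xi|^(-2s) exp(2 pi i xi.Q) psi(xi), by
  Gaussian subordination, and interchanging the pairing with this integral gives the claim.\<close>

text \<open>The pairing is an abstract functional, so nothing is known beforehand about its action
  on integrals, limits or families with a parameter. The square-root bound takes the place of such
  knowledge: when suprema tend to 0 and Lipschitz constants merely stay bounded, the pairing tends
  to 0. Every passage to the limit under the functional has this form, so each uniform estimate
  below is accompanied by a Lipschitz constant that does not deteriorate. The obstacle is the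
  singularity of the kernel: as x approaches the boundary the kernels are not uniformly Lipschitz,
  and no pointwise control of u near the boundary is at hand. Only averages of the kernel over x are
  Lipschitz across the boundary, which is why u is reached through its integrals against bounded
  functions rather than pointwise.\<close>

section \<open>Integrals of singular kernels against measures with ball growth\<close>

lemma dyadic_shell:
  fixes r R :: real
  assumes "0 < r" "r < R"
  obtains k :: nat where "R / 2 ^ Suc k \<le> r" "r < R / 2 ^ k"
proof -
  obtain m :: nat where m: "R / r < 2 ^ m"
    using real_arch_pow[of 2 "R / r"] by auto
  have "R / 2 ^ Suc m \<le> r"
  proof -
    have "R < 2 ^ m * r" using m assms by (simp add: field_simps)
    also have "\<dots> \<le> 2 ^ Suc m * r" using assms by simp
    finally show ?thesis by (simp add: field_simps)
  qed
  then have ex: "\<exists>k. R / 2 ^ Suc k \<le> r" ..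
  define k where "k = (LEAST k. R / 2 ^ Suc k \<le> r)"
  have 1: "R / 2 ^ Suc k \<le> r" unfolding k_def using ex by (rule LeastI_ex)
  have 2: "r < R / 2 ^ k"
  proof (cases k)
    case 0 then show ?thesis using assms by simp
  next
    case (Suc j)
    then have "\<not> R / 2 ^ Suc j \<le> r" using not_less_Least[of j "\<lambda>k. R / 2 ^ Suc k \<le> r"] k_def by simp
    then show ?thesis using Suc by simp
  qed
  from 1 2 show ?thesis using that by blast
qed

text \<open>The ball is cut into the shells \<open>R / 2 ^ Suc k \<le> dist Q x < R / 2 ^ k\<close>.
  On such a shell the kernel is at most \<open>w k\<close> and the measure at most
  \<open>c * (R / 2 ^ k) powr d\<close>, so the bound is a geometric series of ratio
  \<open>2 powr (b - d) < 1\<close>. It is applied both to Lebesgue measure and to the surface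
  measure.\<close>

lemma nn_integral_dist_powr_ball_le:
  fixes \<mu> :: "'a::metric_space measure"
  assumes growth: "\<And>t. 0 < t \<Longrightarrow> t \<le> R \<Longrightarrow> emeasure \<mu> {x \<in> space \<mu>. dist Q x < t} \<le> ennreal (c * t powr d)"
    and meas [measurable]: "(\<lambda>x. dist Q x) \<in> borel_measurable \<mu>"
    and b: "0 \<le> b" "b < d" and R: "0 < R" and c: "0 \<le> c"
  shows "(\<integral>\<^sup>+x. ennreal (dist Q x powr (- b)) * indicator {x. dist Q x < R} x \<partial>\<mu>)
      \<le> ennreal (c * R powr (d - b) * 2 powr b / (1 - 2 powr (b - d)))"
proof -
  have lt1: "(2::real) powr (b - d) < 1"
    using powr_less_mono[of "b - d" 0 2] b by simp
  define S where "S k = {x \<in> space \<mu>. dist Q x < R / 2 ^ k}" for k :: nat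
  define w where "w k = (R / 2 ^ Suc k) powr (- b)" for k :: nat
  have [measurable]: "S k \<in> sets \<mu>" for k unfolding S_def by measurable
  have "(\<integral>\<^sup>+x. ennreal (dist Q x powr (- b)) * indicator {x. dist Q x < R} x \<partial>\<mu>)
      \<le> (\<integral>\<^sup>+x. (\<Sum>k. ennreal (w k) * indicator (S k) x) \<partial>\<mu>)"
  proof (rule nn_integral_mono)
    fix x assume x: "x \<in> space \<mu>"
    show "ennreal (dist Q x powr (- b)) * indicator {x. dist Q x < R} x \<le> (\<Sum>k. ennreal (w k) * indicator (S k) x)"
    proof (cases "0 < dist Q x \<and> dist Q x < R")
      case True
      then obtain k where k: "R / 2 ^ Suc k \<le> dist Q x" "dist Q x < R / 2 ^ k"
        using dyadic_shell by blast
      have "dist Q x powr (- b) \<le> w k"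
        unfolding w_def using k R b by (intro powr_mono2') auto
      then have "ennreal (dist Q x powr (- b)) * indicator {x. dist Q x < R} x \<le> ennreal (w k) * indicator (S k) x"
        using k x True by (simp add: S_def ennreal_leI)
      also have "\<dots> = sum (\<lambda>k. ennreal (w k) * indicator (S k) x) {k}" by (simp del: sum_mult_indicator)
      also have "\<dots> \<le> (\<Sum>k. ennreal (w k) * indicator (S k) x)"
        by (rule sum_le_suminf) auto
      finally show ?thesis .
    next
      \<comment> \<open>At \<open>x = Q\<close> the integrand is 0 by the convention
        \<open>0 powr (- b) = 0\<close>.\<close>
      case False then show ?thesis by (auto simp: indicator_def)
    qed
  qed
  also have "\<dots> = (\<Sum>k. ennreal (w k) * emeasure \<mu> (S k))"
    by (subst nn_integral_suminf) (simp_all add: nn_integral_cmult_indicator)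
  also have "\<dots> \<le> (\<Sum>k. ennreal (c * R powr (d - b) * 2 powr b * (2 powr (b - d)) ^ k))"
  proof (rule suminf_le)
    fix k
    have "emeasure \<mu> (S k) \<le> ennreal (c * (R / 2 ^ k) powr d)"
      unfolding S_def by (rule growth) (use R in \<open>auto simp: field_simps\<close>)
    then have "ennreal (w k) * emeasure \<mu> (S k) \<le> ennreal (w k) * ennreal (c * (R / 2 ^ k) powr d)"
      by (rule mult_left_mono) simp
    also have "\<dots> = ennreal (w k * (c * (R / 2 ^ k) powr d))"
      by (rule ennreal_mult[symmetric]) (auto simp: w_def c)
    also have "w k * (c * (R / 2 ^ k) powr d) = c * R powr (d - b) * 2 powr b * (2 powr (b - d)) ^ k"
    proof -
      have p: "(2::real) ^ k = 2 powr k" "(2::real) ^ Suc k = 2 powr (k + 1)"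
        by (simp_all add: powr_realpow[symmetric] powr_add)
      have q: "((2::real) powr (b - d)) ^ k = 2 powr ((b - d) * k)"
        by (simp add: powr_realpow[symmetric] powr_powr)
      have w: "w k = R powr (- b) * 2 powr ((k + 1) * b)"
        unfolding w_def p using R by (simp add: powr_divide powr_powr powr_minus_divide)
      have g: "(R / 2 ^ k) powr d = R powr d * 2 powr (- (k * d))"
        unfolding p using R by (simp add: powr_divide powr_powr powr_minus_divide)
      have "w k * (c * (R / 2 ^ k) powr d) = c * (R powr (-b) * R powr d) * (2 powr ((k + 1) * b) * 2 powr (- (k * d)))"
        unfolding w g by simp
      also have "R powr (-b) * R powr d = R powr (d - b)"
        using R by (simp add: powr_add[symmetric])
      also have "(2::real) powr ((k + 1) * b) * 2 powr (- (k * d)) = 2 powr b * 2 powr ((b - d) * k)"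
        by (simp add: powr_add[symmetric] algebra_simps)
      finally show ?thesis unfolding q by simp
    qed
    finally show "ennreal (w k) * emeasure \<mu> (S k) \<le> ennreal (c * R powr (d - b) * 2 powr b * (2 powr (b - d)) ^ k)" .
  qed auto
  also have "\<dots> = ennreal (\<Sum>k. c * R powr (d - b) * 2 powr b * (2 powr (b - d)) ^ k)"
    by (rule suminf_ennreal2) (use lt1 c in \<open>auto intro!: summable_mult summable_geometric\<close>)
  also have "(\<Sum>k. c * R powr (d - b) * 2 powr b * (2 powr (b - d)) ^ k) = c * R powr (d - b) * 2 powr b / (1 - 2 powr (b - d))"
    using lt1 by (subst suminf_mult) (auto simp: suminf_geometric intro!: summable_geometric)
  finally show ?thesis .
qed

lemma emeasure_ball_vec_le:
  fixes Q :: "'a::euclidean_space"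
  assumes "0 < t"
  shows "emeasure lborel {x. dist Q x < t} \<le> ennreal (unit_ball_vol (real DIM('a)) * t powr real DIM('a))"
proof -
  have "{x. dist Q x < t} = ball Q t" by (auto simp: ball_def)
  then show ?thesis
    using assms emeasure_ball[of t Q] by (simp add: powr_realpow)
qed

text \<open>Near Q the kernel is integrated against the supremum of h, away from Q it is at most 1.\<close>

lemma nn_integral_dist_powr_mult_le:
  fixes h :: "'a::euclidean_space \<Rightarrow> real"
  assumes [measurable]: "h \<in> borel_measurable borel"
    and h0: "\<And>x. 0 \<le> h x" and hA: "\<And>x. h x \<le> A" and b: "0 \<le> b" "b < real DIM('a)"
  shows "(\<integral>\<^sup>+x. ennreal (dist Q x powr (- b) * h x) \<partial>lborel)
     \<le> ennreal (A * (unit_ball_vol (real DIM('a)) * 2 powr b / (1 - 2 powr (b - real DIM('a))))) + (\<integral>\<^sup>+x. ennreal (h x) \<partial>lborel)"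
proof -
  have lt1: "(2::real) powr (b - real DIM('a)) < 1"
    using powr_less_mono[of "b - real DIM('a)" 0 2] b by simp
  have A0: "0 \<le> A" using h0[of 0] hA[of 0] by linarith
  have "(\<integral>\<^sup>+x. ennreal (dist Q x powr (- b) * h x) \<partial>lborel)
     \<le> (\<integral>\<^sup>+x. ennreal A * (ennreal (dist Q x powr (- b)) * indicator {x. dist Q x < 1} x) + ennreal (h x) \<partial>lborel)"
  proof (rule nn_integral_mono)
    fix x :: 'a
    show "ennreal (dist Q x powr (- b) * h x) \<le> ennreal A * (ennreal (dist Q x powr (- b)) * indicator {x. dist Q x < 1} x) + ennreal (h x)"
    proof (cases "dist Q x < 1")
      case True
      have "ennreal (dist Q x powr (- b) * h x) \<le> ennreal (A * dist Q x powr (- b))"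
        using mult_right_mono[OF hA[of x], of "dist Q x powr (- b)"] by (intro ennreal_leI) (simp add: mult.commute)
      also have "\<dots> = ennreal A * ennreal (dist Q x powr (- b))"
        by (rule ennreal_mult) (use A0 in auto)
      finally show ?thesis using True
        by (auto intro: add_increasing2)
    next
      case False
      then have "dist Q x powr (- b) \<le> 1 powr (- b)" by (intro powr_mono2') (use b in auto)
      then have "dist Q x powr (- b) * h x \<le> 1 * h x" by (intro mult_right_mono h0) auto
      then show ?thesis using False by (simp add: ennreal_leI)
    qed
  qed
  also have "\<dots> = ennreal A * (\<integral>\<^sup>+x. ennreal (dist Q x powr (- b)) * indicator {x. dist Q x < 1} x \<partial>lborel) + (\<integral>\<^sup>+x. ennreal (h x) \<partial>lborel)"
    by (subst nn_integral_add; simp add: nn_integral_cmult)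
  also have "\<dots> \<le> ennreal A * ennreal (unit_ball_vol (real DIM('a)) * 1 powr (real DIM('a) - b) * 2 powr b / (1 - 2 powr (b - real DIM('a)))) + (\<integral>\<^sup>+x. ennreal (h x) \<partial>lborel)"
    by (intro add_right_mono mult_left_mono nn_integral_dist_powr_ball_le)
       (use b emeasure_ball_vec_le[of _ Q] in auto)
  also have "\<dots> = ennreal (A * (unit_ball_vol (real DIM('a)) * 2 powr b / (1 - 2 powr (b - real DIM('a))))) + (\<integral>\<^sup>+x. ennreal (h x) \<partial>lborel)"
    using A0 b by (subst ennreal_mult[symmetric])
      (auto intro!: divide_nonneg_nonneg mult_nonneg_nonneg less_imp_le[OF lt1])
  finally show ?thesis .
qed

section \<open>Hausdorff measure of Lipschitz graphs\<close>

text \<open>The definition asks for a sequence of sets, so the finite cover is padded with empty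
  sets, whose diameter is 0.\<close>

lemma hausdorff_pre_le_finite_cover:
  fixes A :: "'a::euclidean_space set"
  assumes I: "finite I" and A: "A \<subseteq> (\<Union>i\<in>I. D i)" and \<rho>: "0 \<le> \<rho>" "\<rho> \<le> \<delta>" and d: "0 < d"
    and D: "\<And>i. i \<in> I \<Longrightarrow> bounded (D i)" "\<And>i. i \<in> I \<Longrightarrow> diameter (D i) \<le> \<rho>"
  shows "hausdorff_pre d \<delta> A \<le> ennreal (real (card I) * (unit_ball_vol d / 2 powr d * \<rho> powr d))"
proof -
  obtain f where f: "bij_betw f {..<card I} I"
    using ex_bij_betw_nat_finite[OF I] by (auto simp: lessThan_atLeast0)
  define C where "C i = (if i < card I then D (f i) else {})" for i
  have fI: "i < card I \<Longrightarrow> f i \<in> I" for i using f by (auto simp: bij_betw_def)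
  have C: "bounded (C i)" "diameter (C i) \<le> \<rho>" for i
    using D fI \<rho> by (auto simp: C_def)
  have cov: "A \<subseteq> (\<Union>i. C i)"
  proof
    fix x assume "x \<in> A"
    with A obtain i where i: "i \<in> I" "x \<in> D i" by auto
    then obtain k where "k < card I" "f k = i" using bij_betw_imp_surj_on[OF f] by (metis imageE lessThan_iff)
    then show "x \<in> (\<Union>i. C i)" using i by (auto simp: C_def intro!: exI[of _ k])
  qed
  have "hausdorff_pre d \<delta> A \<le> (\<Sum>i. ennreal (unit_ball_vol d / 2 powr d * diameter (C i) powr d))"
    unfolding hausdorff_pre_def using C cov \<rho> by (intro INF_lower) (auto intro: order_trans)
  also have "\<dots> = (\<Sum>i<card I. ennreal (unit_ball_vol d / 2 powr d * diameter (C i) powr d))"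
    using d by (intro suminf_finite) (auto simp: C_def)
  also have "\<dots> \<le> (\<Sum>i<card I. ennreal (unit_ball_vol d / 2 powr d * \<rho> powr d))"
    using C d by (intro sum_mono ennreal_leI mult_left_mono powr_mono2)
      (auto intro!: divide_nonneg_nonneg diameter_ge_0)
  also have "\<dots> = ennreal (real (card I) * (unit_ball_vol d / 2 powr d * \<rho> powr d))"
    using d by (simp add: ennreal_mult'[symmetric] ennreal_of_nat_eq_real_of_nat)
  finally show ?thesis .
qed

lemma norm_le_sum_orthonormal:
  assumes "finite B" "pairwise orthogonal B" "\<And>b. b \<in> B \<Longrightarrow> norm b = 1" "y \<in> span B"
  shows "norm (y :: 'a::euclidean_space) \<le> (\<Sum>b\<in>B. \<bar>y \<bullet> b\<bar>)"
proof -
  have "y = (\<Sum>b\<in>B. (y \<bullet> b) *\<^sub>R b)"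
    using orthonormal_basis_expand[of B y] assms by simp
  then have "norm y \<le> (\<Sum>b\<in>B. norm ((y \<bullet> b) *\<^sub>R b))" by (metis norm_sum)
  then show ?thesis using assms(3) by simp
qed

text \<open>The index is the integer part of the coordinate \<open>q\<close>, rescaled to run from 0
  to N; the strict bound \<open>\<bar>w\<bar> < t\<close> keeps it below N.\<close>

lemma grid_cell:
  fixes w t :: real
  assumes "0 < N" "0 < t" "\<bar>w\<bar> < t"
  obtains j where "j < (N::nat)" "- t + 2 * t * real j / real N \<le> w" "w \<le> - t + 2 * t * (real j + 1) / real N"
proof -
  define q where "q = (w + t) * real N / (2 * t)"
  have q: "0 \<le> q" "q < real N"
  proof -
    have "0 \<le> w + t" "w + t < 2 * t" using assms by linarith+
    then show "0 \<le> q" "q < real N" unfolding q_def using assms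
      by (auto simp: pos_divide_less_eq mult.commute)
  qed
  define j where "j = nat \<lfloor>q\<rfloor>"
  have j: "real j \<le> q" "q \<le> real j + 1" using q by (simp_all add: j_def)
  have w: "w = - t + 2 * t * q / real N" unfolding q_def using assms by (simp add: field_simps)
  show ?thesis
  proof (rule that[of j])
    show "j < N" using j(1) q(2) by linarith
    have "2 * t * real j / real N \<le> 2 * t * q / real N"
      using j(1) assms by (intro divide_right_mono mult_left_mono) auto
    then show "- t + 2 * t * real j / real N \<le> w" using w by linarith
    have "2 * t * q / real N \<le> 2 * t * (real j + 1) / real N"
      using j(2) assms by (intro divide_right_mono mult_left_mono) auto
    then show "w \<le> - t + 2 * t * (real j + 1) / real N" using w by linarith
  qed
qed

text \<open>With k the cardinality of B, the cube is cut into \<open>N ^ k\<close> cells. The image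
  of a cell has diameter at most \<open>D / N\<close>, where \<open>D = 2 * L * k * t\<close>, and
  \<open>N ^ k * (D / N) ^ k\<close> does not depend on N. Hence N can be taken so large that the
  cells are admissible for \<open>\<delta>\<close>, and the bound survives the supremum over
  \<open>\<delta>\<close>.\<close>

lemma hausdorff_outer_lipschitz_cube_le:
  fixes B :: "'a::euclidean_space set" and G :: "'a \<Rightarrow> 'b::euclidean_space"
  assumes B: "finite B" "pairwise orthogonal B" "\<And>b. b \<in> B \<Longrightarrow> norm b = 1" and k: "0 < card B"
    and G: "L-lipschitz_on (span B) G" and t: "0 < t"
  shows "hausdorff_outer (real (card B)) (G ` {y \<in> span B. \<forall>b\<in>B. \<bar>(y - z) \<bullet> b\<bar> < t})
     \<le> ennreal (unit_ball_vol (real (card B)) / 2 powr real (card B) * (2 * L * real (card B)) powr real (card B) * t powr real (card B))"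
    (is "hausdorff_outer ?k ?A \<le> ennreal ?c")
proof -
  have L: "0 \<le> L" using G by (rule lipschitz_on_nonneg)
  have "hausdorff_pre ?k \<delta> ?A \<le> ennreal ?c" if \<delta>: "0 < \<delta>" for \<delta>
  proof -
    \<comment> \<open>The factor \<open>?k\<close> comes from bounding the norm by the sum of the
      moduli of the coordinates.\<close>
    define D where "D = L * ?k * 2 * t"
    have D: "0 \<le> D" using L t by (simp add: D_def)
    obtain N :: nat where N: "D / \<delta> < real N" using reals_Archimedean2 by blast
    have N0: "0 < N" using N D \<delta> by (metis divide_nonneg_pos less_le_trans not_less of_nat_0_less_iff of_nat_le_0_iff gr0I)
    define \<rho> where "\<rho> = D / real N"
    have \<rho>: "0 \<le> \<rho>" "\<rho> \<le> \<delta>" using D N N0 \<delta> by (auto simp: \<rho>_def field_simps)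
    define I where "I = PiE B (\<lambda>_. {..<N})"
    define cell where "cell j = {y \<in> span B. \<forall>b\<in>B. - t + 2 * t * real (j b) / real N \<le> (y - z) \<bullet> b
        \<and> (y - z) \<bullet> b \<le> - t + 2 * t * (real (j b) + 1) / real N}" for j :: "'a \<Rightarrow> nat"
    have fI: "finite I" unfolding I_def using B by (intro finite_PiE) auto
    have cI: "card I = N ^ card B" unfolding I_def using B by (simp add: card_PiE)
    have cov: "?A \<subseteq> (\<Union>j\<in>I. G ` cell j)"
    proof clarify
      fix y assume y: "y \<in> span B" "\<forall>b\<in>B. \<bar>(y - z) \<bullet> b\<bar> < t"
      have "\<exists>j. \<forall>b\<in>B. j b < N \<and> - t + 2 * t * real (j b) / real N \<le> (y - z) \<bullet> b
        \<and> (y - z) \<bullet> b \<le> - t + 2 * t * (real (j b) + 1) / real N"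
      proof (rule bchoice, rule ballI)
        fix b assume b: "b \<in> B"
        obtain j where "j < N" "- t + 2 * t * real j / real N \<le> (y - z) \<bullet> b" "(y - z) \<bullet> b \<le> - t + 2 * t * (real j + 1) / real N"
          using grid_cell[OF N0 t, of "(y - z) \<bullet> b"] y(2) b by blast
        then show "\<exists>j<N. - t + 2 * t * real j / real N \<le> (y - z) \<bullet> b \<and> (y - z) \<bullet> b \<le> - t + 2 * t * (real j + 1) / real N"
          by blast
      qed
      then obtain j where j: "\<And>b. b \<in> B \<Longrightarrow> j b < N \<and> - t + 2 * t * real (j b) / real N \<le> (y - z) \<bullet> b
        \<and> (y - z) \<bullet> b \<le> - t + 2 * t * (real (j b) + 1) / real N" by blast
      have "restrict j B \<in> I" unfolding I_def using j by auto
      moreover have "y \<in> cell (restrict j B)" unfolding cell_def using j y by simp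
      ultimately show "G y \<in> (\<Union>j\<in>I. G ` cell j)" by blast
    qed
    have dc: "dist (G y) (G y') \<le> \<rho>" if y: "y \<in> cell j" "y' \<in> cell j" for j y y'
    proof -
      have yy: "y \<in> span B" "y' \<in> span B" using y by (auto simp: cell_def)
      have "\<bar>(y - y') \<bullet> b\<bar> \<le> 2 * t / real N" if b: "b \<in> B" for b
      proof -
        have e: "2 * t * (real (j b) + 1) / real N = 2 * t * real (j b) / real N + 2 * t / real N"
          by (simp add: add_divide_distrib distrib_left)
        have "(y - y') \<bullet> b = (y - z) \<bullet> b - (y' - z) \<bullet> b" by (simp add: inner_diff_left)
        moreover have "- t + 2 * t * real (j b) / real N \<le> (y - z) \<bullet> b" "(y - z) \<bullet> b \<le> - t + 2 * t * (real (j b) + 1) / real N"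
           "- t + 2 * t * real (j b) / real N \<le> (y' - z) \<bullet> b" "(y' - z) \<bullet> b \<le> - t + 2 * t * (real (j b) + 1) / real N"
          using y b by (auto simp: cell_def)
        ultimately show ?thesis unfolding e by linarith
      qed
      then have "norm (y - y') \<le> ?k * (2 * t / real N)"
        using norm_le_sum_orthonormal[OF B span_diff[OF yy]] sum_bounded_above[of B "\<lambda>b. \<bar>(y - y') \<bullet> b\<bar>" "2 * t / real N"] by simp
      then have "L * dist y y' \<le> L * (?k * (2 * t / real N))"
        unfolding dist_norm using L by (rule mult_left_mono)
      then show ?thesis using lipschitz_onD[OF G yy] by (simp add: \<rho>_def D_def mult.assoc)
    qed
    have "hausdorff_pre ?k \<delta> ?A \<le> ennreal (real (card I) * (unit_ball_vol ?k / 2 powr ?k * \<rho> powr ?k))"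
    proof (rule hausdorff_pre_le_finite_cover[OF fI cov \<rho>])
      show "0 < ?k" using k by simp
      fix j
      show "bounded (G ` cell j)" unfolding bounded_two_points using dc[of _ j] by (intro exI[of _ \<rho>]) auto
      show "diameter (G ` cell j) \<le> \<rho>"
        using dc[of _ j] \<rho> by (intro diameter_le) (auto simp: dist_norm)
    qed
    also have "real (card I) * (unit_ball_vol ?k / 2 powr ?k * \<rho> powr ?k) = ?c"
    proof -
      have 1: "real (card I) = real N powr ?k" unfolding cI using N0 by (simp add: powr_realpow)
      have 2: "\<rho> powr ?k = ((2 * L * ?k) * t) powr ?k / real N powr ?k"
        unfolding \<rho>_def using D by (subst powr_divide) (auto simp: D_def mult_ac)
      show ?thesis unfolding 1 2 using N0 L t by (simp add: powr_mult)
    qed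
    finally show ?thesis .
  qed
  then show ?thesis unfolding hausdorff_outer_def by (intro SUP_least) auto
qed

lemma orthonormal_basis_of_complement:
  fixes e :: "'a::euclidean_space"
  assumes "e \<noteq> 0"
  obtains B where "finite B" "pairwise orthogonal B" "\<And>b. b \<in> B \<Longrightarrow> norm b = 1" "card B = DIM('a) - 1" "span B = {y. y \<bullet> e = 0}"
proof -
  obtain B where B: "B \<subseteq> {y. e \<bullet> y = 0}" "pairwise orthogonal B" "\<And>x. x \<in> B \<Longrightarrow> norm x = 1" "independent B"
     "card B = dim {y. e \<bullet> y = 0}" "span B = {y. e \<bullet> y = 0}"
    using orthonormal_basis_subspace[OF subspace_hyperplane[of e]] by metis
  show ?thesis
    by (rule that[of B]) (use B assms independent_imp_finite[OF B(4)] dim_hyperplane[of e] in \<open>auto simp: inner_commute\<close>)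
qed

lemma lipschitz_graph_map:
  fixes f :: "'a::euclidean_space \<Rightarrow> real"
  assumes "L-lipschitz_on S f" and e1: "norm e = 1"
  shows "(1 + L)-lipschitz_on S (\<lambda>y. P + y + f y *\<^sub>R e)"
proof (rule lipschitz_onI)
  show "0 \<le> 1 + L" using lipschitz_on_nonneg[OF assms(1)] by simp
  fix x y assume "x \<in> S" "y \<in> S"
  then have f: "\<bar>f x - f y\<bar> \<le> L * dist x y" using lipschitz_onD[OF assms(1)] by (simp add: dist_real_def)
  have "dist (P + x + f x *\<^sub>R e) (P + y + f y *\<^sub>R e) = norm ((x - y) + (f x - f y) *\<^sub>R e)"
    by (simp add: dist_norm algebra_simps)
  also have "\<dots> \<le> norm (x - y) + norm ((f x - f y) *\<^sub>R e)" by (rule norm_triangle_ineq)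
  also have "norm ((f x - f y) *\<^sub>R e) \<le> L * dist x y" using f e1 by (simp only: norm_scaleR) simp
  finally show "dist (P + x + f x *\<^sub>R e) (P + y + f y *\<^sub>R e) \<le> (1 + L) * dist x y"
    by (simp add: dist_norm algebra_simps)
qed

text \<open>Coordinates along B do not see the direction e, so the part of the graph within distance
  t of Q lies over the cube of half-side t around the coordinates of \<open>Q - P\<close>. The
  constant therefore depends on neither Q nor t. Arbitrary subsets S are allowed so that pieces of
  the boundary lying on the graph can be inserted directly.\<close>

lemma hausdorff_outer_graph_ball_le:
  fixes f :: "'a::euclidean_space \<Rightarrow> real"
  assumes f: "L-lipschitz_on {y. y \<bullet> e = 0} f" and e: "norm e = 1" and n: "2 \<le> DIM('a)"
  shows "\<exists>c\<ge>0. \<forall>Q t. 0 < t \<longrightarrow> (\<forall>S. S \<subseteq> {x. (x - P) \<bullet> e = f ((x - P) - ((x - P) \<bullet> e) *\<^sub>R e)} \<inter> ball Q t \<longrightarrow>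
     hausdorff_outer (real DIM('a) - 1) S \<le> ennreal (c * t powr (real DIM('a) - 1)))"
proof -
  have e0: "e \<noteq> 0" using e by auto
  obtain B :: "'a set" where B: "finite B" "pairwise orthogonal B" "\<And>b. b \<in> B \<Longrightarrow> norm b = 1" and cB: "card B = DIM('a) - 1" and sB: "span B = {y. y \<bullet> e = 0}"
    using orthonormal_basis_of_complement[OF e0] by metis
  have rk: "real (card B) = real DIM('a) - 1" using cB n by (simp add: of_nat_diff)
  have k0: "0 < card B" using cB n by simp
  define G where "G y = P + y + f y *\<^sub>R e" for y
  have G: "(1 + L)-lipschitz_on (span B) G" unfolding G_def sB by (rule lipschitz_graph_map[OF f e])
  have ee: "e \<bullet> e = 1" using e by (simp add: norm_eq_1)
  have L0: "0 \<le> L" using lipschitz_on_nonneg[OF f] .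
  have mono: "hausdorff_outer d S \<le> hausdorff_outer d S'" if "S \<subseteq> S'" for d and S S' :: "'a set"
    unfolding hausdorff_outer_def hausdorff_pre_def by (intro SUP_mono' INF_superset_mono) (use that in auto)
  let ?c = "unit_ball_vol (real (card B)) / 2 powr real (card B) * (2 * (1 + L) * real (card B)) powr real (card B)"
  show ?thesis
  proof (intro exI[of _ ?c] conjI allI impI)
    show "0 \<le> ?c" by (intro mult_nonneg_nonneg divide_nonneg_nonneg) auto
    fix Q :: 'a and t :: real and S assume t: "0 < t" and S: "S \<subseteq> {x. (x - P) \<bullet> e = f ((x - P) - ((x - P) \<bullet> e) *\<^sub>R e)} \<inter> ball Q t"
    have "S \<subseteq> G ` {y \<in> span B. \<forall>b\<in>B. \<bar>(y - (Q - P)) \<bullet> b\<bar> < t}"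
    proof
      fix x assume "x \<in> S"
      with S have x: "(x - P) \<bullet> e = f ((x - P) - ((x - P) \<bullet> e) *\<^sub>R e)" "dist Q x < t" by auto
      define y where "y = (x - P) - ((x - P) \<bullet> e) *\<^sub>R e"
      have "x = G y" unfolding G_def using x(1) by (simp add: y_def)
      moreover have "y \<in> span B" unfolding sB y_def using ee by (simp add: inner_diff_left)
      moreover have "\<bar>(y - (Q - P)) \<bullet> b\<bar> < t" if b: "b \<in> B" for b
      proof -
        have "b \<in> span B" using b by (rule span_base)
        then have be: "e \<bullet> b = 0" using sB by (simp add: inner_commute)
        have "(y - (Q - P)) \<bullet> b = (x - Q) \<bullet> b" by (simp add: y_def inner_diff_left be)
        then have "\<bar>(y - (Q - P)) \<bullet> b\<bar> \<le> norm (x - Q) * norm b" by (simp add: Cauchy_Schwarz_ineq2)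
        then show ?thesis using x(2) B(3)[OF b] by (simp add: dist_norm norm_minus_commute)
      qed
      ultimately show "x \<in> G ` {y \<in> span B. \<forall>b\<in>B. \<bar>(y - (Q - P)) \<bullet> b\<bar> < t}" by blast
    qed
    then have "hausdorff_outer (real (card B)) S \<le> ennreal (?c * t powr real (card B))"
      by (rule order_trans[OF mono hausdorff_outer_lipschitz_cube_le[OF B k0 G t]])
    then show "hausdorff_outer (real DIM('a) - 1) S \<le> ennreal (?c * t powr (real DIM('a) - 1))"
      using rk by simp
  qed
qed

section \<open>Surface measure of a Lipschitz domain\<close>

lemma sets_hausdorff_measure [simp]: "sets (hausdorff_measure d) = sets borel"
  unfolding hausdorff_measure_def by (subst sets_measure_of) (auto simp: sets.sigma_sets_eq[of borel, simplified])

lemma space_hausdorff_measure [simp]: "space (hausdorff_measure d) = UNIV"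
  using sets_eq_imp_space_eq[OF sets_hausdorff_measure[of d]] by simp

lemma space_surface_measure [simp]: "space (surface_measure \<Omega>) = frontier \<Omega>"
  unfolding surface_measure_def by (simp add: space_restrict_space)

lemma sets_surface_measure: "sets (surface_measure \<Omega>) = sets (restrict_space borel (frontier \<Omega>))"
  unfolding surface_measure_def by (rule sets_restrict_space_cong) simp

lemma measurable_surface_measure:
  "f \<in> borel_measurable borel \<Longrightarrow> f \<in> borel_measurable (surface_measure \<Omega>)"
  using measurable_cong_sets[OF sets_surface_measure refl] by (metis measurable_restrict_space1)

text \<open>On a given set, \<open>measure_of\<close> returns either the prescribed set function or
  the default 0, so the inequality holds in both cases. It carries the covering estimates over to
  the measure.\<close>

lemma emeasure_hausdorff_le_outer: "emeasure (hausdorff_measure d) A \<le> hausdorff_outer d A"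
  unfolding hausdorff_measure_def by (auto simp: emeasure_measure_of_conv)

lemma emeasure_surface_le_outer:
  assumes "A \<subseteq> frontier \<Omega>"
  shows "emeasure (surface_measure (\<Omega> :: (real^'n) set)) A \<le> hausdorff_outer (real CARD('n) - 1) A"
proof -
  have "emeasure (surface_measure \<Omega>) A = emeasure (hausdorff_measure (real CARD('n) - 1)) A"
    unfolding surface_measure_def by (rule emeasure_restrict_space) (use assms in auto)
  then show ?thesis using emeasure_hausdorff_le_outer by metis
qed

text \<open>The graph is the image of the hyperplane orthogonal to e under a Lipschitz map into the
  space of the same dimension, and such maps send negligible sets to negligible sets.\<close>

lemma negligible_lipschitz_graph:
  fixes f :: "'a::euclidean_space \<Rightarrow> real"
  assumes f: "L-lipschitz_on {y. y \<bullet> e = 0} f" and e: "norm e = 1"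
  shows "negligible {x. (x - P) \<bullet> e = f ((x - P) - ((x - P) \<bullet> e) *\<^sub>R e)}"
proof -
  define G where "G y = P + y + f y *\<^sub>R e" for y
  have G: "(1 + L)-lipschitz_on {y. y \<bullet> e = 0} G" unfolding G_def by (rule lipschitz_graph_map[OF f e])
  have ee: "e \<bullet> e = 1" using e by (simp add: norm_eq_1)
  have "negligible {y. e \<bullet> y = 0}" using ee by (intro negligible_hyperplane) auto
  then have "negligible (G ` {y. y \<bullet> e = 0})"
  proof (intro negligible_locally_Lipschitz_image)
    fix x assume "x \<in> {y. y \<bullet> e = 0}"
    then show "\<exists>T B. open T \<and> x \<in> T \<and> (\<forall>y\<in>{y. y \<bullet> e = 0} \<inter> T. norm (G y - G x) \<le> B * norm (y - x))"
      using lipschitz_onD[OF G] by (intro exI[of _ UNIV] exI[of _ "1 + L"]) (auto simp: dist_norm)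
  qed (simp_all add: inner_commute)
  moreover have "{x. (x - P) \<bullet> e = f ((x - P) - ((x - P) \<bullet> e) *\<^sub>R e)} \<subseteq> G ` {y. y \<bullet> e = 0}"
  proof
    fix x assume "x \<in> {x. (x - P) \<bullet> e = f ((x - P) - ((x - P) \<bullet> e) *\<^sub>R e)}"
    then have x: "(x - P) \<bullet> e = f ((x - P) - ((x - P) \<bullet> e) *\<^sub>R e)" by simp
    define y where "y = (x - P) - ((x - P) \<bullet> e) *\<^sub>R e"
    have "x = G y" unfolding G_def using x by (simp add: y_def)
    moreover have "y \<bullet> e = 0" unfolding y_def using ee by (simp add: inner_diff_left)
    ultimately show "x \<in> G ` {y. y \<bullet> e = 0}" by blast
  qed
  ultimately show ?thesis by (rule negligible_subset)
qed

text \<open>The coordinate cylinder at P serves as U. Inside it the boundary lies on one Lipschitz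
  graph, so both the measure bound and the negligibility of graphs apply.\<close>

lemma lipschitz_domain_local:
  fixes \<Omega> :: "(real^'n) set"
  assumes "lipschitz_domain \<Omega>" and n: "2 \<le> CARD('n)" and P: "P \<in> frontier \<Omega>"
  shows "\<exists>U c. open U \<and> P \<in> U \<and> negligible (frontier \<Omega> \<inter> U) \<and> 0 \<le> c \<and>
    (\<forall>Q t. 0 < t \<longrightarrow> (\<forall>S. S \<subseteq> frontier \<Omega> \<inter> U \<inter> ball Q t \<longrightarrow>
       hausdorff_outer (real CARD('n) - 1) S \<le> ennreal (c * t powr (real CARD('n) - 1))))"
proof -
  obtain e r h L f where e: "norm e = 1" and r: "r > 0" and h: "h > 0" and f: "L-lipschitz_on {y. y \<bullet> e = 0} f"
    and fr: "(let cyl = {x. norm ((x - P) - ((x - P) \<bullet> e) *\<^sub>R e) < r \<and> \<bar>(x - P) \<bullet> e\<bar> < h} in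
          \<Omega> \<inter> cyl = {x \<in> cyl. (x - P) \<bullet> e > f ((x - P) - ((x - P) \<bullet> e) *\<^sub>R e)} \<and>
          frontier \<Omega> \<inter> cyl = {x \<in> cyl. (x - P) \<bullet> e = f ((x - P) - ((x - P) \<bullet> e) *\<^sub>R e)})"
    using bspec[OF conjunct2[OF conjunct2[OF conjunct2[OF conjunct2[OF assms(1)[unfolded lipschitz_domain_def]]]]] P]
    by (elim exE conjE) (rule that)
  define U where "U = {x. norm ((x - P) - ((x - P) \<bullet> e) *\<^sub>R e) < r \<and> \<bar>(x - P) \<bullet> e\<bar> < h}"
  define \<Gamma> where "\<Gamma> = {x. (x - P) \<bullet> e = f ((x - P) - ((x - P) \<bullet> e) *\<^sub>R e)}"
  have sub: "frontier \<Omega> \<inter> U \<subseteq> \<Gamma>" using fr unfolding U_def \<Gamma>_def Let_def by blast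
  have "open U" unfolding U_def
    by (intro open_Collect_conj open_Collect_less continuous_intros)
  moreover have "P \<in> U" using r h by (simp add: U_def)
  moreover have "negligible (frontier \<Omega> \<inter> U)"
    using negligible_lipschitz_graph[OF f e] sub unfolding \<Gamma>_def by (rule negligible_subset)
  moreover have n': "2 \<le> DIM(real^'n)" using n by simp
  obtain c where c: "c \<ge> 0 \<and> (\<forall>Q t. 0 < t \<longrightarrow> (\<forall>S. S \<subseteq> \<Gamma> \<inter> ball Q t \<longrightarrow>
     hausdorff_outer (real DIM(real^'n) - 1) S \<le> ennreal (c * t powr (real DIM(real^'n) - 1))))"
    by (rule exE[OF hausdorff_outer_graph_ball_le[OF f e n', of P, folded \<Gamma>_def]])
  moreover have out: "hausdorff_outer (real CARD('n) - 1) S \<le> ennreal (c * t powr (real CARD('n) - 1))"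
    if "0 < t" "S \<subseteq> frontier \<Omega> \<inter> U \<inter> ball Q t" for S Q t
    proof -
    have "S \<subseteq> \<Gamma> \<inter> ball Q t" using that(2) sub by (auto intro: subsetD)
    then show ?thesis using conjunct2[OF c, rule_format, OF that(1), of S Q] by simp
  qed
  ultimately show ?thesis using conjunct1[OF c] by (intro exI[of _ U] exI[of _ c] conjI allI impI out)
qed

lemma compact_frontier_lipschitz_domain: "lipschitz_domain \<Omega> \<Longrightarrow> compact (frontier \<Omega>)"
  unfolding lipschitz_domain_def by (simp add: compact_frontier_bounded)

lemma lipschitz_domain_finite_cover:
  fixes \<Omega> :: "(real^'n) set"
  assumes \<Omega>: "lipschitz_domain \<Omega>" and n: "2 \<le> CARD('n)"
  obtains I U c where "finite I" "frontier \<Omega> \<subseteq> (\<Union>P\<in>I. U P)" "\<And>P. P \<in> I \<Longrightarrow> open (U P)"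
    "\<And>P. P \<in> I \<Longrightarrow> negligible (frontier \<Omega> \<inter> U P)" "\<And>P. P \<in> I \<Longrightarrow> 0 \<le> c P"
    "\<And>P Q t S. P \<in> (I :: (real^'n) set) \<Longrightarrow> 0 < t \<Longrightarrow> S \<subseteq> frontier \<Omega> \<inter> U P \<inter> ball Q t \<Longrightarrow>
       hausdorff_outer (real CARD('n) - 1) S \<le> ennreal (c P * t powr (real CARD('n) - 1))"
proof -
  let ?good = "\<lambda>P U c. open U \<and> P \<in> U \<and> negligible (frontier \<Omega> \<inter> U) \<and> 0 \<le> c \<and>
    (\<forall>Q t. 0 < t \<longrightarrow> (\<forall>S. S \<subseteq> frontier \<Omega> \<inter> U \<inter> ball Q t \<longrightarrow>
       hausdorff_outer (real CARD('n) - 1) S \<le> ennreal (c * t powr (real CARD('n) - 1))))"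
  have "\<forall>P\<in>frontier \<Omega>. \<exists>U c. ?good P U c" using lipschitz_domain_local[OF \<Omega> n] by simp
  then obtain U where "\<forall>P\<in>frontier \<Omega>. \<exists>c. ?good P (U P) c" by (rule bchoice[THEN exE])
  then obtain c where g: "\<forall>P\<in>frontier \<Omega>. ?good P (U P) (c P)" by (rule bchoice[THEN exE])
  have opn: "open (U P)" and mem: "P \<in> U P" if "P \<in> frontier \<Omega>" for P
    using bspec[OF g that] by simp_all
  have cov: "frontier \<Omega> \<subseteq> (\<Union>P\<in>frontier \<Omega>. U P)" using mem by (intro subsetI UN_I)
  obtain I where I: "I \<subseteq> frontier \<Omega>" "finite I" "frontier \<Omega> \<subseteq> (\<Union>P\<in>I. U P)"
    by (rule compactE_image[OF compact_frontier_lipschitz_domain[OF \<Omega>] opn cov])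
  show ?thesis
  proof (rule that[OF I(2,3), of c])
    fix P assume P: "P \<in> I"
    then have gP: "?good P (U P) (c P)" by (intro bspec[OF g] subsetD[OF I(1)])
    show "open (U P)" "negligible (frontier \<Omega> \<inter> U P)" "0 \<le> c P" using gP by simp_all
    show "hausdorff_outer (real CARD('n) - 1) S \<le> ennreal (c P * t powr (real CARD('n) - 1))"
      if "0 < t" "S \<subseteq> frontier \<Omega> \<inter> U P \<inter> ball Q t" for Q t S
    proof -
      have "\<forall>Q t. 0 < t \<longrightarrow> (\<forall>S. S \<subseteq> frontier \<Omega> \<inter> U P \<inter> ball Q t \<longrightarrow>
         hausdorff_outer (real CARD('n) - 1) S \<le> ennreal (c P * t powr (real CARD('n) - 1)))"
        using gP by (elim conjE)
      then show ?thesis using that by (simp only:)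
    qed
  qed
qed

lemma negligible_frontier_lipschitz_domain:
  fixes \<Omega> :: "(real^'n) set"
  assumes \<Omega>: "lipschitz_domain \<Omega>" and n: "2 \<le> CARD('n)"
  shows "frontier \<Omega> \<in> null_sets lborel"
proof -
  obtain I U and c :: "real^'n \<Rightarrow> real" where I: "finite I" "frontier \<Omega> \<subseteq> (\<Union>P\<in>I. U P)" "\<And>P. P \<in> I \<Longrightarrow> open (U P)"
    "\<And>P. P \<in> I \<Longrightarrow> negligible (frontier \<Omega> \<inter> U P)" "\<And>P. P \<in> I \<Longrightarrow> 0 \<le> c P"
    "\<And>P Q t S. P \<in> I \<Longrightarrow> 0 < t \<Longrightarrow> S \<subseteq> frontier \<Omega> \<inter> U P \<inter> ball Q t \<Longrightarrow>
       hausdorff_outer (real CARD('n) - 1) S \<le> ennreal (c P * t powr (real CARD('n) - 1))"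
  proof (rule lipschitz_domain_finite_cover[OF \<Omega> n], goal_cases)
    case 1
    show ?case by (rule 1(1)[OF 1(2-)])
  qed
  have "negligible (\<Union>P\<in>I. frontier \<Omega> \<inter> U P)" using I(1,4) by (intro negligible_Union) auto
  then have "negligible (frontier \<Omega>)" by (rule negligible_subset) (use I(2) in auto)
  then have "frontier \<Omega> \<in> null_sets lebesgue" by (simp add: negligible_iff_null_sets)
  moreover have "frontier \<Omega> \<in> sets borel" using frontier_closed by simp
  ultimately show ?thesis by (auto simp: null_sets_def)
qed

text \<open>The bounds of the finitely many charts are added. A chart estimate holds wherever the
  centre Q lies and for every radius; a large radius will give finiteness of the measure, small
  radii the convergence of singular integrals.\<close>

lemma surface_measure_upper_regular:
  fixes \<Omega> :: "(real^'n) set"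
  assumes \<Omega>: "lipschitz_domain \<Omega>" and n: "2 \<le> CARD('n)"
  obtains c where "0 \<le> c" "\<And>Q t. 0 < t \<Longrightarrow>
    emeasure (surface_measure \<Omega>) {x \<in> space (surface_measure \<Omega>). dist Q x < t} \<le> ennreal (c * t powr (real CARD('n) - 1))"
proof -
  obtain I U and c :: "real^'n \<Rightarrow> real" where I: "finite I" "frontier \<Omega> \<subseteq> (\<Union>P\<in>I. U P)" "\<And>P. P \<in> I \<Longrightarrow> open (U P)"
    "\<And>P. P \<in> I \<Longrightarrow> negligible (frontier \<Omega> \<inter> U P)" "\<And>P. P \<in> I \<Longrightarrow> 0 \<le> c P"
    "\<And>P Q t S. P \<in> I \<Longrightarrow> 0 < t \<Longrightarrow> S \<subseteq> frontier \<Omega> \<inter> U P \<inter> ball Q t \<Longrightarrow>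
       hausdorff_outer (real CARD('n) - 1) S \<le> ennreal (c P * t powr (real CARD('n) - 1))"
  proof (rule lipschitz_domain_finite_cover[OF \<Omega> n], goal_cases)
    case 1
    show ?case by (rule 1(1)[OF 1(2-)])
  qed
  show ?thesis
  proof (rule that[of "\<Sum>P\<in>I. c P"])
    show "0 \<le> (\<Sum>P\<in>I. c P)" using I(5) by (rule sum_nonneg)
    fix Q :: "real^'n" and t :: real assume t: "0 < t"
    let ?M = "surface_measure \<Omega>"
    have meas: "frontier \<Omega> \<inter> U P \<inter> ball Q t \<in> sets ?M" if "P \<in> I" for P
    proof -
      have "U P \<inter> ball Q t \<in> sets borel" using I(3)[OF that] by auto
      then show ?thesis unfolding sets_surface_measure sets_restrict_space by (auto simp: Int_assoc)
    qed
    have "{x \<in> space ?M. dist Q x < t} \<subseteq> (\<Union>P\<in>I. frontier \<Omega> \<inter> U P \<inter> ball Q t)"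
      using I(2) by auto
    then have "emeasure ?M {x \<in> space ?M. dist Q x < t} \<le> emeasure ?M (\<Union>P\<in>I. frontier \<Omega> \<inter> U P \<inter> ball Q t)"
      by (rule emeasure_mono) (rule sets.finite_UN[OF I(1) meas])
    also have "\<dots> \<le> (\<Sum>P\<in>I. emeasure ?M (frontier \<Omega> \<inter> U P \<inter> ball Q t))"
      by (rule emeasure_subadditive_finite) (use I(1) meas in auto)
    also have "\<dots> \<le> (\<Sum>P\<in>I. ennreal (c P * t powr (real CARD('n) - 1)))"
      by (intro sum_mono order_trans[OF emeasure_surface_le_outer I(6)[OF _ t]]) auto
    also have "\<dots> = ennreal ((\<Sum>P\<in>I. c P) * t powr (real CARD('n) - 1))"
      using I(5) by (subst sum_ennreal) (auto simp: sum_distrib_right)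
    finally show "emeasure ?M {x \<in> space ?M. dist Q x < t} \<le> ennreal ((\<Sum>P\<in>I. c P) * t powr (real CARD('n) - 1))" .
  qed
qed

section \<open>Functionals controlled on Lipschitz functions\<close>

text \<open>This is all that is retained of the dual Sobolev space. In \<open>T_bound\<close> the
  term \<open>A * A\<close> stems from the L^2 norm and \<open>A * L\<close> from the double
  integral of the Sobolev norm. T is constrained only on functions that are Lipschitz on K, which is
  why Lipschitz constants accompany every use of linearity.\<close>

locale lipschitz_functional =
  fixes K :: "'a::euclidean_space set" and T :: "('a \<Rightarrow> complex) \<Rightarrow> complex" and C :: real
  assumes compact_K: "compact K" and C_nonneg: "0 \<le> C"
    and T_add: "L-lipschitz_on K g \<Longrightarrow> L'-lipschitz_on K h \<Longrightarrow> T (\<lambda>x. g x + h x) = T g + T h"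
    and T_cmult: "L-lipschitz_on K g \<Longrightarrow> T (\<lambda>x. c * g x) = c * T g"
    and T_bound: "0 \<le> A \<Longrightarrow> (\<And>x. x \<in> K \<Longrightarrow> cmod (g x) \<le> A) \<Longrightarrow> L-lipschitz_on K g
       \<Longrightarrow> cmod (T g) \<le> C * sqrt (A * (A + L))"
begin

lemma T_diff:
  assumes "L-lipschitz_on K g" "L'-lipschitz_on K h"
  shows "T (\<lambda>x. g x - h x) = T g - T h"
proof -
  have "L'-lipschitz_on K (\<lambda>x. (- 1) * h x)"
    using lipschitz_on_minus[OF assms(2)] by simp
  from T_add[OF assms(1) this] T_cmult[OF assms(2), of "-1"] show ?thesis by simp
qed

text \<open>T takes functions on the whole space, but on functions Lipschitz on K only the values on
  K matter: \<open>T_bound\<close> with \<open>A = 0\<close> and \<open>L = 0\<close> annihilates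
  the difference.\<close>

lemma T_cong:
  assumes g: "L-lipschitz_on K g" and eq: "\<And>x. x \<in> K \<Longrightarrow> g x = h x"
  shows "T g = T h"
proof -
  have h: "L-lipschitz_on K h" using lipschitz_onD[OF g] lipschitz_on_nonneg[OF g] eq by (intro lipschitz_onI) auto
  have "0-lipschitz_on K (\<lambda>x. g x - h x)" by (rule lipschitz_onI) (auto simp: eq)
  from T_bound[OF order_refl _ this] have "T (\<lambda>x. g x - h x) = 0" by (simp add: eq)
  with T_diff[OF g h] show ?thesis by simp
qed

text \<open>The existence of a Lipschitz constant is carried along because \<open>T_add\<close> asks
  for it in the induction step.\<close>

lemma T_sum:
  assumes "finite I" "\<And>i. i \<in> I \<Longrightarrow> L-lipschitz_on K (g i)"
  shows "T (\<lambda>x. \<Sum>i\<in>I. c i * g i x) = (\<Sum>i\<in>I. c i * T (g i)) \<and> (\<exists>L'. L'-lipschitz_on K (\<lambda>x. \<Sum>i\<in>I. c i * g i x))"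
  using assms
proof (induction I rule: finite_induct)
  case empty
  have "0-lipschitz_on K (\<lambda>x. 0)" by (rule lipschitz_onI) auto
  then show ?case using T_cmult[of 0 "\<lambda>x. 0" 0] by auto
next
  case (insert i I)
  then obtain L' where L': "L'-lipschitz_on K (\<lambda>x. \<Sum>i\<in>I. c i * g i x)" and
    eq: "T (\<lambda>x. \<Sum>i\<in>I. c i * g i x) = (\<Sum>i\<in>I. c i * T (g i))" by auto
  have gi: "L-lipschitz_on K (g i)" using insert by auto
  have ci: "(cmod (c i) * L)-lipschitz_on K (\<lambda>x. c i * g i x)"
    by (rule lipschitz_onI)
      (use lipschitz_onD[OF gi] lipschitz_on_nonneg[OF gi] in \<open>auto simp: dist_norm norm_mult right_diff_distrib[symmetric] mult_left_mono mult.assoc\<close>)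
  show ?case
    unfolding sum.insert[OF insert.hyps]
    using T_add[OF ci L'] lipschitz_on_add[OF ci L'] T_cmult[OF gi] eq
    by (intro conjI exI) simp_all
qed

end

section \<open>Sobolev norms of Lipschitz functions on the boundary\<close>

lemma finite_surface_measure:
  fixes \<Omega> :: "(real^'n) set"
  assumes \<Omega>: "lipschitz_domain \<Omega>" and n: "2 \<le> CARD('n)"
  shows "finite_measure (surface_measure \<Omega>)"
proof
  obtain c where c: "0 \<le> c" "\<And>Q t. 0 < t \<Longrightarrow>
    emeasure (surface_measure \<Omega>) {x \<in> space (surface_measure \<Omega>). dist Q x < t} \<le> ennreal (c * t powr (real CARD('n) - 1))"
  proof (rule surface_measure_upper_regular[OF \<Omega> n], goal_cases)
    case 1
    show ?case by (rule 1(1)[OF 1(2-)])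
  qed
  obtain R where R: "0 < R" "frontier \<Omega> \<subseteq> ball 0 R"
    using bounded_subset_ballD[OF compact_imp_bounded[OF compact_frontier_lipschitz_domain[OF \<Omega>]], of 0] by auto
  have "{x \<in> space (surface_measure \<Omega>). dist 0 x < R} = space (surface_measure \<Omega>)" using R(2) by auto
  with c(2)[OF R(1), of 0] have "emeasure (surface_measure \<Omega>) (space (surface_measure \<Omega>)) \<le> ennreal (c * R powr (real CARD('n) - 1))"
    by simp
  then show "emeasure (surface_measure \<Omega>) (space (surface_measure \<Omega>)) \<noteq> \<infinity>"
    by (auto simp: top_unique)
qed

text \<open>In the square of \<open>cmod (g x - g y)\<close> one factor is bounded by
  \<open>2 * A\<close> and the other by \<open>L * dist x y\<close>. One power of the distance is
  gained, and the remaining exponent \<open>b\<close> is below n - 1, the dimension of the boundary,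
  exactly when \<open>\<alpha> < 1/2\<close>. The inner integral is then bounded uniformly in
  x.\<close>

lemma gagliardo_lipschitz_le:
  fixes \<Omega> :: "(real^'n) set"
  assumes \<Omega>: "lipschitz_domain \<Omega>" and n: "2 \<le> CARD('n)" and \<alpha>: "0 \<le> \<alpha>" "\<alpha> < 1/2"
  obtains c where "0 \<le> c" "\<And>g A L. 0 \<le> A \<Longrightarrow> (\<And>x. x \<in> frontier \<Omega> \<Longrightarrow> cmod (g x) \<le> A) \<Longrightarrow> L-lipschitz_on (frontier \<Omega>) g
     \<Longrightarrow> gagliardo \<Omega> \<alpha> g \<le> ennreal (c * A * L)"
proof -
  let ?M = "surface_measure \<Omega>"
  interpret M: finite_measure ?M by (rule finite_surface_measure[OF \<Omega> n])
  obtain c where c: "0 \<le> c" "\<And>Q t. 0 < t \<Longrightarrow>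
    emeasure (surface_measure \<Omega>) {x \<in> space (surface_measure \<Omega>). dist Q x < t} \<le> ennreal (c * t powr (real CARD('n) - 1))"
  proof (rule surface_measure_upper_regular[OF \<Omega> n], goal_cases)
    case 1
    show ?case by (rule 1(1)[OF 1(2-)])
  qed
  obtain R where R: "0 < R" "frontier \<Omega> \<subseteq> ball 0 R"
    using bounded_subset_ballD[OF compact_imp_bounded[OF compact_frontier_lipschitz_domain[OF \<Omega>]], of 0] by auto
  define b where "b = real CARD('n) - 2 + 2 * \<alpha>"
  have b: "0 \<le> b" "b < real CARD('n) - 1" using n \<alpha> by (auto simp: b_def)
  define D where "D = c * (2 * R) powr (real CARD('n) - 1 - b) * 2 powr b / (1 - 2 powr (b - (real CARD('n) - 1)))"
  have lt1: "(2::real) powr (b - (real CARD('n) - 1)) < 1"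
    using powr_less_mono[of "b - (real CARD('n) - 1)" 0 2] b by simp
  have D: "0 \<le> D" unfolding D_def using lt1 c(1) by (intro divide_nonneg_nonneg mult_nonneg_nonneg) auto
  have [measurable]: "(\<lambda>x. x) \<in> borel_measurable ?M" by (rule measurable_surface_measure) simp
  have inner: "(\<integral>\<^sup>+y. ennreal (dist x y powr (- b)) \<partial>?M) \<le> ennreal D" if x: "x \<in> frontier \<Omega>" for x
  proof -
    have "(\<integral>\<^sup>+y. ennreal (dist x y powr (- b)) \<partial>?M) = (\<integral>\<^sup>+y. ennreal (dist x y powr (- b)) * indicator {y. dist x y < 2 * R} y \<partial>?M)"
    proof (rule nn_integral_cong)
      fix y assume "y \<in> space ?M"
      then have "dist x y < 2 * R"
        using subsetD[OF R(2), of x] subsetD[OF R(2), of y] x norm_triangle_ineq4[of x y] by (auto simp: dist_norm)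
      then show "ennreal (dist x y powr (- b)) = ennreal (dist x y powr (- b)) * indicator {y. dist x y < 2 * R} y" by simp
    qed
    also have "\<dots> \<le> ennreal D" unfolding D_def
      by (rule nn_integral_dist_powr_ball_le) (use c b R in auto)
    finally show ?thesis .
  qed
  let ?c = "2 * D * measure ?M (space ?M)"
  show ?thesis
  proof (rule that[of ?c])
    show "0 \<le> ?c" using D by simp
    fix g :: "real^'n \<Rightarrow> complex" and A L assume A: "0 \<le> A" and gA: "\<And>x. x \<in> frontier \<Omega> \<Longrightarrow> cmod (g x) \<le> A" and g: "L-lipschitz_on (frontier \<Omega>) g"
    have L: "0 \<le> L" using lipschitz_on_nonneg[OF g] .
    have "gagliardo \<Omega> \<alpha> g \<le> (\<integral>\<^sup>+z. ennreal (2 * A * L) * ennreal (dist (fst z) (snd z) powr (- b)) \<partial>(?M \<Otimes>\<^sub>M ?M))"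
      unfolding gagliardo_def
    proof (rule nn_integral_mono)
      fix z assume "z \<in> space (?M \<Otimes>\<^sub>M ?M)"
      then obtain x y where z: "z = (x, y)" "x \<in> frontier \<Omega>" "y \<in> frontier \<Omega>" by (auto simp: space_pair_measure)
      have "(cmod (g x - g y))\<^sup>2 \<le> (2 * A) * (L * dist x y)"
        unfolding power2_eq_square
        using lipschitz_onD[OF g z(2,3)] gA[OF z(2)] gA[OF z(3)] norm_triangle_ineq4[of "g x" "g y"] A
        by (intro mult_mono) (auto simp: dist_norm)
      then have "(cmod (g x - g y))\<^sup>2 / dist x y powr (real CARD('n) - 1 + 2 * \<alpha>) \<le> (2 * A) * (L * dist x y) / dist x y powr (real CARD('n) - 1 + 2 * \<alpha>)"
        by (rule divide_right_mono) simp
      also have "\<dots> = 2 * A * L * dist x y powr (- b)"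
      \<comment> \<open>On the diagonal both sides are 0: the numerator contains
        \<open>dist x y\<close>, and \<open>0 powr (- b) = 0\<close>.\<close>
      proof (cases "x = y")
        case False
        have "dist x y powr (- b) = dist x y powr (1 - (real CARD('n) - 1 + 2 * \<alpha>))"
          by (rule arg_cong[where f="\<lambda>t. dist x y powr t"]) (simp add: b_def)
        also have "\<dots> = dist x y / dist x y powr (real CARD('n) - 1 + 2 * \<alpha>)" using False by (subst powr_diff) simp
        finally show ?thesis by simp
      qed simp
      finally show "ennreal ((cmod (g (fst z) - g (snd z)))\<^sup>2 / dist (fst z) (snd z) powr (real CARD('n) - 1 + 2 * \<alpha>))
          \<le> ennreal (2 * A * L) * ennreal (dist (fst z) (snd z) powr (- b))"
        using A L by (simp add: z ennreal_mult[symmetric] ennreal_leI)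
    qed
    also have "\<dots> = ennreal (2 * A * L) * (\<integral>\<^sup>+z. ennreal (dist (fst z) (snd z) powr (- b)) \<partial>(?M \<Otimes>\<^sub>M ?M))"
      by (rule nn_integral_cmult) measurable
    also have "(\<integral>\<^sup>+z. ennreal (dist (fst z) (snd z) powr (- b)) \<partial>(?M \<Otimes>\<^sub>M ?M)) = (\<integral>\<^sup>+x. \<integral>\<^sup>+y. ennreal (dist x y powr (- b)) \<partial>?M \<partial>?M)"
      by (subst M.nn_integral_fst[symmetric]) (auto)
    also have "\<dots> \<le> (\<integral>\<^sup>+x. ennreal D \<partial>?M)"
      by (intro nn_integral_mono inner) simp
    also have "\<dots> = ennreal D * ennreal (measure ?M (space ?M))"
      by (simp add: M.emeasure_eq_measure)
    finally have "gagliardo \<Omega> \<alpha> g \<le> ennreal (2 * A * L) * (ennreal D * ennreal (measure ?M (space ?M)))"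
      by (simp add: mult_left_mono)
    also have "\<dots> = ennreal (?c * A * L)"
      using A L D by (simp add: ennreal_mult[symmetric] mult_ac)
    finally show "gagliardo \<Omega> \<alpha> g \<le> ennreal (?c * A * L)" .
  qed
qed

lemma lipschitz_sobolev_bdry:
  fixes \<Omega> :: "(real^'n) set"
  assumes \<Omega>: "lipschitz_domain \<Omega>" and n: "2 \<le> CARD('n)" and \<alpha>: "0 \<le> \<alpha>" "\<alpha> < 1/2"
  obtains c where "0 \<le> c" "\<And>g A L. 0 \<le> A \<Longrightarrow> (\<And>x. x \<in> frontier \<Omega> \<Longrightarrow> cmod (g x) \<le> A) \<Longrightarrow> L-lipschitz_on (frontier \<Omega>) g
     \<Longrightarrow> g \<in> sobolev_bdry \<Omega> \<alpha> \<and> sobolev_bdry_norm \<Omega> \<alpha> g \<le> c * sqrt (A * (A + L))"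
proof -
  let ?M = "surface_measure \<Omega>"
  interpret M: finite_measure ?M by (rule finite_surface_measure[OF \<Omega> n])
  obtain c where c: "0 \<le> c" "\<And>g A L. 0 \<le> A \<Longrightarrow> (\<And>x. x \<in> frontier \<Omega> \<Longrightarrow> cmod (g x) \<le> A) \<Longrightarrow> L-lipschitz_on (frontier \<Omega>) g
     \<Longrightarrow> gagliardo \<Omega> \<alpha> g \<le> ennreal (c * A * L)"
  proof (rule gagliardo_lipschitz_le[OF \<Omega> n \<alpha>], goal_cases)
    case 1
    show ?case by (rule 1(1)[OF 1(2-)])
  qed
  let ?m = "measure ?M (space ?M)"
  show ?thesis
  proof (rule that[of "sqrt (c + ?m)"])
    show "0 \<le> sqrt (c + ?m)" using c(1) by simp
    fix g :: "real^'n \<Rightarrow> complex" and A L assume A: "0 \<le> A" and gA: "\<And>x. x \<in> frontier \<Omega> \<Longrightarrow> cmod (g x) \<le> A" and g: "L-lipschitz_on (frontier \<Omega>) g"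
    have L: "0 \<le> L" using lipschitz_on_nonneg[OF g] .
    have gag: "gagliardo \<Omega> \<alpha> g \<le> ennreal (c * A * L)" by (rule c(2)[OF A gA g])
    have "g \<in> borel_measurable (restrict_space borel (frontier \<Omega>))"
      by (rule borel_measurable_continuous_on_restrict) (rule lipschitz_on_continuous_on[OF g])
    then have [measurable]: "g \<in> borel_measurable ?M"
      using measurable_cong_sets[OF sets_surface_measure[of \<Omega>] refl, of borel] by blast
    have sq: "(cmod (g x))\<^sup>2 \<le> A\<^sup>2" if "x \<in> frontier \<Omega>" for x
      using gA[OF that] by (rule power_mono) simp
    have "AE x in ?M. norm ((cmod (g x))\<^sup>2) \<le> A\<^sup>2"
      by (rule AE_I2) (simp add: sq)
    then have int: "integrable ?M (\<lambda>x. (cmod (g x))\<^sup>2)"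
      by (rule M.integrable_const_bound) measurable
    have "(\<integral>x. (cmod (g x))\<^sup>2 \<partial>?M) \<le> (\<integral>x. A\<^sup>2 \<partial>?M)"
      by (rule integral_mono) (simp_all add: int sq)
    then have i: "(\<integral>x. (cmod (g x))\<^sup>2 \<partial>?M) \<le> ?m * A\<^sup>2" by simp
    have "enn2real (gagliardo \<Omega> \<alpha> g) \<le> c * A * L"
      using gag A L c(1) by (intro enn2real_leI) auto
    with i have "(\<integral>x. (cmod (g x))\<^sup>2 \<partial>?M) + enn2real (gagliardo \<Omega> \<alpha> g) \<le> ?m * A\<^sup>2 + c * A * L" by linarith
    \<comment> \<open>The nonnegative cross terms \<open>?m * (A * L)\<close> and
      \<open>c * A\<^sup>2\<close> are added to obtain a product.\<close>
    also have "\<dots> \<le> (c + ?m) * (A * (A + L))"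
    proof -
      have "0 \<le> ?m * (A * L) + c * A\<^sup>2" using A L c(1) by simp
      then show ?thesis by (simp add: algebra_simps power2_eq_square)
    qed
    finally have "sobolev_bdry_norm \<Omega> \<alpha> g \<le> sqrt (c + ?m) * sqrt (A * (A + L))"
      unfolding sobolev_bdry_norm_def real_sqrt_mult[symmetric] by simp
    moreover have "g \<in> sobolev_bdry \<Omega> \<alpha>"
      unfolding sobolev_bdry_def using int order_le_less_trans[OF gag ennreal_less_top] by simp
    ultimately show "g \<in> sobolev_bdry \<Omega> \<alpha> \<and> sobolev_bdry_norm \<Omega> \<alpha> g \<le> sqrt (c + ?m) * sqrt (A * (A + L))" by simp
  qed
qed

lemma lipschitz_on_compact_bounded:
  fixes g :: "'a::metric_space \<Rightarrow> complex"
  assumes "compact K" "L-lipschitz_on K g"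
  obtains A where "0 \<le> A" "\<And>x. x \<in> K \<Longrightarrow> cmod (g x) \<le> A"
proof -
  have "bounded (g ` K)"
    using compact_continuous_image[OF lipschitz_on_continuous_on[OF assms(2)] assms(1)] compact_imp_bounded by blast
  then obtain A where "\<forall>x\<in>g ` K. cmod x \<le> A" by (auto simp: bounded_iff)
  then show ?thesis by (intro that[of "max 0 A"]) (auto simp: le_max_iff_disj)
qed

lemma neg_sobolev_lipschitz_functional:
  fixes \<Omega> :: "(real^'n) set"
  assumes \<Omega>: "lipschitz_domain \<Omega>" and n: "2 \<le> CARD('n)" and \<alpha>: "0 \<le> \<alpha>" "\<alpha> < 1/2"
    and T: "T \<in> neg_sobolev_bdry \<Omega> \<alpha>"
  shows "\<exists>C. lipschitz_functional (frontier \<Omega>) T C"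
proof -
  obtain c where c: "0 \<le> c" and lip: "\<And>g A L. 0 \<le> A \<Longrightarrow> (\<And>x. x \<in> frontier \<Omega> \<Longrightarrow> cmod (g x) \<le> A) \<Longrightarrow> L-lipschitz_on (frontier \<Omega>) g
     \<Longrightarrow> g \<in> sobolev_bdry \<Omega> \<alpha> \<and> sobolev_bdry_norm \<Omega> \<alpha> g \<le> c * sqrt (A * (A + L))"
  proof (rule lipschitz_sobolev_bdry[OF \<Omega> n \<alpha>], goal_cases)
    case 1
    show ?case by (rule 1(1)[OF 1(2-)])
  qed
  note cpt = compact_frontier_lipschitz_domain[OF \<Omega>]
  have mem: "g \<in> sobolev_bdry \<Omega> \<alpha>" if g: "L-lipschitz_on (frontier \<Omega>) g" for g L
    using lipschitz_on_compact_bounded[OF cpt g] lip g by metis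
  obtain C where C: "\<forall>g\<in>sobolev_bdry \<Omega> \<alpha>. cmod (T g) \<le> C * sobolev_bdry_norm \<Omega> \<alpha> g"
    using T unfolding neg_sobolev_bdry_def by blast
  \<comment> \<open>The absolute value is taken because the constant in the definition of the dual
    space may have either sign.\<close>
  have "lipschitz_functional (frontier \<Omega>) T (\<bar>C\<bar> * c)"
  proof
    show "compact (frontier \<Omega>)" by (rule cpt)
    show "0 \<le> \<bar>C\<bar> * c" using c by simp
    show "T (\<lambda>x. g x + h x) = T g + T h" if "L-lipschitz_on (frontier \<Omega>) g" "L'-lipschitz_on (frontier \<Omega>) h" for L L' g h
      using T mem[OF that(1)] mem[OF that(2)] unfolding neg_sobolev_bdry_def by blast
    show "T (\<lambda>x. c * g x) = c * T g" if "L-lipschitz_on (frontier \<Omega>) g" for L g c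
      using T mem[OF that] unfolding neg_sobolev_bdry_def by blast
    fix A g L assume g: "0 \<le> A" "\<And>x. x \<in> frontier \<Omega> \<Longrightarrow> cmod (g x) \<le> A" "L-lipschitz_on (frontier \<Omega>) g"
    have n0: "0 \<le> sobolev_bdry_norm \<Omega> \<alpha> g" unfolding sobolev_bdry_norm_def by simp
    have "cmod (T g) \<le> C * sobolev_bdry_norm \<Omega> \<alpha> g" using C mem[OF g(3)] by blast
    also have "\<dots> \<le> \<bar>C\<bar> * (c * sqrt (A * (A + L)))"
      using lip[OF g] n0 by (intro mult_mono) auto
    finally show "cmod (T g) \<le> \<bar>C\<bar> * c * sqrt (A * (A + L))" by (simp add: mult.assoc)
  qed
  then show ?thesis ..
qed

section \<open>Pairing with families depending on a parameter\<close>

text \<open>A single constant B bounds the values, the Lipschitz constants on K and the Lipschitz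
  constant in the parameter. Both the truncated kernels and the rescaled plane waves have this
  form.\<close>

locale lipschitz_family = lipschitz_functional K T C
  for K :: "'a::euclidean_space set" and T C +
  fixes G :: "'b::euclidean_space \<Rightarrow> 'a \<Rightarrow> complex" and B :: real
  assumes B_nonneg: "0 \<le> B"
    and G_bound: "P \<in> K \<Longrightarrow> cmod (G x P) \<le> B"
    and G_lipschitz: "B-lipschitz_on K (G x)"
    and G_lipschitz_param: "P \<in> K \<Longrightarrow> cmod (G x P - G y P) \<le> B * dist x y"
begin

lemma family_bound: "cmod (T (G x)) \<le> C * sqrt (B * (B + B))"
  by (rule T_bound[OF B_nonneg G_bound G_lipschitz])

text \<open>The difference of two members has supremum at most \<open>B * dist x y\<close> and
  Lipschitz constant at most \<open>B + B\<close>, so \<open>T_bound\<close> makes the pairing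
  locally Hoelder continuous of order 1/2 in the parameter.\<close>

lemma family_dist: "cmod (T (G x) - T (G y)) \<le> C * sqrt (B * dist x y * (B * dist x y + (B + B)))"
  unfolding T_diff[OF G_lipschitz G_lipschitz, symmetric]
  by (rule T_bound[OF _ G_lipschitz_param lipschitz_on_diff[OF G_lipschitz G_lipschitz]]) (use B_nonneg in simp_all)

lemma family_tendsto:
  assumes "q \<longlonglongrightarrow> x"
  shows "(\<lambda>k. T (G (q k))) \<longlonglongrightarrow> T (G x)"
proof (rule LIM_zero_cancel, rule Lim_null_comparison)
  have d: "(\<lambda>k. dist (q k) x) \<longlonglongrightarrow> 0" by (rule tendsto_dist_iff[THEN iffD1, OF assms])
  have "(\<lambda>k. C * sqrt (B * dist (q k) x * (B * dist (q k) x + (B + B)))) \<longlonglongrightarrow> C * sqrt (B * 0 * (B * 0 + (B + B)))"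
    by (intro tendsto_intros d)
  then show "(\<lambda>k. C * sqrt (B * dist (q k) x * (B * dist (q k) x + (B + B)))) \<longlonglongrightarrow> 0" by simp
  show "\<forall>\<^sub>F k in sequentially. norm (T (G (q k)) - T (G x)) \<le> C * sqrt (B * dist (q k) x * (B * dist (q k) x + (B + B)))"
    using family_dist by (intro always_eventually) simp
qed

lemma family_measurable: "(\<lambda>x. T (G x)) \<in> borel_measurable borel"
proof (rule borel_measurable_continuous_onI)
  show "continuous_on UNIV (\<lambda>x. T (G x))"
    unfolding continuous_on_sequentially by (auto simp: comp_def intro: family_tendsto)
qed

lemma family_param_measurable: "P \<in> K \<Longrightarrow> (\<lambda>x. G x P) \<in> borel_measurable borel"
proof (rule borel_measurable_continuous_onI)
  assume "P \<in> K"
  then have "B-lipschitz_on UNIV (\<lambda>x. G x P)"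
    using B_nonneg G_lipschitz_param by (intro lipschitz_onI) (auto simp: dist_norm[where 'a=complex])
  then show "continuous_on UNIV (\<lambda>x. G x P)" by (rule lipschitz_on_continuous_on)
qed

text \<open>The parameter is composed with a measurable map q because q will run through simple
  functions approximating the identity.\<close>

lemma family_integrable:
  assumes w: "integrable lborel w" and q [measurable]: "q \<in> borel_measurable borel" and P: "P \<in> K"
  shows "integrable lborel (\<lambda>x. w x * G (q x) P)"
proof (rule Bochner_Integration.integrable_bound[of _ "\<lambda>x. B * norm (w x)"])
  show "integrable lborel (\<lambda>x. B * norm (w x))" using w by simp
  have [measurable]: "w \<in> borel_measurable borel" using borel_measurable_integrable[OF w] by simp
  note [measurable] = family_param_measurable[OF P]
  show "(\<lambda>x. w x * G (q x) P) \<in> borel_measurable lborel" by measurable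
  show "AE x in lborel. norm (w x * G (q x) P) \<le> norm (B * norm (w x))"
    using G_bound[OF P] B_nonneg by (intro AE_I2) (simp add: norm_mult mult.commute[of B] mult_left_mono)
qed

lemma integrable_family_pairing:
  assumes w: "integrable lborel w" and q [measurable]: "q \<in> borel_measurable borel"
  shows "integrable lborel (\<lambda>x. w x * T (G (q x)))"
proof (rule Bochner_Integration.integrable_bound[of _ "\<lambda>x. (C * sqrt (B * (B + B))) * norm (w x)"])
  show "integrable lborel (\<lambda>x. (C * sqrt (B * (B + B))) * norm (w x))" using w by simp
  have [measurable]: "w \<in> borel_measurable borel" using borel_measurable_integrable[OF w] by simp
  have [measurable]: "(\<lambda>x. T (G (q x))) \<in> borel_measurable borel"
    by (rule measurable_compose[OF q family_measurable])
  show "(\<lambda>x. w x * T (G (q x))) \<in> borel_measurable lborel" by measurable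
  show "AE x in lborel. norm (w x * T (G (q x))) \<le> norm ((C * sqrt (B * (B + B))) * norm (w x))"
  proof (rule AE_I2)
    fix x
    have "norm (w x * T (G (q x))) \<le> norm (w x) * (C * sqrt (B * (B + B)))"
      unfolding norm_mult by (rule mult_left_mono[OF family_bound]) simp
    also have "\<dots> \<le> norm ((C * sqrt (B * (B + B))) * norm (w x))" by (simp add: mult.commute)
    finally show "norm (w x * T (G (q x))) \<le> norm ((C * sqrt (B * (B + B))) * norm (w x))" .
  qed
qed

lemma lipschitz_integral:
  assumes w: "integrable lborel w" and q [measurable]: "q \<in> borel_measurable borel"
  shows "(B * (\<integral>x. norm (w x) \<partial>lborel))-lipschitz_on K (\<lambda>P. \<integral>x. w x * G (q x) P \<partial>lborel)"
proof (rule lipschitz_onI)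
  show "0 \<le> B * (\<integral>x. norm (w x) \<partial>lborel)" using B_nonneg by simp
  fix P Q assume PQ: "P \<in> K" "Q \<in> K"
  note int = family_integrable[OF w q PQ(1)] family_integrable[OF w q PQ(2)]
  have "dist (\<integral>x. w x * G (q x) P \<partial>lborel) (\<integral>x. w x * G (q x) Q \<partial>lborel) = norm (\<integral>x. w x * G (q x) P - w x * G (q x) Q \<partial>lborel)"
    using int by (simp add: dist_norm)
  also have "\<dots> \<le> (\<integral>x. norm (w x * G (q x) P - w x * G (q x) Q) \<partial>lborel)" by (rule integral_norm_bound)
  also have "\<dots> \<le> (\<integral>x. norm (w x) * (B * dist P Q) \<partial>lborel)"
  proof (rule integral_mono)
    fix x
    show "norm (w x * G (q x) P - w x * G (q x) Q) \<le> norm (w x) * (B * dist P Q)"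
      unfolding right_diff_distrib[symmetric] norm_mult
      using lipschitz_onD[OF G_lipschitz[of "q x"] PQ] by (intro mult_left_mono) (auto simp: dist_norm)
  qed (use int w in auto)
  finally show "dist (\<integral>x. w x * G (q x) P \<partial>lborel) (\<integral>x. w x * G (q x) Q \<partial>lborel) \<le> B * (\<integral>x. norm (w x) \<partial>lborel) * dist P Q"
    by (simp add: mult_ac)
qed

text \<open>For a simple q the integral is a finite sum of members of the family, weighted by the
  integrals \<open>a y\<close> of w over the level sets of q, and T commutes with finite
  sums.\<close>

lemma pairing_integral_simple:
  assumes w: "integrable lborel w" and q: "simple_function lborel q"
  shows "T (\<lambda>P. \<integral>x. w x * G (q x) P \<partial>lborel) = (\<integral>x. w x * T (G (q x)) \<partial>lborel)"
proof -
  define a where "a y = (\<integral>x. w x * indicator (q -` {y}) x \<partial>lborel)" for y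
  have fin: "finite (range q)" using simple_functionD(1)[OF q] by simp
  have meas: "q -` {y} \<in> sets lborel" for y using simple_functionD(2)[OF q, of "{y}"] by simp
  have int: "integrable lborel (\<lambda>x. w x * indicator (q -` {y}) x)" for y
    using integrable_mult_indicator[OF meas w, of y] by (simp add: scaleR_conv_of_real mult.commute of_real_indicator)
  \<comment> \<open>F is arbitrary because the expansion serves twice, for \<open>G y P\<close> with
    P fixed and for \<open>T (G y)\<close>.\<close>
  have expand: "(\<integral>x. w x * F (q x) \<partial>lborel) = (\<Sum>y\<in>range q. a y * F y)" for F :: "'b \<Rightarrow> complex"
  proof -
    have "w x * F (q x) = (\<Sum>y\<in>range q. (w x * indicator (q -` {y}) x) * F y)" for x
    proof -
      have "(\<Sum>y\<in>range q. (w x * indicator (q -` {y}) x) * F y) = (\<Sum>y\<in>range q. if y = q x then w x * F (q x) else 0)"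
        by (rule sum.cong) (auto simp: indicator_def)
      also have "\<dots> = w x * F (q x)" using fin by (simp add: sum.delta)
      finally show ?thesis by simp
    qed
    then have "(\<integral>x. w x * F (q x) \<partial>lborel) = (\<integral>x. (\<Sum>y\<in>range q. (w x * indicator (q -` {y}) x) * F y) \<partial>lborel)" by simp
    also have "\<dots> = (\<Sum>y\<in>range q. a y * F y)"
      using int by (subst Bochner_Integration.integral_sum) (auto simp: a_def)
    finally show ?thesis .
  qed
  have "T (\<lambda>P. \<integral>x. w x * G (q x) P \<partial>lborel) = T (\<lambda>P. \<Sum>y\<in>range q. a y * G y P)"
    by (rule arg_cong[where f = T]) (rule ext, rule expand)
  also have "\<dots> = (\<Sum>y\<in>range q. a y * T (G y))"
    using T_sum[OF fin, of B G a] G_lipschitz by simp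
  also have "\<dots> = (\<integral>x. w x * T (G (q x)) \<partial>lborel)" by (rule expand[symmetric])
  finally show ?thesis .
qed

text \<open>Simple functions \<open>q k\<close> tend pointwise to the identity. The integrals
  \<open>F k\<close> then converge to \<open>F0\<close> uniformly on K, and all of them have
  Lipschitz constant at most \<open>B * W\<close>, so \<open>T_bound\<close> carries the formula for
  simple functions to the limit on the left; dominated convergence does so on the right.\<close>

theorem pairing_integral:
  assumes w: "integrable lborel w"
  shows "T (\<lambda>P. \<integral>x. w x * G x P \<partial>lborel) = (\<integral>x. w x * T (G x) \<partial>lborel)"
proof -
  have "(\<lambda>x. x) \<in> borel_measurable (lborel :: 'b measure)" by simp
  from borel_measurable_implies_sequence_metric[OF this, of 0]
  obtain q where "(\<forall>k. simple_function (lborel :: 'b measure) (q k)) \<and> (\<forall>x\<in>space (lborel :: 'b measure). (\<lambda>k. q k x) \<longlonglongrightarrow> x)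
     \<and> (\<forall>k. \<forall>x\<in>space (lborel :: 'b measure). dist (q k x) 0 \<le> 2 * dist x 0)" by (rule exE)
  then have q: "\<And>k. simple_function lborel (q k)" and lim: "\<And>x. (\<lambda>k. q k x) \<longlonglongrightarrow> x" by simp_all
  have qm: "q k \<in> borel_measurable borel" for k using borel_measurable_simple_function[OF q] by simp
  have [measurable]: "q k \<in> borel_measurable lborel" for k using qm by simp
  have idm: "(\<lambda>x. x) \<in> borel_measurable (borel :: 'b measure)" by simp
  have [measurable]: "w \<in> borel_measurable lborel" using borel_measurable_integrable[OF w] .
  define F where "F k P = (\<integral>x. w x * G (q k x) P \<partial>lborel)" for k P
  define F0 where "F0 P = (\<integral>x. w x * G x P \<partial>lborel)" for P
  define W where "W = (\<integral>x. norm (w x) \<partial>lborel)"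
  have FL: "(B * W)-lipschitz_on K (F k)" for k unfolding F_def W_def by (rule lipschitz_integral[OF w qm])
  have F0L: "(B * W)-lipschitz_on K F0" unfolding F0_def W_def by (rule lipschitz_integral[OF w idm])
  \<comment> \<open>The bound \<open>2 * B\<close> supplies the integrable majorant,
    \<open>B * dist (q k x) x\<close> the pointwise limit 0.\<close>
  define a where "a k = (\<integral>x. norm (w x) * min (2 * B) (B * dist (q k x) x) \<partial>lborel)" for k
  have am: "(\<lambda>x. norm (w x) * min (2 * B) (B * dist (q k x) x)) \<in> borel_measurable lborel" for k
    by (intro borel_measurable_times borel_measurable_norm borel_measurable_min borel_measurable_const borel_measurable_dist) simp_all
  have aint: "integrable lborel (\<lambda>x. norm (w x) * min (2 * B) (B * dist (q k x) x))" for k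
  proof (rule Bochner_Integration.integrable_bound[of _ "\<lambda>x. norm (w x) * (2 * B)"])
    show "AE x in lborel. norm (norm (w x) * min (2 * B) (B * dist (q k x) x)) \<le> norm (norm (w x) * (2 * B))"
      using B_nonneg by (intro AE_I2) (auto simp: abs_mult intro!: mult_left_mono)
    show "integrable lborel (\<lambda>x. norm (w x) * (2 * B))" using w by simp
    show "(\<lambda>x. norm (w x) * min (2 * B) (B * dist (q k x) x)) \<in> borel_measurable lborel" by (rule am)
  qed
  have a0: "0 \<le> a k" for k unfolding a_def by (rule Bochner_Integration.integral_nonneg) (use B_nonneg in auto)
  have "(\<lambda>k. \<integral>x. norm (w x) * min (2 * B) (B * dist (q k x) x) \<partial>lborel) \<longlonglongrightarrow> (\<integral>x. 0 \<partial>(lborel :: 'b measure))"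
  proof (rule integral_dominated_convergence[of "\<lambda>x. 0" lborel "\<lambda>k x. norm (w x) * min (2 * B) (B * dist (q k x) x)" "\<lambda>x. norm (w x) * (2 * B)"])
    show "AE x in lborel. (\<lambda>k. norm (w x) * min (2 * B) (B * dist (q k x) x)) \<longlonglongrightarrow> 0"
    proof (rule AE_I2)
      fix x
      have "(\<lambda>k. dist (q k x) x) \<longlonglongrightarrow> 0" by (rule tendsto_dist_iff[THEN iffD1, OF lim])
      then have "(\<lambda>k. norm (w x) * min (2 * B) (B * dist (q k x) x)) \<longlonglongrightarrow> norm (w x) * min (2 * B) (B * 0)"
        by (intro tendsto_intros)
      then show "(\<lambda>k. norm (w x) * min (2 * B) (B * dist (q k x) x)) \<longlonglongrightarrow> 0" using B_nonneg by simp
    qed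
    show "AE x in lborel. norm (norm (w x) * min (2 * B) (B * dist (q k x) x)) \<le> norm (w x) * (2 * B)" for k
      using B_nonneg by (intro AE_I2) (auto simp: abs_mult intro!: mult_left_mono)
    show "integrable lborel (\<lambda>x. norm (w x) * (2 * B))" using w by simp
    show "(\<lambda>x. norm (w x) * min (2 * B) (B * dist (q k x) x)) \<in> borel_measurable lborel" for k by (rule am)
  qed simp
  then have a_lim: "a \<longlonglongrightarrow> 0" unfolding a_def[abs_def] by simp
  have diff: "cmod (F k P - F0 P) \<le> a k" if P: "P \<in> K" for k P
  proof -
    note int = family_integrable[OF w qm P, of k] family_integrable[OF w idm P]
    have "cmod (F k P - F0 P) = norm (\<integral>x. w x * G (q k x) P - w x * G x P \<partial>lborel)"
      unfolding F_def F0_def using int by simp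
    also have "\<dots> \<le> (\<integral>x. norm (w x * G (q k x) P - w x * G x P) \<partial>lborel)" by (rule integral_norm_bound)
    also have "\<dots> \<le> a k" unfolding a_def
    proof (rule integral_mono)
      fix x
      show "norm (w x * G (q k x) P - w x * G x P) \<le> norm (w x) * min (2 * B) (B * dist (q k x) x)"
        unfolding right_diff_distrib[symmetric] norm_mult
        using G_lipschitz_param[OF P, of "q k x" x] G_bound[OF P, of "q k x"] G_bound[OF P, of x] norm_triangle_ineq4[of "G (q k x) P" "G x P"]
        by (intro mult_left_mono) auto
    qed (use int aint in auto)
    finally show ?thesis .
  qed
  have "(\<lambda>k. T (F k)) \<longlonglongrightarrow> T F0"
  proof (rule LIM_zero_cancel, rule Lim_null_comparison)
    show "\<forall>\<^sub>F k in sequentially. norm (T (F k) - T F0) \<le> C * sqrt (a k * (a k + (B * W + B * W)))"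
    proof (rule always_eventually, rule allI)
      fix k
      show "norm (T (F k) - T F0) \<le> C * sqrt (a k * (a k + (B * W + B * W)))"
        unfolding T_diff[OF FL F0L, symmetric]
        by (rule T_bound[OF a0 diff lipschitz_on_diff[OF FL F0L]])
    qed
    have "(\<lambda>k. C * sqrt (a k * (a k + (B * W + B * W)))) \<longlonglongrightarrow> C * sqrt (0 * (0 + (B * W + B * W)))"
      by (intro tendsto_intros a_lim)
    then show "(\<lambda>k. C * sqrt (a k * (a k + (B * W + B * W)))) \<longlonglongrightarrow> 0" by simp
  qed
  moreover have "T (F k) = (\<integral>x. w x * T (G (q k x)) \<partial>lborel)" for k
    unfolding F_def by (rule pairing_integral_simple[OF w q])
  moreover have "(\<lambda>k. \<integral>x. w x * T (G (q k x)) \<partial>lborel) \<longlonglongrightarrow> (\<integral>x. w x * T (G x) \<partial>lborel)"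
  proof (rule integral_dominated_convergence[of "\<lambda>x. w x * T (G x)" lborel "\<lambda>k x. w x * T (G (q k x))" "\<lambda>x. norm (w x) * (C * sqrt (B * (B + B)))"])
    show "AE x in lborel. (\<lambda>k. w x * T (G (q k x))) \<longlonglongrightarrow> w x * T (G x)"
      by (intro AE_I2 tendsto_intros family_tendsto lim)
    show "AE x in lborel. norm (w x * T (G (q k x))) \<le> norm (w x) * (C * sqrt (B * (B + B)))" for k
      unfolding norm_mult by (intro AE_I2 mult_left_mono[OF family_bound]) simp
    show "(\<lambda>x. w x * T (G x)) \<in> borel_measurable lborel" using integrable_family_pairing[OF w idm] by simp
    show "(\<lambda>x. w x * T (G (q k x))) \<in> borel_measurable lborel" for k using integrable_family_pairing[OF w qm] by simp
    show "integrable lborel (\<lambda>x. norm (w x) * (C * sqrt (B * (B + B))))" using w by simp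
  qed
  ultimately have "T F0 = (\<integral>x. w x * T (G x) \<partial>lborel)"
    by (simp add: LIMSEQ_unique)
  then show ?thesis unfolding F0_def .
qed

end

section \<open>Riesz potentials of bounded integrable functions\<close>

text \<open>With \<open>t = r' / r\<close> the claim becomes
  \<open>1 - t powr (- a) \<le> a * (t - 1)\<close>, which follows from
  \<open>ln t \<le> t - 1\<close> and \<open>exp u \<ge> 1 + u\<close>.\<close>

lemma powr_minus_diff_le:
  fixes r r' a :: real
  assumes r: "0 < r" "r \<le> r'" and a: "0 \<le> a"
  shows "r powr (- a) - r' powr (- a) \<le> a * r powr (- a - 1) * (r' - r)"
proof -
  define t where "t = r' / r"
  have t: "1 \<le> t" "r' = t * r" using r by (auto simp: t_def)
  have "1 - a * (t - 1) \<le> 1 + (- a * ln t)"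
    using ln_le_minus_one[of t] t a by (auto intro!: mult_left_mono)
  also have "\<dots> \<le> exp (- a * ln t)" by (rule exp_ge_add_one_self)
  also have "\<dots> = t powr (- a)" using t by (simp add: powr_def)
  finally have "1 - t powr (- a) \<le> a * (t - 1)" by linarith
  then have "r powr (- a) * (1 - t powr (- a)) \<le> r powr (- a) * (a * (t - 1))"
    by (rule mult_left_mono) simp
  moreover have "r powr (- a) * (1 - t powr (- a)) = r powr (- a) - r' powr (- a)"
    unfolding t(2) using t r by (simp add: powr_mult algebra_simps)
  moreover have "r powr (- a) * (a * (t - 1)) = a * r powr (- a - 1) * (r' - r)"
    using r by (simp add: powr_diff t(2) field_simps)
  ultimately show ?thesis by simp
qed

text \<open>The bound m is left free: it becomes the sum of the two powers for the Riesz kernel, and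
  \<open>\<epsilon> powr (- a - 1)\<close> for the truncated kernel.\<close>

lemma powr_minus_abs_diff_le:
  fixes r r' a m :: real
  assumes "0 < r" "0 < r'" "0 \<le> a" "r powr (- a - 1) \<le> m" "r' powr (- a - 1) \<le> m"
  shows "\<bar>r powr (- a) - r' powr (- a)\<bar> \<le> a * m * \<bar>r - r'\<bar>"
proof -
  have *: "\<bar>p powr (- a) - q powr (- a)\<bar> \<le> a * m * \<bar>p - q\<bar>"
    if "0 < p" "p \<le> q" "p powr (- a - 1) \<le> m" for p q
  proof -
    have "q powr (- a) \<le> p powr (- a)" using that assms(3) by (intro powr_mono2') auto
    then have "\<bar>p powr (- a) - q powr (- a)\<bar> = p powr (- a) - q powr (- a)" by simp
    also have "\<dots> \<le> a * p powr (- a - 1) * (q - p)" by (rule powr_minus_diff_le) (use that assms in auto)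
    also have "\<dots> \<le> a * m * (q - p)" using that assms(3) by (intro mult_right_mono mult_left_mono) auto
    finally show ?thesis using that by simp
  qed
  show ?thesis
  proof (cases "r \<le> r'")
    case True then show ?thesis using * assms by simp
  next
    case False
    then have "r' \<le> r" by simp
    from *[OF assms(2) this assms(5)] show ?thesis by (simp add: abs_minus_commute)
  qed
qed

lemma riesz_integral_bound:
  assumes b: "0 \<le> b" "b < real DIM('a::euclidean_space)"
  obtains c where "0 \<le> c" "\<And>h :: 'a \<Rightarrow> complex. \<And>A Q. integrable lborel h \<Longrightarrow> (\<And>x. cmod (h x) \<le> A) \<Longrightarrow>
     integrable lborel (\<lambda>x. norm (x - Q) powr (- b) * norm (h x)) \<and>
     (\<integral>x. norm (x - Q) powr (- b) * norm (h x) \<partial>lborel) \<le> c * A + (\<integral>x. norm (h x) \<partial>lborel)"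
proof -
  define c where "c = unit_ball_vol (real DIM('a)) * 2 powr b / (1 - 2 powr (b - real DIM('a)))"
  have lt1: "(2::real) powr (b - real DIM('a)) < 1"
    using powr_less_mono[of "b - real DIM('a)" 0 2] b by simp
  show ?thesis
  proof (rule that[of c])
    show c0: "0 \<le> c" unfolding c_def using lt1 by (intro divide_nonneg_nonneg mult_nonneg_nonneg) auto
    fix h :: "'a \<Rightarrow> complex" and A Q
    assume h: "integrable lborel h" and hA: "\<And>x. cmod (h x) \<le> A"
    have [measurable]: "h \<in> borel_measurable borel" using borel_measurable_integrable[OF h] by simp
    have A0: "0 \<le> A" using hA[of 0] norm_ge_zero[of "h 0"] by linarith
    have I0: "0 \<le> (\<integral>x. norm (h x) \<partial>lborel)" by simp
    have "(\<integral>\<^sup>+x. ennreal (norm (x - Q) powr (- b) * norm (h x)) \<partial>lborel)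
      \<le> ennreal (A * c) + (\<integral>\<^sup>+x. ennreal (norm (h x)) \<partial>lborel)"
      unfolding c_def using nn_integral_dist_powr_mult_le[of "\<lambda>x. norm (h x)" A b Q] hA b
      by (simp add: dist_norm norm_minus_commute)
    also have "(\<integral>\<^sup>+x. ennreal (norm (h x)) \<partial>lborel) = ennreal (\<integral>x. norm (h x) \<partial>lborel)"
      by (rule nn_integral_eq_integral) (use h in auto)
    also have "ennreal (A * c) + ennreal (\<integral>x. norm (h x) \<partial>lborel) = ennreal (c * A + (\<integral>x. norm (h x) \<partial>lborel))"
      using A0 c0 I0 by (subst ennreal_plus[symmetric]) (auto simp: mult.commute)
    finally have le: "(\<integral>\<^sup>+x. ennreal (norm (x - Q) powr (- b) * norm (h x)) \<partial>lborel) \<le> ennreal (c * A + (\<integral>x. norm (h x) \<partial>lborel))" .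
    have int: "integrable lborel (\<lambda>x. norm (x - Q) powr (- b) * norm (h x))"
      by (rule integrableI_bounded) (use le in \<open>auto simp: abs_mult intro: le_less_trans\<close>)
    have "ennreal (\<integral>x. norm (x - Q) powr (- b) * norm (h x) \<partial>lborel) \<le> ennreal (c * A + (\<integral>x. norm (h x) \<partial>lborel))"
      using le nn_integral_eq_integral[OF int] by simp
    then have "(\<integral>x. norm (x - Q) powr (- b) * norm (h x) \<partial>lborel) \<le> c * A + (\<integral>x. norm (h x) \<partial>lborel)"
      using c0 A0 I0 by (subst (asm) ennreal_le_iff) (auto intro!: add_nonneg_nonneg mult_nonneg_nonneg)
    with int show "integrable lborel (\<lambda>x. norm (x - Q) powr (- b) * norm (h x)) \<and>
     (\<integral>x. norm (x - Q) powr (- b) * norm (h x) \<partial>lborel) \<le> c * A + (\<integral>x. norm (h x) \<partial>lborel)" by simp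
  qed
qed

text \<open>The factor \<open>riesz_const\<close> is left out here and restored where the Fourier
  transform is computed.\<close>

definition riesz_potential :: "real \<Rightarrow> ('a::euclidean_space \<Rightarrow> complex) \<Rightarrow> 'a \<Rightarrow> complex" where
  "riesz_potential a h Q = (\<integral>x. complex_of_real (norm (x - Q) powr (- a)) * h x \<partial>lborel)"

text \<open>The last clause splits the kernel at a free radius \<open>\<rho>\<close>. It makes the
  potential uniformly small when the integral of \<open>norm (h x)\<close> is small although the
  bound A on h does not shrink, as happens for restrictions of h to thin neighbourhoods of the
  boundary.\<close>

definition riesz_potential_bounded :: "real \<Rightarrow> real \<Rightarrow> ('a::euclidean_space \<Rightarrow> complex) \<Rightarrow> real \<Rightarrow> bool" where
  "riesz_potential_bounded a c h A \<longleftrightarrow>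
     (\<forall>Q. integrable lborel (\<lambda>x. complex_of_real (norm (x - Q) powr (- a)) * h x)) \<and>
     (c * (A + (\<integral>x. norm (h x) \<partial>lborel)))-lipschitz_on UNIV (riesz_potential a h) \<and>
     (\<forall>Q. cmod (riesz_potential a h Q) \<le> c * (A + (\<integral>x. norm (h x) \<partial>lborel))) \<and>
     (\<forall>Q \<rho>. 0 < \<rho> \<longrightarrow> cmod (riesz_potential a h Q) \<le> \<rho> * (c * (A + (\<integral>x. norm (h x) \<partial>lborel))) + \<rho> powr (- a) * (\<integral>x. norm (h x) \<partial>lborel))"

text \<open>The kernels with poles P and Q differ by at most \<open>a * dist P Q\<close> times the
  sum of the kernels of order \<open>a + 1\<close> at these poles, and this order is still below the
  dimension. The kernel of order \<open>a + 1\<close> also governs the small radii in the last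
  clause of \<open>riesz_potential_bounded\<close>.\<close>

lemma riesz_potential_bounds:
  assumes a: "0 < a" "a + 1 < real DIM('a::euclidean_space)"
  obtains c where "0 \<le> c" "\<And>h :: 'a \<Rightarrow> complex. \<And>A. integrable lborel h \<Longrightarrow> (\<And>x. cmod (h x) \<le> A) \<Longrightarrow> riesz_potential_bounded a c h A"
proof -
  have pe: "- (a + 1) = - a - 1" by simp
  have b1: "0 \<le> a" "a < real DIM('a)" and b2: "0 \<le> a + 1" "a + 1 < real DIM('a)" using a by auto
  obtain c1 where c1: "0 \<le> c1" "\<And>h :: 'a \<Rightarrow> complex. \<And>A Q. integrable lborel h \<Longrightarrow> (\<And>x. cmod (h x) \<le> A) \<Longrightarrow>
     integrable lborel (\<lambda>x. norm (x - Q) powr (- a) * norm (h x)) \<and>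
     (\<integral>x. norm (x - Q) powr (- a) * norm (h x) \<partial>lborel) \<le> c1 * A + (\<integral>x. norm (h x) \<partial>lborel)"
  proof (rule riesz_integral_bound[OF b1], goal_cases)
    case 1
    show ?case by (rule 1(1)[OF 1(2-)])
  qed
  obtain c2 where c2: "0 \<le> c2" "\<And>h :: 'a \<Rightarrow> complex. \<And>A Q. integrable lborel h \<Longrightarrow> (\<And>x. cmod (h x) \<le> A) \<Longrightarrow>
     integrable lborel (\<lambda>x. norm (x - Q) powr (- (a + 1)) * norm (h x)) \<and>
     (\<integral>x. norm (x - Q) powr (- (a + 1)) * norm (h x) \<partial>lborel) \<le> c2 * A + (\<integral>x. norm (h x) \<partial>lborel)"
  proof (rule riesz_integral_bound[OF b2], goal_cases)
    case 1
    show ?case by (rule 1(1)[OF 1(2-)])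
  qed
  \<comment> \<open>Chosen to dominate the bounds for both kernels as well as the factor
    \<open>2 * a\<close> that arises from the two poles.\<close>
  define c where "c = (1 + 2 * a) * (c1 + c2 + 1)"
  have c0: "0 \<le> c" unfolding c_def using c1(1) c2(1) a by simp
  have cc: "c1 * A + I \<le> c * (A + I) \<and> c2 * A + I \<le> c * (A + I) \<and> 2 * a * (c2 * A + I) \<le> c * (A + I)" if "0 \<le> A" "0 \<le> I" for A I
  proof -
    have 1: "c1 * A + I \<le> (c1 + c2 + 1) * (A + I)" "c2 * A + I \<le> (c1 + c2 + 1) * (A + I)"
      using that c1(1) c2(1) by (auto simp: algebra_simps)
    have 2: "0 \<le> (c1 + c2 + 1) * (A + I)" using that c1(1) c2(1) by simp
    have 3: "c * (A + I) = (c1 + c2 + 1) * (A + I) + 2 * a * ((c1 + c2 + 1) * (A + I))"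
      unfolding c_def by (simp add: algebra_simps)
    have 4: "2 * a * (c2 * A + I) \<le> 2 * a * ((c1 + c2 + 1) * (A + I))" using 1(2) a by (intro mult_left_mono) auto
    have 5: "0 \<le> 2 * a * ((c1 + c2 + 1) * (A + I))" using 2 a by simp
    show ?thesis unfolding 3 using 1 2 4 5 by linarith
  qed
  show ?thesis
  proof (rule that[of c, OF c0])
    fix h :: "'a \<Rightarrow> complex" and A
    assume h: "integrable lborel h" and hA: "\<And>x. cmod (h x) \<le> A"
    have [measurable]: "h \<in> borel_measurable borel" using borel_measurable_integrable[OF h] by simp
    have A0: "0 \<le> A" using hA[of 0] norm_ge_zero[of "h 0"] by linarith
    define I where "I = (\<integral>x. norm (h x) \<partial>lborel)"
    have I0: "0 \<le> I" by (simp add: I_def)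
    note i1 = c1(2)[OF h hA, THEN conjunct1] and i2 = c2(2)[OF h hA, THEN conjunct1]
    have v1: "(\<integral>x. norm (x - Q) powr (- a) * norm (h x) \<partial>lborel) \<le> c * (A + I)" for Q
      using c1(2)[OF h hA, of Q, THEN conjunct2] cc[OF A0 I0] unfolding I_def by linarith
    have v2: "(\<integral>x. norm (x - Q) powr (- (a + 1)) * norm (h x) \<partial>lborel) \<le> c2 * A + I" for Q
      unfolding I_def by (rule c2(2)[OF h hA, of Q, THEN conjunct2])
    have int: "integrable lborel (\<lambda>x. complex_of_real (norm (x - Q) powr (- a)) * h x)" for Q
      by (rule Bochner_Integration.integrable_bound[OF i1[of Q]]) (auto simp: norm_mult)
    have le: "cmod (riesz_potential a h Q) \<le> (\<integral>x. norm (x - Q) powr (- a) * norm (h x) \<partial>lborel)" for Q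
      unfolding riesz_potential_def by (rule order_trans[OF integral_norm_bound]) (simp add: norm_mult)
    have lip: "(c * (A + I))-lipschitz_on UNIV (riesz_potential a h)"
    proof (rule lipschitz_onI)
      show "0 \<le> c * (A + I)" using c0 A0 I0 by simp
      fix P Q :: 'a
      let ?k = "\<lambda>Q x. complex_of_real (norm (x - Q) powr (- a)) * h x"
      let ?m = "\<lambda>x. a * dist P Q * (norm (x - P) powr (- (a + 1)) * norm (h x)) + a * dist P Q * (norm (x - Q) powr (- (a + 1)) * norm (h x))"
      have mi: "integrable lborel ?m" using i2[of P] i2[of Q] by simp
      have "dist (riesz_potential a h P) (riesz_potential a h Q) = norm (\<integral>x. ?k P x - ?k Q x \<partial>lborel)"
        unfolding riesz_potential_def using int[of P] int[of Q] by (simp add: dist_norm)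
      also have "\<dots> \<le> (\<integral>x. norm (?k P x - ?k Q x) \<partial>lborel)" by (rule integral_norm_bound)
      also have "\<dots> \<le> (\<integral>x. ?m x \<partial>lborel)"
      proof (rule integral_mono_AE)
        show "integrable lborel (\<lambda>x. norm (?k P x - ?k Q x))" using int[of P] int[of Q] by simp
        show "integrable lborel ?m" by (rule mi)
        \<comment> \<open>The poles are removed because the estimate for differences of powers
          requires positive distances.\<close>
        have "AE x in lborel. x \<noteq> P \<and> x \<noteq> Q" using AE_lborel_singleton[of P] AE_lborel_singleton[of Q] by simp
        then show "AE x in lborel. norm (?k P x - ?k Q x) \<le> ?m x"
        proof eventually_elim
          case (elim x)
          let ?r = "norm (x - P)" and ?r' = "norm (x - Q)"
          have "\<bar>?r powr (- a) - ?r' powr (- a)\<bar> \<le> a * (?r powr (- a - 1) + ?r' powr (- a - 1)) * \<bar>?r - ?r'\<bar>"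
            by (rule powr_minus_abs_diff_le) (use elim a in auto)
          also have "\<bar>?r - ?r'\<bar> \<le> dist P Q" using norm_triangle_ineq3[of "x - P" "x - Q"] by (simp add: dist_norm norm_minus_commute)
          finally have 1: "\<bar>?r powr (- a) - ?r' powr (- a)\<bar> \<le> a * (?r powr (- a - 1) + ?r' powr (- a - 1)) * dist P Q"
            using a by (simp add: mult_left_mono)
          have "norm (?k P x - ?k Q x) = \<bar>?r powr (- a) - ?r' powr (- a)\<bar> * norm (h x)"
            unfolding left_diff_distrib[symmetric] norm_mult of_real_diff[symmetric] norm_of_real by (rule refl)
          also have "\<dots> \<le> a * (?r powr (- a - 1) + ?r' powr (- a - 1)) * dist P Q * norm (h x)"
            using 1 by (rule mult_right_mono) simp
          also have "\<dots> = ?m x" unfolding pe by (simp only: distrib_left distrib_right mult_ac)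
          finally show ?case .
        qed
      qed
      also have "\<dots> = a * dist P Q * (\<integral>x. norm (x - P) powr (- (a + 1)) * norm (h x) \<partial>lborel) + a * dist P Q * (\<integral>x. norm (x - Q) powr (- (a + 1)) * norm (h x) \<partial>lborel)"
        using i2[of P] i2[of Q] by simp
      also have "\<dots> \<le> a * dist P Q * (c2 * A + I) + a * dist P Q * (c2 * A + I)"
        using a by (intro add_mono mult_left_mono v2) auto
      also have "\<dots> = 2 * a * (c2 * A + I) * dist P Q" by simp
      also have "\<dots> \<le> c * (A + I) * dist P Q" using cc[OF A0 I0] by (intro mult_right_mono) auto
      finally show "dist (riesz_potential a h P) (riesz_potential a h Q) \<le> c * (A + I) * dist P Q" .
    qed
    have near: "cmod (riesz_potential a h Q) \<le> \<rho> * (c * (A + I)) + \<rho> powr (- a) * I" if \<rho>: "0 < \<rho>" for Q \<rho>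
    proof -
      have "(\<integral>x. norm (x - Q) powr (- a) * norm (h x) \<partial>lborel)
        \<le> (\<integral>x. \<rho> * (norm (x - Q) powr (- (a + 1)) * norm (h x)) + \<rho> powr (- a) * norm (h x) \<partial>lborel)"
      proof (rule integral_mono)
        show "integrable lborel (\<lambda>x. norm (x - Q) powr (- a) * norm (h x))" by (rule i1)
        show "integrable lborel (\<lambda>x. \<rho> * (norm (x - Q) powr (- (a + 1)) * norm (h x)) + \<rho> powr (- a) * norm (h x))"
          using i2[of Q] h by simp
        fix x :: 'a
        \<comment> \<open>Within radius \<open>\<rho>\<close> a factor \<open>norm (x - Q)\<close>
          is split off and bounded by \<open>\<rho>\<close>; outside, the kernel is at most its
          value at \<open>\<rho>\<close>.\<close>
        have "norm (x - Q) powr (- a) \<le> \<rho> * norm (x - Q) powr (- (a + 1)) + \<rho> powr (- a)"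
        proof (cases "norm (x - Q) \<le> \<rho>")
          case True
          have "norm (x - Q) powr (- a) = norm (x - Q) * norm (x - Q) powr (- (a + 1))"
            by (cases "x = Q") (simp_all add: powr_mult_base)
          also have "\<dots> \<le> \<rho> * norm (x - Q) powr (- (a + 1))" using True by (rule mult_right_mono) simp
          finally show ?thesis by (simp add: add_increasing2)
        next
          case False
          then have "norm (x - Q) powr (- a) \<le> \<rho> powr (- a)" using \<rho> a by (intro powr_mono2') auto
          then show ?thesis using \<rho> by (simp add: add_increasing)
        qed
        from mult_right_mono[OF this norm_ge_zero[of "h x"]]
        show "norm (x - Q) powr (- a) * norm (h x) \<le> \<rho> * (norm (x - Q) powr (- (a + 1)) * norm (h x)) + \<rho> powr (- a) * norm (h x)"
          by (simp add: distrib_right mult.assoc)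
      qed
      also have "\<dots> = \<rho> * (\<integral>x. norm (x - Q) powr (- (a + 1)) * norm (h x) \<partial>lborel) + \<rho> powr (- a) * I"
        using i2[of Q] h by (simp add: I_def)
      also have "\<dots> \<le> \<rho> * (c * (A + I)) + \<rho> powr (- a) * I"
        using \<rho> cc[OF A0 I0] v2[of Q] by (intro add_right_mono mult_left_mono) auto
      finally show ?thesis using le[of Q] by linarith
    qed
    show "riesz_potential_bounded a c h A"
      using int lip near order_trans[OF le v1] unfolding riesz_potential_bounded_def I_def by (intro conjI allI impI)
  qed
qed

section \<open>The layer potential and its duality with Riesz potentials\<close>

text \<open>Raising distances to at least \<open>\<epsilon>\<close> bounds the slope of the kernel
  by \<open>a * \<epsilon> powr (- a - 1)\<close>. Both variables move at once, so that one estimate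
  yields the Lipschitz bounds in the boundary point and in the parameter.\<close>

lemma lipschitz_truncated_kernel:
  fixes a \<epsilon> :: real
  assumes a: "0 \<le> a" and \<epsilon>: "0 < \<epsilon>"
  shows "\<bar>max \<epsilon> (norm (x - P)) powr (- a) - max \<epsilon> (norm (y - Q)) powr (- a)\<bar> \<le> a * \<epsilon> powr (- a - 1) * (dist x y + dist P Q)"
proof -
  have m: "max \<epsilon> r powr (- a - 1) \<le> \<epsilon> powr (- a - 1)" for r
    using powr_mono2'[of "- a - 1" \<epsilon> "max \<epsilon> r"] a \<epsilon> by simp
  have "norm (x - P) - norm (y - Q) \<le> norm ((x - y) - (P - Q))" "norm (y - Q) - norm (x - P) \<le> norm ((x - y) - (P - Q))"
    using norm_triangle_ineq3[of "x - P" "y - Q"] by (simp_all add: algebra_simps)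
  then have "\<bar>max \<epsilon> (norm (x - P)) - max \<epsilon> (norm (y - Q))\<bar> \<le> dist x y + dist P Q"
    using norm_triangle_ineq4[of "x - y" "P - Q"] unfolding dist_norm by linarith
  then have "a * \<epsilon> powr (- a - 1) * \<bar>max \<epsilon> (norm (x - P)) - max \<epsilon> (norm (y - Q))\<bar> \<le> a * \<epsilon> powr (- a - 1) * (dist x y + dist P Q)"
    using a by (intro mult_left_mono) auto
  moreover have "\<bar>max \<epsilon> (norm (x - P)) powr (- a) - max \<epsilon> (norm (y - Q)) powr (- a)\<bar> \<le> a * \<epsilon> powr (- a - 1) * \<bar>max \<epsilon> (norm (x - P)) - max \<epsilon> (norm (y - Q))\<bar>"
    by (rule powr_minus_abs_diff_le) (use \<epsilon> a m in auto)
  ultimately show ?thesis by linarith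
qed

context lipschitz_functional
begin

text \<open>The value 0 on K agrees with the convention for u in the theorem, and it makes the
  cut-offs to \<open>far \<epsilon>\<close> converge at every point of space.\<close>

definition layer_potential :: "real \<Rightarrow> 'a \<Rightarrow> complex" where
  "layer_potential a x = (if x \<in> K then 0 else T (\<lambda>Q. complex_of_real (norm (x - Q) powr (- a))))"

definition far :: "real \<Rightarrow> 'a set" where
  "far \<epsilon> = {x. \<forall>Q\<in>K. \<epsilon> \<le> dist x Q}"

lemma far_measurable [measurable]: "far \<epsilon> \<in> sets borel"
proof -
  have "far \<epsilon> = (\<Inter>Q\<in>K. {x. \<epsilon> \<le> dist x Q})" by (auto simp: far_def)
  moreover have "closed (\<Inter>Q\<in>K. {x. \<epsilon> \<le> dist x Q})"
    by (intro closed_INT ballI closed_Collect_le continuous_intros)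
  ultimately show ?thesis by simp
qed

lemma far_disjoint: "0 < \<epsilon> \<Longrightarrow> x \<in> far \<epsilon> \<Longrightarrow> x \<notin> K"
  unfolding far_def by fastforce

lemma eventually_far:
  assumes "x \<notin> K"
  shows "\<forall>\<^sub>F k in sequentially. x \<in> far (1 / real (Suc k))"
proof -
  obtain d where d: "0 < d" "\<forall>y\<in>K. d \<le> dist x y"
    using separate_point_closed[OF compact_imp_closed[OF compact_K] assms] by blast
  have "\<forall>\<^sub>F k in sequentially. 1 / real (Suc k) < d"
    using order_tendstoD(2)[OF LIMSEQ_inverse_real_of_nat d(1)] by (simp add: inverse_eq_divide)
  then show ?thesis
    by eventually_elim (use d in \<open>auto simp: far_def intro: less_imp_le less_le_trans\<close>)
qed

lemma far_mono: "\<epsilon> \<le> \<delta> \<Longrightarrow> far \<delta> \<subseteq> far \<epsilon>"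
  unfolding far_def by (auto intro: order_trans)

lemma truncated_family:
  assumes a: "0 \<le> a" and \<epsilon>: "0 < \<epsilon>"
  shows "lipschitz_family K T C (\<lambda>x Q. complex_of_real (max \<epsilon> (norm (x - Q)) powr (- a))) (\<epsilon> powr (- a) + a * \<epsilon> powr (- a - 1))"
proof
  let ?B = "\<epsilon> powr (- a) + a * \<epsilon> powr (- a - 1)"
  have le: "a * \<epsilon> powr (- a - 1) \<le> ?B" by simp
  show B0: "0 \<le> ?B" using a by simp
  show "cmod (complex_of_real (max \<epsilon> (norm (x - P)) powr (- a))) \<le> ?B" for x P
  proof -
    have "max \<epsilon> (norm (x - P)) powr (- a) \<le> \<epsilon> powr (- a)" using a \<epsilon> by (intro powr_mono2') auto
    also have "\<dots> \<le> ?B" using a by simp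
    finally show ?thesis by simp
  qed
  show "?B-lipschitz_on K (\<lambda>Q. complex_of_real (max \<epsilon> (norm (x - Q)) powr (- a)))" for x
  proof (rule lipschitz_onI[OF _ B0])
    fix P Q
    have "\<bar>max \<epsilon> (norm (x - P)) powr (- a) - max \<epsilon> (norm (x - Q)) powr (- a)\<bar> \<le> a * \<epsilon> powr (- a - 1) * dist P Q"
      using lipschitz_truncated_kernel[OF a \<epsilon>, of x P x Q] by simp
    also have "\<dots> \<le> ?B * dist P Q" using le by (rule mult_right_mono) simp
    finally show "dist (complex_of_real (max \<epsilon> (norm (x - P)) powr (- a))) (complex_of_real (max \<epsilon> (norm (x - Q)) powr (- a))) \<le> ?B * dist P Q"
      by (simp add: dist_norm of_real_diff[symmetric] del: of_real_diff)
  qed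
  show "cmod (complex_of_real (max \<epsilon> (norm (x - P)) powr (- a)) - complex_of_real (max \<epsilon> (norm (y - P)) powr (- a))) \<le> ?B * dist x y" for x y P
  proof -
    have "\<bar>max \<epsilon> (norm (x - P)) powr (- a) - max \<epsilon> (norm (y - P)) powr (- a)\<bar> \<le> a * \<epsilon> powr (- a - 1) * dist x y"
      using lipschitz_truncated_kernel[OF a \<epsilon>, of x P y P] by simp
    also have "\<dots> \<le> ?B * dist x y" using le by (rule mult_right_mono) simp
    finally show ?thesis by (simp add: of_real_diff[symmetric] del: of_real_diff)
  qed
qed

lemma truncated_eq_far:
  assumes "x \<in> far \<epsilon>" "Q \<in> K"
  shows "max \<epsilon> (norm (x - Q)) = norm (x - Q)"
  using assms by (auto simp: far_def dist_norm)

text \<open>For x in \<open>far \<epsilon>\<close> the truncation changes the kernel at no point of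
  K, and values off K do not affect the pairing.\<close>

lemma layer_potential_far:
  assumes a: "0 \<le> a" and \<epsilon>: "0 < \<epsilon>" and x: "x \<in> far \<epsilon>"
  shows "layer_potential a x = T (\<lambda>Q. complex_of_real (max \<epsilon> (norm (x - Q)) powr (- a)))"
proof -
  interpret G: lipschitz_family K T C "\<lambda>x Q. complex_of_real (max \<epsilon> (norm (x - Q)) powr (- a))" "\<epsilon> powr (- a) + a * \<epsilon> powr (- a - 1)"
    by (rule truncated_family[OF a \<epsilon>])
  have "T (\<lambda>Q. complex_of_real (max \<epsilon> (norm (x - Q)) powr (- a))) = T (\<lambda>Q. complex_of_real (norm (x - Q) powr (- a)))"
    by (rule T_cong[OF G.G_lipschitz]) (simp add: truncated_eq_far[OF x])
  then show ?thesis using far_disjoint[OF \<epsilon> x] by (simp add: layer_potential_def)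
qed

text \<open>Where the cut-off weight w is nonzero, the kernel coincides on K with its truncation,
  and the truncated kernels form a family to which \<open>pairing_integral\<close> applies. The two
  functions of Q agree on K only, hence the use of \<open>T_cong\<close>.\<close>

lemma pairing_far:
  assumes a: "0 \<le> a" and \<epsilon>: "0 < \<epsilon>" and h: "integrable lborel h"
  shows "integrable lborel (\<lambda>x. indicator (far \<epsilon>) x * (layer_potential a x * h x))"
    and "T (riesz_potential a (\<lambda>x. indicator (far \<epsilon>) x * h x)) = (\<integral>x. indicator (far \<epsilon>) x * (layer_potential a x * h x) \<partial>lborel)"
proof -
  interpret G: lipschitz_family K T C "\<lambda>x Q. complex_of_real (max \<epsilon> (norm (x - Q)) powr (- a))" "\<epsilon> powr (- a) + a * \<epsilon> powr (- a - 1)"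
    by (rule truncated_family[OF a \<epsilon>])
  let ?G = "\<lambda>x Q. complex_of_real (max \<epsilon> (norm (x - Q)) powr (- a))"
  define w where "w x = indicator (far \<epsilon>) x * h x" for x
  have w: "integrable lborel w" unfolding w_def
    using integrable_mult_indicator[OF _ h, of "far \<epsilon>"] by (simp add: scaleR_conv_of_real of_real_indicator)
  have idm: "(\<lambda>x. x) \<in> borel_measurable (borel :: 'a measure)" by simp
  have e1: "w x * T (?G x) = indicator (far \<epsilon>) x * (layer_potential a x * h x)" for x
    using layer_potential_far[OF a \<epsilon>, of x] by (simp add: w_def indicator_def)
  have e2: "w x * ?G x Q = complex_of_real (norm (x - Q) powr (- a)) * w x" if "Q \<in> K" for x Q
    using truncated_eq_far[of x \<epsilon> Q] that by (simp add: w_def indicator_def)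
  show "integrable lborel (\<lambda>x. indicator (far \<epsilon>) x * (layer_potential a x * h x))"
    using G.integrable_family_pairing[OF w idm] by (simp only: e1)
  have "T (riesz_potential a w) = T (\<lambda>Q. \<integral>x. w x * ?G x Q \<partial>lborel)"
  proof (rule T_cong[symmetric])
    show "((\<epsilon> powr (- a) + a * \<epsilon> powr (- a - 1)) * (\<integral>x. norm (w x) \<partial>lborel))-lipschitz_on K (\<lambda>Q. \<integral>x. w x * ?G x Q \<partial>lborel)"
      by (rule G.lipschitz_integral[OF w idm])
    show "(\<integral>x. w x * ?G x Q \<partial>lborel) = riesz_potential a w Q" if "Q \<in> K" for Q
      unfolding riesz_potential_def e2[OF that] by (rule refl)
  qed
  also have "\<dots> = (\<integral>x. w x * T (?G x) \<partial>lborel)" by (rule G.pairing_integral[OF w])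
  finally show "T (riesz_potential a (\<lambda>x. indicator (far \<epsilon>) x * h x)) = (\<integral>x. indicator (far \<epsilon>) x * (layer_potential a x * h x) \<partial>lborel)"
    unfolding e1 unfolding w_def[abs_def] .
qed

lemma far_tendsto:
  "(\<lambda>k. indicator (far (1 / real (Suc k))) x * (layer_potential a x * z)) \<longlonglongrightarrow> layer_potential a x * z"
proof (cases "x \<in> K")
  case True then show ?thesis by (simp add: layer_potential_def)
next
  case False
  show ?thesis
    by (rule tendsto_eventually, rule eventually_mono[OF eventually_far[OF False]]) simp
qed

text \<open>Cut off to \<open>far \<epsilon>\<close>, the potential equals a pairing with truncated
  kernels, which is continuous in x; the cut-offs converge pointwise.\<close>

lemma layer_potential_measurable:
  assumes a: "0 \<le> a"
  shows "layer_potential a \<in> borel_measurable borel"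
proof (rule borel_measurable_LIMSEQ_metric)
  fix k
  let ?\<epsilon> = "1 / real (Suc k)"
  have \<epsilon>: "0 < ?\<epsilon>" by simp
  interpret G: lipschitz_family K T C "\<lambda>x Q. complex_of_real (max ?\<epsilon> (norm (x - Q)) powr (- a))" "?\<epsilon> powr (- a) + a * ?\<epsilon> powr (- a - 1)"
    by (rule truncated_family[OF a \<epsilon>])
  have "(\<lambda>x. indicator (far ?\<epsilon>) x * T (\<lambda>Q. complex_of_real (max ?\<epsilon> (norm (x - Q)) powr (- a)))) \<in> borel_measurable borel"
    by (intro borel_measurable_times G.family_measurable borel_measurable_indicator far_measurable)
  moreover have "(\<lambda>x. indicator (far ?\<epsilon>) x * T (\<lambda>Q. complex_of_real (max ?\<epsilon> (norm (x - Q)) powr (- a)))) = (\<lambda>x. indicator (far ?\<epsilon>) x * (layer_potential a x * 1))"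
    using layer_potential_far[OF a \<epsilon>] by (auto simp: fun_eq_iff indicator_def)
  ultimately show "(\<lambda>x. indicator (far ?\<epsilon>) x * (layer_potential a x * 1)) \<in> borel_measurable borel" by simp
next
  show "(\<lambda>k. indicator (far (1 / real (Suc k))) x * (layer_potential a x * 1)) \<longlonglongrightarrow> layer_potential a x" for x
    using far_tendsto[of x a 1] by simp
qed

text \<open>Duality: pairing T with the Riesz potential of the unimodular multiple of h that makes the
  integrand nonnegative bounds the integral of the modulus, uniformly in the cut-off.\<close>

lemma layer_potential_integrable:
  assumes a: "0 < a" "a + 1 < real DIM('a)" and h: "integrable lborel h" and hA: "\<And>x. cmod (h x) \<le> A"
  shows "integrable lborel (\<lambda>x. layer_potential a x * h x)"
proof -
  have a0: "0 \<le> a" using a by simp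
  obtain c where c: "0 \<le> c" and bounded: "\<And>h :: 'a \<Rightarrow> complex. \<And>A. integrable lborel h \<Longrightarrow> (\<And>x. cmod (h x) \<le> A) \<Longrightarrow> riesz_potential_bounded a c h A"
  proof (rule riesz_potential_bounds[OF a], goal_cases)
    case 1
    show ?case by (rule 1(1)[OF 1(2-)])
  qed
  note bd = bounded[unfolded riesz_potential_bounded_def]
  have A0: "0 \<le> A" using hA[of 0] norm_ge_zero[of "h 0"] by linarith
  note [measurable] = layer_potential_measurable[OF a0]
  have [measurable]: "h \<in> borel_measurable borel" using borel_measurable_integrable[OF h] by simp
  define v where "v x = layer_potential a x * h x" for x
  have [measurable]: "v \<in> borel_measurable borel" unfolding v_def by measurable
  define h' where "h' x = h x * cnj (sgn (v x))" for x
  have sgn1: "norm (sgn z) \<le> 1" for z :: complex by (simp add: norm_sgn)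
  have h'le: "norm (h' x) \<le> norm (h x)" for x
    unfolding h'_def norm_mult complex_mod_cnj using mult_left_mono[OF sgn1[of "v x"], of "norm (h x)"] by simp
  have [measurable]: "cnj \<in> borel_measurable borel" by (intro borel_measurable_continuous_onI continuous_intros)
  have [measurable]: "(\<lambda>x. sgn (v x)) \<in> borel_measurable borel" unfolding sgn_div_norm by measurable
  have [measurable]: "h' \<in> borel_measurable borel" unfolding h'_def by measurable
  have h': "integrable lborel h'"
    by (rule Bochner_Integration.integrable_bound[OF h]) (auto simp: h'le)
  have vv: "layer_potential a x * h' x = complex_of_real (norm (v x))" for x
  proof -
    have "layer_potential a x * h' x = v x * cnj (sgn (v x))" by (simp add: h'_def v_def)
    also have "\<dots> = complex_of_real (norm (v x))"
      by (cases "v x = 0") (simp_all add: sgn_div_norm scaleR_conv_of_real complex_norm_square[symmetric] power2_eq_square field_simps)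
    finally show ?thesis .
  qed
  define I where "I = (\<integral>x. norm (h x) \<partial>lborel)"
  have I0: "0 \<le> I" by (simp add: I_def)
  define L where "L = c * (A + I)"
  have L0: "0 \<le> L" using c A0 I0 by (simp add: L_def)
  define M where "M = C * sqrt (L * (L + L))"
  define f where "f k x = ennreal (indicator (far (1 / real (Suc k))) x * norm (v x))" for k x
  have fM: "(\<integral>\<^sup>+x. f k x \<partial>lborel) \<le> ennreal M" for k
  proof -
    let ?F = "far (1 / real (Suc k))"
    let ?w = "\<lambda>x. indicator ?F x * h' x"
    have \<epsilon>: "0 < 1 / real (Suc k)" by simp
    have w: "integrable lborel ?w"
      using integrable_mult_indicator[OF _ h', of ?F] by (simp add: scaleR_conv_of_real of_real_indicator)
    have wle: "norm (?w x) \<le> norm (h x)" for x using h'le[of x] by (simp add: indicator_def)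
    have wI: "(\<integral>x. norm (?w x) \<partial>lborel) \<le> I"
      unfolding I_def by (rule integral_mono) (use w h wle in auto)
    have wA: "cmod (?w x) \<le> A" for x using order_trans[OF wle hA] .
    have wL: "c * (A + (\<integral>x. norm (?w x) \<partial>lborel)) \<le> L" unfolding L_def using wI c by (intro mult_left_mono) auto
    note b = bd[OF w wA]
    \<comment> \<open>M is formed from the data of h alone: cutting off and multiplying by factors
      of modulus at most 1 increase neither the supremum nor the integral of the modulus.\<close>
    have "cmod (T (riesz_potential a ?w)) \<le> M" unfolding M_def
    proof (rule T_bound[OF L0])
      show "cmod (riesz_potential a ?w x) \<le> L" for x using b wL by (meson order_trans)
      show "L-lipschitz_on K (riesz_potential a ?w)" using b wL lipschitz_on_mono by blast
    qed
    moreover have e: "indicator ?F x * (layer_potential a x * h' x) = complex_of_real (indicator ?F x * norm (v x))" for x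
      unfolding vv by (simp add: indicator_def)
    ultimately have "cmod (\<integral>x. complex_of_real (indicator ?F x * norm (v x)) \<partial>lborel) \<le> M"
      using pairing_far(2)[OF a0 \<epsilon> h'] by simp
    then have le: "(\<integral>x. indicator ?F x * norm (v x) \<partial>lborel) \<le> M"
      unfolding integral_complex_of_real norm_of_real by linarith
    have int: "integrable lborel (\<lambda>x. indicator ?F x * norm (v x))"
      using pairing_far(1)[OF a0 \<epsilon> h'] unfolding e by (simp only: complex_of_real_integrable_eq)
    have "(\<integral>\<^sup>+x. f k x \<partial>lborel) = ennreal (\<integral>x. indicator ?F x * norm (v x) \<partial>lborel)"
      unfolding f_def by (rule nn_integral_eq_integral[OF int]) simp
    then show ?thesis using le by (simp add: ennreal_leI)
  qed
  \<comment> \<open>The cut-off sets increase to the complement of K and v is 0 on K, so this is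
    monotone convergence.\<close>
  have "(\<lambda>k. \<integral>\<^sup>+x. f k x \<partial>lborel) \<longlonglongrightarrow> (\<integral>\<^sup>+x. ennreal (norm (v x)) \<partial>lborel)"
  proof (rule nn_integral_LIMSEQ)
    show "incseq f"
    proof (rule incseq_SucI, rule le_funI)
      fix k x
      have "far (1 / real (Suc k)) \<subseteq> far (1 / real (Suc (Suc k)))" by (rule far_mono) (simp add: field_simps)
      then show "f k x \<le> f (Suc k) x" unfolding f_def by (intro ennreal_leI mult_right_mono) (auto simp: indicator_def)
    qed
    show "f k \<in> borel_measurable lborel" for k unfolding f_def by measurable
    show "(\<lambda>k. f k x) \<longlonglongrightarrow> ennreal (norm (v x))" for x
    proof -
      have "(\<lambda>k. norm (indicator (far (1 / real (Suc k))) x * v x)) \<longlonglongrightarrow> norm (v x)"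
        unfolding v_def by (intro tendsto_norm far_tendsto)
      then have "(\<lambda>k. indicator (far (1 / real (Suc k))) x * norm (v x)) \<longlonglongrightarrow> norm (v x)"
        by (rule Lim_transform_eventually) (auto intro!: always_eventually simp: indicator_def)
      then show ?thesis unfolding f_def by (intro tendsto_ennrealI)
    qed
  qed
  then have "(\<integral>\<^sup>+x. ennreal (norm (v x)) \<partial>lborel) \<le> ennreal M"
    by (rule LIMSEQ_le_const2) (use fM in auto)
  then have "integrable lborel v"
    by (intro integrableI_bounded) (auto intro: le_less_trans)
  then show ?thesis unfolding v_def .
qed

text \<open>Since K is null, the part \<open>near k\<close> of h close to K tends to 0 in L^1,
  though not necessarily in supremum. Splitting the kernel turns this into uniform smallness of its
  potential, while the Lipschitz constants stay below L. The pairing of that potential thus tends to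
  0, and \<open>pairing_far\<close> accounts for the rest.\<close>

theorem layer_potential_pairing:
  assumes a: "0 < a" "a + 1 < real DIM('a)" and null: "K \<in> null_sets lborel"
    and h: "integrable lborel h" and hA: "\<And>x. cmod (h x) \<le> A"
  shows "T (riesz_potential a h) = (\<integral>x. layer_potential a x * h x \<partial>lborel)"
proof -
  have a0: "0 \<le> a" using a by simp
  obtain c where c: "0 \<le> c" and bounded: "\<And>h :: 'a \<Rightarrow> complex. \<And>A. integrable lborel h \<Longrightarrow> (\<And>x. cmod (h x) \<le> A) \<Longrightarrow> riesz_potential_bounded a c h A"
  proof (rule riesz_potential_bounds[OF a], goal_cases)
    case 1
    show ?case by (rule 1(1)[OF 1(2-)])
  qed
  note bd = bounded[unfolded riesz_potential_bounded_def]
  have A0: "0 \<le> A" using hA[of 0] norm_ge_zero[of "h 0"] by linarith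
  note [measurable] = layer_potential_measurable[OF a0]
  have [measurable]: "h \<in> borel_measurable borel" using borel_measurable_integrable[OF h] by simp
  define F where "F k = far (1 / real (Suc k))" for k
  have [measurable]: "F k \<in> sets borel" for k unfolding F_def by measurable
  have \<epsilon>: "0 < 1 / real (Suc k)" for k by simp
  define near where "near k x = (1 - indicator (F k) x) * h x" for k x
  have fi: "integrable lborel (\<lambda>x. indicator (F k) x * h x)" for k
    using integrable_mult_indicator[OF _ h, of "F k"] by (simp add: scaleR_conv_of_real of_real_indicator)
  have near_eq: "near k = (\<lambda>x. h x - indicator (F k) x * h x)" for k
    unfolding near_def by (simp add: fun_eq_iff left_diff_distrib)
  have ni: "integrable lborel (near k)" for k unfolding near_eq using h fi by simp
  have nle: "norm (near k x) \<le> norm (h x)" for k x unfolding near_def by (simp add: indicator_def)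
  have nA: "cmod (near k x) \<le> A" for k x using order_trans[OF nle hA] .
  define e where "e k = (\<integral>x. norm (near k x) \<partial>lborel)" for k
  have e0: "0 \<le> e k" for k by (simp add: e_def)
  have "(\<lambda>k. \<integral>x. norm (near k x) \<partial>lborel) \<longlonglongrightarrow> (\<integral>x. 0 \<partial>(lborel :: 'a measure))"
  proof (rule integral_dominated_convergence[of "\<lambda>x. 0" lborel "\<lambda>k x. norm (near k x)" "\<lambda>x. norm (h x)"])
    have "AE x in lborel. x \<notin> K" using null by (rule AE_not_in)
    then show "AE x in lborel. (\<lambda>k. norm (near k x)) \<longlonglongrightarrow> 0"
    proof eventually_elim
      case (elim x)
      show ?case
        by (rule tendsto_eventually, rule eventually_mono[OF eventually_far[OF elim]]) (simp add: near_def F_def)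
    qed
    show "AE x in lborel. norm (norm (near k x)) \<le> norm (h x)" for k using nle by simp
    show "(\<lambda>x. norm (near k x)) \<in> borel_measurable lborel" for k
      using borel_measurable_integrable[OF ni] by measurable
  qed (use h in auto)
  then have e_lim: "e \<longlonglongrightarrow> 0" unfolding e_def[abs_def] by simp
  define I where "I = (\<integral>x. norm (h x) \<partial>lborel)"
  have eI: "e k \<le> I" for k unfolding e_def I_def by (rule integral_mono) (use ni h nle in auto)
  have I0: "0 \<le> I" by (simp add: I_def)
  define L where "L = c * (A + I)"
  have L0: "0 \<le> L" using c A0 I0 by (simp add: L_def)
  have neL: "c * (A + e k) \<le> L" for k unfolding L_def using eI c by (intro mult_left_mono) auto
  \<comment> \<open>This radius makes \<open>\<rho> k powr (- a) * e k\<close> at most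
    \<open>\<rho> k\<close>, so that both terms of the splitting are of order
    \<open>\<rho> k\<close>. The summand \<open>1 / real (Suc k)\<close> keeps the radius positive
    even when \<open>e k = 0\<close>.\<close>
  define \<rho> where "\<rho> k = (e k + 1 / real (Suc k)) powr (1 / (a + 1))" for k
  have pos: "0 < e k + 1 / real (Suc k)" for k using e0[of k] \<epsilon>[of k] by linarith
  have \<rho>0: "0 < \<rho> k" for k unfolding \<rho>_def using pos[of k] by simp
  have \<rho>pow: "\<rho> k powr (a + 1) = e k + 1 / real (Suc k)" for k
    unfolding \<rho>_def using pos[of k] a by (simp add: powr_powr)
  have "(\<lambda>k. 1 / real (Suc k)) \<longlonglongrightarrow> 0" using LIMSEQ_inverse_real_of_nat by (simp add: inverse_eq_divide)
  then have base: "(\<lambda>k. e k + 1 / real (Suc k)) \<longlonglongrightarrow> 0" using tendsto_add[OF e_lim] by simp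
  have "\<rho> \<longlonglongrightarrow> 0 powr (1 / (a + 1))" unfolding \<rho>_def[abs_def]
    by (rule tendsto_powr2[OF base tendsto_const]) (use pos a in \<open>auto intro!: always_eventually less_imp_le\<close>)
  then have \<rho>_lim: "\<rho> \<longlonglongrightarrow> 0" by simp
  define s where "s k = \<rho> k * (L + 1)" for k
  have s0: "0 \<le> s k" for k unfolding s_def using \<rho>0[of k] L0 by simp
  have s_lim: "s \<longlonglongrightarrow> 0" unfolding s_def[abs_def] using tendsto_mult_left_zero[OF \<rho>_lim] by simp
  have nb: "cmod (riesz_potential a (near k) Q) \<le> s k" for k Q
  proof -
    have "cmod (riesz_potential a (near k) Q) \<le> \<rho> k * (c * (A + e k)) + \<rho> k powr (- a) * e k"
      using bd[OF ni nA] \<rho>0[of k] unfolding e_def by blast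
    also have "\<dots> \<le> \<rho> k * L + \<rho> k powr (- a) * \<rho> k powr (a + 1)"
      using \<rho>0[of k] neL by (intro add_mono mult_left_mono) (auto simp: \<rho>pow)
    also have "\<rho> k powr (- a) * \<rho> k powr (a + 1) = \<rho> k" using \<rho>0[of k] by (simp add: powr_add[symmetric])
    finally show ?thesis by (simp add: s_def algebra_simps)
  qed
  have nL: "L-lipschitz_on K (riesz_potential a (near k))" for k
    using bd[OF ni nA, of k] neL[of k] lipschitz_on_mono unfolding e_def by blast
  have hL: "L-lipschitz_on K (riesz_potential a h)"
    using bd[OF h hA] lipschitz_on_mono unfolding L_def I_def by blast
  have split: "riesz_potential a (\<lambda>x. indicator (F k) x * h x) = (\<lambda>Q. riesz_potential a h Q - riesz_potential a (near k) Q)" for k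
  proof
    fix Q
    have "riesz_potential a h Q - riesz_potential a (near k) Q = (\<integral>x. complex_of_real (norm (x - Q) powr (- a)) * h x - complex_of_real (norm (x - Q) powr (- a)) * near k x \<partial>lborel)"
      unfolding riesz_potential_def using bd[OF h hA] bd[OF ni nA, of k] by (intro Bochner_Integration.integral_diff[symmetric]) auto
    also have "\<dots> = riesz_potential a (\<lambda>x. indicator (F k) x * h x) Q"
      unfolding riesz_potential_def near_def by (rule Bochner_Integration.integral_cong) (simp_all add: algebra_simps)
    finally show "riesz_potential a (\<lambda>x. indicator (F k) x * h x) Q = riesz_potential a h Q - riesz_potential a (near k) Q" by simp
  qed
  have "(\<lambda>k. T (riesz_potential a (near k))) \<longlonglongrightarrow> 0"
  proof (rule Lim_null_comparison)
    show "\<forall>\<^sub>F k in sequentially. norm (T (riesz_potential a (near k))) \<le> C * sqrt (s k * (s k + L))"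
      using T_bound[OF s0 nb nL] by (intro always_eventually) simp
    have "(\<lambda>k. C * sqrt (s k * (s k + L))) \<longlonglongrightarrow> C * sqrt (0 * (0 + L))" by (intro tendsto_intros s_lim)
    then show "(\<lambda>k. C * sqrt (s k * (s k + L))) \<longlonglongrightarrow> 0" by simp
  qed
  then have "(\<lambda>k. T (riesz_potential a h) - T (riesz_potential a (near k))) \<longlonglongrightarrow> T (riesz_potential a h) - 0"
    by (intro tendsto_diff tendsto_const)
  moreover have "T (riesz_potential a h) - T (riesz_potential a (near k)) = (\<integral>x. indicator (F k) x * (layer_potential a x * h x) \<partial>lborel)" for k
    using pairing_far(2)[OF a0 \<epsilon> h, of k] T_diff[OF hL nL, of k] split[of k] unfolding F_def by simp
  moreover have "(\<lambda>k. \<integral>x. indicator (F k) x * (layer_potential a x * h x) \<partial>lborel) \<longlonglongrightarrow> (\<integral>x. layer_potential a x * h x \<partial>lborel)"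
  proof (rule integral_dominated_convergence[of "\<lambda>x. layer_potential a x * h x" lborel "\<lambda>k x. indicator (F k) x * (layer_potential a x * h x)" "\<lambda>x. norm (layer_potential a x * h x)"])
    show "integrable lborel (\<lambda>x. norm (layer_potential a x * h x))"
      using layer_potential_integrable[OF a h hA] by simp
    show "AE x in lborel. (\<lambda>k. indicator (F k) x * (layer_potential a x * h x)) \<longlonglongrightarrow> layer_potential a x * h x"
      unfolding F_def using far_tendsto by (intro AE_I2)
    show "AE x in lborel. norm (indicator (F k) x * (layer_potential a x * h x)) \<le> norm (layer_potential a x * h x)" for k
      by (intro AE_I2) (simp add: indicator_def)
    show "(\<lambda>x. layer_potential a x * h x) \<in> borel_measurable lborel" by measurable
    show "(\<lambda>x. indicator (F k) x * (layer_potential a x * h x)) \<in> borel_measurable lborel" for k by measurable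
  qed
  ultimately show ?thesis by (simp add: LIMSEQ_unique)
qed

end

section \<open>Fourier transforms of Schwartz functions\<close>

lemma dyadic_ge_1:
  fixes r :: real
  assumes "1 \<le> r"
  obtains k :: nat where "2 ^ k \<le> r" "r < 2 ^ Suc k"
proof -
  obtain m :: nat where m: "r < 2 ^ m" using real_arch_pow[of 2 r] by auto
  define k where "k = (LEAST k. r < 2 ^ Suc k)"
  have "r < 2 ^ Suc m" using m by (rule less_trans) simp
  then have 1: "r < 2 ^ Suc k" unfolding k_def by (rule LeastI)
  have 2: "2 ^ k \<le> r"
  proof (cases k)
    case 0 then show ?thesis using assms by simp
  next
    case (Suc j)
    then have "\<not> r < 2 ^ Suc j" using not_less_Least[of j "\<lambda>k. r < 2 ^ Suc k"] k_def by simp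
    then show ?thesis using Suc by simp
  qed
  from 2 1 show ?thesis by (rule that)
qed

text \<open>Let n be the dimension. Where \<open>1 + norm x\<close> lies between
  \<open>2 ^ j\<close> and \<open>2 ^ Suc j\<close>, the integrand is at most
  \<open>1 / (2 ^ j) ^ Suc n\<close>, and the enclosing ball has volume of order
  \<open>(2 ^ j) ^ n\<close>. The products form a geometric series of ratio 1/2.\<close>

lemma integrable_inverse_power_norm:
  "integrable lborel (\<lambda>x::'a::euclidean_space. 1 / (1 + norm x) ^ Suc DIM('a))"
proof -
  let ?n = "DIM('a)"
  let ?S = "\<lambda>j::nat. {x::'a. norm x < 2 ^ Suc j}"
  let ?c = "unit_ball_vol (real ?n) * 2 ^ ?n"
  have [measurable]: "?S j \<in> sets borel" for j by measurable
  have "(\<integral>\<^sup>+x. ennreal (1 / (1 + norm (x::'a)) ^ Suc ?n) \<partial>lborel) \<le> (\<integral>\<^sup>+x. (\<Sum>j. ennreal (1 / (2 ^ j) ^ Suc ?n) * indicator (?S j) x) \<partial>lborel)"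
  proof (rule nn_integral_mono)
    fix x :: 'a
    obtain j where j: "2 ^ j \<le> 1 + norm x" "1 + norm x < 2 ^ Suc j"
      using dyadic_ge_1[of "1 + norm x"] by auto
    have "1 / (1 + norm x) ^ Suc ?n \<le> 1 / (2 ^ j) ^ Suc ?n"
      using j by (intro divide_left_mono power_mono mult_pos_pos zero_less_power) (auto intro: add_pos_nonneg)
    then have "ennreal (1 / (1 + norm x) ^ Suc ?n) \<le> ennreal (1 / (2 ^ j) ^ Suc ?n) * indicator (?S j) x"
      using j by (simp add: ennreal_leI)
    also have "\<dots> = sum (\<lambda>j. ennreal (1 / (2 ^ j) ^ Suc ?n) * indicator (?S j) x) {j}" by (simp del: sum_mult_indicator)
    also have "\<dots> \<le> (\<Sum>j. ennreal (1 / (2 ^ j) ^ Suc ?n) * indicator (?S j) x)"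
      by (rule sum_le_suminf) auto
    finally show "ennreal (1 / (1 + norm x) ^ Suc ?n) \<le> (\<Sum>j. ennreal (1 / (2 ^ j) ^ Suc ?n) * indicator (?S j) x)" .
  qed
  also have "\<dots> = (\<Sum>j. ennreal (1 / (2 ^ j) ^ Suc ?n) * emeasure lborel (?S j))"
    by (subst nn_integral_suminf) (simp_all add: nn_integral_cmult_indicator)
  also have "\<dots> = (\<Sum>j. ennreal (?c * (1 / 2) ^ j))"
  proof (rule suminf_cong)
    fix j :: nat
    have "?S j = ball 0 (2 ^ Suc j)" by (auto simp: ball_def)
    then have "emeasure lborel (?S j) = ennreal (unit_ball_vol (real ?n) * (2 ^ Suc j) ^ ?n)"
      by (simp add: emeasure_ball)
    then have "ennreal (1 / (2 ^ j) ^ Suc ?n) * emeasure lborel (?S j) = ennreal (1 / (2 ^ j) ^ Suc ?n * (unit_ball_vol (real ?n) * (2 ^ Suc j) ^ ?n))"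
      by (simp add: ennreal_mult'[symmetric])
    also have "1 / (2 ^ j) ^ Suc ?n * (unit_ball_vol (real ?n) * (2 ^ Suc j) ^ ?n) = ?c * (1 / 2) ^ j"
      by (simp add: power_mult_distrib field_simps)
    finally show "ennreal (1 / (2 ^ j) ^ Suc ?n) * emeasure lborel (?S j) = ennreal (?c * (1 / 2) ^ j)" .
  qed
  also have "\<dots> = ennreal (\<Sum>j. ?c * (1 / 2) ^ j)"
    by (rule suminf_ennreal2) (auto intro!: summable_mult summable_geometric)
  also have "\<dots> < \<infinity>" by simp
  finally have "(\<integral>\<^sup>+x. ennreal (norm (1 / (1 + norm (x::'a)) ^ Suc ?n)) \<partial>lborel) < \<infinity>" by simp
  then show ?thesis by (intro integrableI_bounded) auto
qed

lemma integrable_decay: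
  fixes f :: "'a::euclidean_space \<Rightarrow> complex"
  assumes "f \<in> borel_measurable borel" "\<And>x. norm (f x) \<le> c / (1 + norm x) ^ Suc DIM('a)"
  shows "integrable lborel f"
proof (rule Bochner_Integration.integrable_bound)
  show "integrable lborel (\<lambda>x::'a. c * (1 / (1 + norm x) ^ Suc DIM('a)))"
    by (rule integrable_mult_right) (rule integrable_inverse_power_norm)
  show "f \<in> borel_measurable lborel" using assms(1) by simp
  show "AE x in lborel. norm (f x) \<le> norm (c * (1 / (1 + norm x) ^ Suc DIM('a)))"
  proof (rule AE_I2)
    fix x
    have "norm (f x) \<le> c * (1 / (1 + norm x) ^ Suc DIM('a))" using assms(2)[of x] by simp
    also have "\<dots> \<le> norm (c * (1 / (1 + norm x) ^ Suc DIM('a)))" unfolding real_norm_def by (rule abs_ge_self)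
    finally show "norm (f x) \<le> norm (c * (1 / (1 + norm x) ^ Suc DIM('a)))" .
  qed
qed

lemma cis_measurable [measurable]: "cis \<in> borel_measurable borel"
  by (intro borel_measurable_continuous_onI continuous_on_cis continuous_on_id)

lemma fourier_measurable:
  fixes f :: "real^'n \<Rightarrow> complex"
  assumes [measurable]: "f \<in> borel_measurable borel"
  shows "fourier f \<in> borel_measurable borel"
proof -
  have "(\<lambda>\<xi>. \<integral>x. cis (2 * pi * (x \<bullet> \<xi>)) * f x \<partial>lborel) \<in> borel_measurable borel"
    by (rule lborel.borel_measurable_lebesgue_integral) measurable
  then show ?thesis unfolding fourier_def[abs_def] .
qed

lemma fourier_integrand:
  assumes f: "integrable lborel f"
  shows "integrable lborel (\<lambda>x. cis (2 * pi * (x \<bullet> \<xi>)) * f x)"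
proof (rule Bochner_Integration.integrable_bound[OF f])
  have [measurable]: "f \<in> borel_measurable borel" using borel_measurable_integrable[OF f] by simp
  show "(\<lambda>x. cis (2 * pi * (x \<bullet> \<xi>)) * f x) \<in> borel_measurable lborel" by measurable
qed (simp add: norm_mult)

lemma norm_fourier_le:
  "cmod (fourier f \<xi>) \<le> (\<integral>x. norm (f x) \<partial>lborel)"
  unfolding fourier_def by (rule order_trans[OF integral_norm_bound]) (simp add: norm_mult)

lemma lborel_integral_translate:
  fixes f :: "'a::euclidean_space \<Rightarrow> complex"
  assumes [measurable]: "f \<in> borel_measurable borel"
  shows "(\<integral>x. f (x + c) \<partial>lborel) = (\<integral>x. f x \<partial>lborel)"
proof -
  have "(\<integral>x. f x \<partial>lborel) = (\<integral>x. f x \<partial>(distr lborel borel ((+) c)))" by (simp add: lborel_distr_plus)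
  also have "\<dots> = (\<integral>x. f (c + x) \<partial>lborel)" by (rule integral_distr) measurable
  finally show ?thesis by (simp add: add.commute)
qed

lemma fourier_translate:
  assumes [measurable]: "f \<in> borel_measurable borel"
  shows "fourier (\<lambda>x. f (x + c)) \<xi> = cis (- (2 * pi * (c \<bullet> \<xi>))) * fourier f \<xi>"
proof -
  have "fourier (\<lambda>x. f (x + c)) \<xi> = (\<integral>x. cis (2 * pi * ((x + c - c) \<bullet> \<xi>)) * f (x + c) \<partial>lborel)"
    unfolding fourier_def by simp
  also have "\<dots> = (\<integral>x. cis (2 * pi * ((x - c) \<bullet> \<xi>)) * f x \<partial>lborel)"
    by (rule lborel_integral_translate[of "\<lambda>x. cis (2 * pi * ((x - c) \<bullet> \<xi>)) * f x" c]) measurable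
  also have "\<dots> = (\<integral>x. cis (- (2 * pi * (c \<bullet> \<xi>))) * (cis (2 * pi * (x \<bullet> \<xi>)) * f x) \<partial>lborel)"
  proof (rule Bochner_Integration.integral_cong)
    fix x
    have "2 * pi * ((x - c) \<bullet> \<xi>) = - (2 * pi * (c \<bullet> \<xi>)) + 2 * pi * (x \<bullet> \<xi>)"
      by (simp add: inner_diff_left algebra_simps)
    then show "cis (2 * pi * ((x - c) \<bullet> \<xi>)) * f x = cis (- (2 * pi * (c \<bullet> \<xi>))) * (cis (2 * pi * (x \<bullet> \<xi>)) * f x)"
      by (simp only: cis_mult[symmetric] mult.assoc)
  qed simp
  also have "\<dots> = cis (- (2 * pi * (c \<bullet> \<xi>))) * fourier f \<xi>" unfolding fourier_def by simp
  finally show ?thesis .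
qed

lemma has_vector_derivative_quotient:
  fixes f :: "real \<Rightarrow> 'b::real_normed_vector"
  assumes "(f has_vector_derivative d) (at 0)"
  shows "((\<lambda>h. (f h - f 0) /\<^sub>R h) \<longlongrightarrow> d) (at 0)"
proof -
  have lim: "((\<lambda>h. norm (f (0 + h) - f 0 - h *\<^sub>R d) / norm h) \<longlongrightarrow> 0) (at 0)"
    using assms unfolding has_vector_derivative_def has_derivative_at by (rule conjunct2)
  have eq: "norm (f (0 + h) - f 0 - h *\<^sub>R d) / norm h = norm ((f h - f 0) /\<^sub>R h - d)" if "h \<noteq> 0" for h
  proof -
    have "(f h - f 0) /\<^sub>R h - d = (f h - f 0 - h *\<^sub>R d) /\<^sub>R h" using that by (simp add: scaleR_right_diff_distrib)
    then have "norm ((f h - f 0) /\<^sub>R h - d) = norm (f h - f 0 - h *\<^sub>R d) / norm h"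
      by (simp only: norm_scaleR norm_inverse divide_inverse mult.commute abs_inverse real_norm_def)
    then show ?thesis by (simp only: add_0_left)
  qed
  have "eventually (\<lambda>h. norm (f (0 + h) - f 0 - h *\<^sub>R d) / norm h = norm ((f h - f 0) /\<^sub>R h - d)) (at 0)"
    unfolding eventually_at_filter by (intro always_eventually allI impI eq)
  with lim have "((\<lambda>h. norm ((f h - f 0) /\<^sub>R h - d)) \<longlongrightarrow> 0) (at 0)"
    by (rule Lim_transform_eventually)
  then show ?thesis by (rule LIM_zero_cancel[OF tendsto_norm_zero_cancel])
qed

text \<open>The Schwartz condition gives derivatives at parameter 0 from every base point; moving
  the base point gives them at every parameter of the line, as the mean value inequality
  requires.\<close>

lemma has_vector_derivative_along_line:
  fixes g :: "'a::real_normed_vector \<Rightarrow> 'b::real_normed_vector"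
  assumes "((\<lambda>t. g ((x + t0 *\<^sub>R v) + t *\<^sub>R v)) has_vector_derivative d) (at 0)"
  shows "((\<lambda>t. g (x + t *\<^sub>R v)) has_vector_derivative d) (at t0)"
proof -
  have "((\<lambda>t. t - t0) has_vector_derivative 1) (at t0)" by (auto intro!: derivative_eq_intros)
  moreover have "((\<lambda>t. g ((x + t0 *\<^sub>R v) + t *\<^sub>R v)) has_vector_derivative d) (at (t0 - t0))" using assms unfolding diff_self .
  ultimately have "((\<lambda>t. g ((x + t0 *\<^sub>R v) + t *\<^sub>R v)) \<circ> (\<lambda>t. t - t0) has_vector_derivative (1 *\<^sub>R d)) (at t0)"
    by (rule vector_diff_chain_at)
  moreover have "(\<lambda>t. g ((x + t0 *\<^sub>R v) + t *\<^sub>R v)) \<circ> (\<lambda>t. t - t0) = (\<lambda>t. g (x + t *\<^sub>R v))"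
    unfolding comp_def by (intro ext arg_cong[where f = g]) (simp add: scaleR_left_diff_distrib)
  ultimately show ?thesis by (simp only: scaleR_one)
qed

text \<open>The mean value inequality leads to the derivative at some
  \<open>x + \<tau> *\<^sub>R v\<close>. This point is within distance 1 of x, so the two weights
  compare up to the factor \<open>2 ^ m\<close>. The bound is independent of t and serves as a
  majorant for dominated convergence.\<close>

lemma difference_quotient_le:
  fixes g :: "'a::real_normed_vector \<Rightarrow> complex"
  assumes der: "\<And>x. ((\<lambda>t. g (x + t *\<^sub>R v)) has_vector_derivative g' x) (at 0)"
    and decay: "\<And>x. cmod (g' x) \<le> c / (1 + norm x) ^ m" and v: "norm v \<le> 1" and t: "0 < t" "t \<le> 1" and c: "0 \<le> c"
  shows "cmod ((g (x + t *\<^sub>R v) - g x) /\<^sub>R t) \<le> c * 2 ^ m / (1 + norm x) ^ m"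
proof -
  have line: "((\<lambda>t. g (x + t *\<^sub>R v)) has_vector_derivative g' (x + t0 *\<^sub>R v)) (at t0)" for t0
    by (rule has_vector_derivative_along_line) (rule der)
  have "\<exists>\<tau>\<in>{0<..<t}. norm (g (x + t *\<^sub>R v) - g (x + 0 *\<^sub>R v)) \<le> norm ((\<lambda>h. h *\<^sub>R g' (x + \<tau> *\<^sub>R v)) (t - 0))"
  proof (rule mvt_general[of 0 t "\<lambda>t. g (x + t *\<^sub>R v)" "\<lambda>\<tau> h. h *\<^sub>R g' (x + \<tau> *\<^sub>R v)"])
    show "continuous_on {0..t} (\<lambda>t. g (x + t *\<^sub>R v))"
      by (intro continuous_at_imp_continuous_on ballI) (rule has_vector_derivative_continuous[OF line])
    show "((\<lambda>t. g (x + t *\<^sub>R v)) has_derivative (\<lambda>h. h *\<^sub>R g' (x + \<tau> *\<^sub>R v))) (at \<tau>)" for \<tau>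
      using line[of \<tau>] unfolding has_vector_derivative_def .
  qed (rule t)
  then obtain \<tau> where \<tau>: "0 < \<tau>" "\<tau> < t" and le: "norm (g (x + t *\<^sub>R v) - g x) \<le> t * norm (g' (x + \<tau> *\<^sub>R v))"
    using t by auto
  have "norm (x + \<tau> *\<^sub>R v - \<tau> *\<^sub>R v) \<le> norm (x + \<tau> *\<^sub>R v) + norm (\<tau> *\<^sub>R v)" by (rule norm_triangle_ineq4)
  moreover have "norm (\<tau> *\<^sub>R v) \<le> 1" using \<tau> t v mult_mono[of "\<tau>" 1 "norm v" 1] by simp
  ultimately have "1 + norm x \<le> 2 * (1 + norm (x + \<tau> *\<^sub>R v))" using norm_ge_zero[of "x + \<tau> *\<^sub>R v"] unfolding add_diff_cancel_right' distrib_left by linarith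
  then have pw: "(1 + norm x) ^ m \<le> 2 ^ m * (1 + norm (x + \<tau> *\<^sub>R v)) ^ m"
    unfolding power_mult_distrib[symmetric] by (rule power_mono) simp
  have p1: "0 < (1 + norm x) ^ m" "0 < (1 + norm (x + \<tau> *\<^sub>R v)) ^ m"
    by (auto intro!: zero_less_power add_pos_nonneg)
  have "cmod ((g (x + t *\<^sub>R v) - g x) /\<^sub>R t) \<le> norm (g' (x + \<tau> *\<^sub>R v))"
    using le t by (simp add: divide_simps mult.commute)
  also have "\<dots> \<le> c / (1 + norm (x + \<tau> *\<^sub>R v)) ^ m" by (rule decay)
  also have "\<dots> \<le> c * 2 ^ m / (1 + norm x) ^ m"
  proof -
    have "c * (1 + norm x) ^ m / (1 + norm x) ^ m \<le> c * (2 ^ m * (1 + norm (x + \<tau> *\<^sub>R v)) ^ m) / (1 + norm x) ^ m"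
      using p1(1) by (intro divide_right_mono mult_left_mono pw c) auto
    then have "c \<le> c * 2 ^ m / (1 + norm x) ^ m * (1 + norm (x + \<tau> *\<^sub>R v)) ^ m"
      unfolding nonzero_mult_div_cancel_right[OF less_imp_neq[OF p1(1), symmetric]] times_divide_eq_left mult.assoc .
    then show ?thesis by (simp only: pos_divide_le_eq[OF p1(2)])
  qed
  finally show ?thesis .
qed

text \<open>The derivative is the limit of difference quotients, whose transforms are known from
  translation: a shift by \<open>t *\<^sub>R v\<close> multiplies the transform by a phase, and the
  factor obtained is the derivative of that phase at \<open>t = 0\<close>. Its minus sign reflects
  the positive exponent in \<open>fourier\<close>.\<close>

lemma fourier_directional_derivative:
  fixes g :: "real^'n \<Rightarrow> complex"
  assumes der: "\<And>x. ((\<lambda>t. g (x + t *\<^sub>R v)) has_vector_derivative g' x) (at 0)"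
    and [measurable]: "g \<in> borel_measurable borel" "g' \<in> borel_measurable borel"
    and decay: "\<And>x. cmod (g' x) \<le> c / (1 + norm x) ^ Suc DIM(real^'n)" and g: "integrable lborel g"
    and v: "norm v \<le> 1"
  shows "fourier g' \<xi> = - (\<i> * complex_of_real (2 * pi * (v \<bullet> \<xi>))) * fourier g \<xi>"
proof -
  have c: "0 \<le> c" using order_trans[OF norm_ge_zero decay[of 0]] by simp
  define t where "t k = 1 / real (Suc k)" for k
  have t: "0 < t k" "t k \<le> 1" for k by (auto simp: t_def)
  have "t \<longlonglongrightarrow> 0" unfolding t_def[abs_def] using LIMSEQ_inverse_real_of_nat by (simp add: inverse_eq_divide)
  then have t_at: "filterlim t (at 0) sequentially"
    unfolding filterlim_at using t by (auto intro!: always_eventually) (metis less_irrefl)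
  define d where "d k x = (g (x + t k *\<^sub>R v) - g x) /\<^sub>R t k" for k x
  have [measurable]: "d k \<in> borel_measurable borel" for k unfolding d_def by measurable
  have d_lim: "(\<lambda>k. d k x) \<longlonglongrightarrow> g' x" for x
  proof -
    have "((\<lambda>h. (g (x + h *\<^sub>R v) - g (x + 0 *\<^sub>R v)) /\<^sub>R h) \<longlongrightarrow> g' x) (at 0)"
      by (rule has_vector_derivative_quotient[OF der])
    from filterlim_compose[OF this t_at] show ?thesis unfolding d_def by simp
  qed
  have d_le: "cmod (d k x) \<le> c * 2 ^ Suc DIM(real^'n) / (1 + norm x) ^ Suc DIM(real^'n)" for k x
    unfolding d_def by (rule difference_quotient_le[OF der decay v t c])
  have lim1: "(\<lambda>k. fourier (d k) \<xi>) \<longlonglongrightarrow> fourier g' \<xi>" unfolding fourier_def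
  proof (rule integral_dominated_convergence[of "\<lambda>x. cis (2 * pi * (x \<bullet> \<xi>)) * g' x" lborel "\<lambda>k x. cis (2 * pi * (x \<bullet> \<xi>)) * d k x"
       "\<lambda>x. c * 2 ^ Suc DIM(real^'n) * (1 / (1 + norm x) ^ Suc DIM(real^'n))"])
    show "(\<lambda>x. cis (2 * pi * (x \<bullet> \<xi>)) * g' x) \<in> borel_measurable lborel" by measurable
    show "(\<lambda>x. cis (2 * pi * (x \<bullet> \<xi>)) * d k x) \<in> borel_measurable lborel" for k by measurable
    show "integrable lborel (\<lambda>x::real^'n. c * 2 ^ Suc DIM(real^'n) * (1 / (1 + norm x) ^ Suc DIM(real^'n)))"
      by (rule integrable_mult_right) (rule integrable_inverse_power_norm)
    show "AE x in lborel. (\<lambda>k. cis (2 * pi * (x \<bullet> \<xi>)) * d k x) \<longlonglongrightarrow> cis (2 * pi * (x \<bullet> \<xi>)) * g' x"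
      by (intro AE_I2 tendsto_intros d_lim)
    show "AE x in lborel. norm (cis (2 * pi * (x \<bullet> \<xi>)) * d k x) \<le> c * 2 ^ Suc DIM(real^'n) * (1 / (1 + norm x) ^ Suc DIM(real^'n))" for k
      using d_le by (intro AE_I2) (simp add: norm_mult)
  qed
  have tr: "integrable lborel (\<lambda>x. g (x + b))" for b
  proof -
    have "integrable (distr lborel borel ((+) b)) g" using g by (simp add: lborel_distr_plus)
    then have "integrable lborel (\<lambda>x. g (b + x))" by (rule integrable_distr[rotated]) simp
    then show ?thesis by (simp add: add.commute)
  qed
  have fd: "fourier (d k) \<xi> = ((cis (- (2 * pi * (v \<bullet> \<xi>)) * t k) - cis (- (2 * pi * (v \<bullet> \<xi>)) * 0)) /\<^sub>R t k) * fourier g \<xi>" for k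
  proof -
    have "fourier (d k) \<xi> = (\<integral>x. (cis (2 * pi * (x \<bullet> \<xi>)) * g (x + t k *\<^sub>R v) - cis (2 * pi * (x \<bullet> \<xi>)) * g x) /\<^sub>R t k \<partial>lborel)"
      unfolding fourier_def d_def by (rule Bochner_Integration.integral_cong) (simp_all add: right_diff_distrib scaleR_right_diff_distrib)
    also have "\<dots> = (fourier (\<lambda>x. g (x + t k *\<^sub>R v)) \<xi> - fourier g \<xi>) /\<^sub>R t k"
      unfolding fourier_def using fourier_integrand[OF tr, of \<xi> "t k *\<^sub>R v"] fourier_integrand[OF g, of \<xi>]
      by simp
    also have "fourier (\<lambda>x. g (x + t k *\<^sub>R v)) \<xi> = cis (- (2 * pi * (v \<bullet> \<xi>)) * t k) * fourier g \<xi>"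
      by (subst fourier_translate) (simp_all add: mult_ac)
    finally show ?thesis by (simp add: left_diff_distrib scaleR_right_diff_distrib)
  qed
  have lim2: "(\<lambda>k. fourier (d k) \<xi>) \<longlonglongrightarrow> (- (\<i> * complex_of_real (2 * pi * (v \<bullet> \<xi>)))) * fourier g \<xi>"
  proof -
    have "((\<lambda>h. cis (- (2 * pi * (v \<bullet> \<xi>)) * h)) has_vector_derivative (- (\<i> * complex_of_real (2 * pi * (v \<bullet> \<xi>))))) (at 0)"
      unfolding has_vector_derivative_def
      by (auto intro!: derivative_eq_intros simp: scaleR_conv_of_real mult_ac)
    then have "((\<lambda>h. (cis (- (2 * pi * (v \<bullet> \<xi>)) * h) - cis (- (2 * pi * (v \<bullet> \<xi>)) * 0)) /\<^sub>R h) \<longlongrightarrow> - (\<i> * complex_of_real (2 * pi * (v \<bullet> \<xi>)))) (at 0)"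
      by (rule has_vector_derivative_quotient)
    from tendsto_mult[OF filterlim_compose[OF this t_at] tendsto_const]
    show ?thesis unfolding fd .
  qed
  show ?thesis by (rule LIMSEQ_unique[OF lim1 lim2])
qed

lemma schwartz_iter:
  fixes f :: "real^'n \<Rightarrow> complex"
  assumes "schwartz f" "set vs \<subseteq> Basis"
  shows "continuous_on UNIV (partial_iter vs f)"
    and "v \<in> Basis \<Longrightarrow> ((\<lambda>t. partial_iter vs f (x + t *\<^sub>R v)) has_vector_derivative partial_iter (v # vs) f x) (at 0)"
    and "bounded (range (\<lambda>x. (1 + norm x) ^ k *\<^sub>R partial_iter vs f x))"
  using assms unfolding schwartz_def by simp_all

lemma schwartz_measurable:
  assumes "schwartz f" "set vs \<subseteq> Basis"
  shows "partial_iter vs f \<in> borel_measurable borel"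
  by (rule borel_measurable_continuous_onI) (rule schwartz_iter(1)[OF assms])

lemma schwartz_decay:
  fixes f :: "real^'n \<Rightarrow> complex"
  assumes "schwartz f" "set vs \<subseteq> Basis"
  obtains c where "0 \<le> c" "\<And>x. cmod (partial_iter vs f x) \<le> c / (1 + norm x) ^ k"
proof -
  obtain c where c: "\<And>x. norm ((1 + norm x) ^ k *\<^sub>R partial_iter vs f x) \<le> c"
    using schwartz_iter(3)[OF assms, of k] by (auto simp: bounded_iff)
  have p: "0 < (1 + norm x) ^ k" for x :: "real^'n" by (intro zero_less_power add_pos_nonneg) auto
  show ?thesis
  proof (rule that)
    show "0 \<le> c" using order_trans[OF norm_ge_zero c[of 0]] .
    show "cmod (partial_iter vs f x) \<le> c / (1 + norm x) ^ k" for x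
      using c[of x] p[of x] by (simp add: pos_le_divide_eq mult.commute abs_of_pos)
  qed
qed

lemma schwartz_integrable:
  fixes f :: "real^'n \<Rightarrow> complex"
  assumes "schwartz f" "set vs \<subseteq> Basis"
  shows "integrable lborel (partial_iter vs f)"
proof -
  obtain c where "0 \<le> c" and c: "\<And>x. cmod (partial_iter vs f x) \<le> c / (1 + norm x) ^ Suc DIM(real^'n)"
  proof (rule schwartz_decay[OF assms, of "Suc DIM(real^'n)"], goal_cases)
    case 1
    show ?case by (rule 1(1)[OF 1(2-)])
  qed
  show ?thesis by (rule integrable_decay[OF schwartz_measurable[OF assms] c])
qed

text \<open>The weight will compensate the division of the plane waves by
  \<open>1 + norm \<xi>\<close>.\<close>

lemma schwartz_weighted:
  fixes f :: "real^'n \<Rightarrow> complex"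
  assumes "schwartz f"
  shows "integrable lborel (\<lambda>x. (1 + norm x) *\<^sub>R f x)" "\<exists>A. \<forall>x. cmod ((1 + norm x) *\<^sub>R f x) \<le> A"
proof -
  have [measurable]: "f \<in> borel_measurable borel" using schwartz_measurable[OF assms, of "[]"] by simp
  have nil: "set [] \<subseteq> (Basis :: (real^'n) set)" by simp
  obtain c where "0 \<le> c" and c: "\<And>x. cmod (f x) \<le> c / (1 + norm x) ^ Suc (Suc DIM(real^'n))"
  proof (rule schwartz_decay[OF assms nil, of "Suc (Suc DIM(real^'n))", unfolded partial_iter.simps], goal_cases)
    case 1
    show ?case by (rule 1(1)[OF 1(2-)])
  qed
  show "integrable lborel (\<lambda>x. (1 + norm x) *\<^sub>R f x)"
  proof (rule integrable_decay)
    show "(\<lambda>x. (1 + norm x) *\<^sub>R f x) \<in> borel_measurable borel" by measurable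
    fix x :: "real^'n"
    have p: "0 < 1 + norm x" by (rule add_pos_nonneg) auto
    have "norm ((1 + norm x) *\<^sub>R f x) = (1 + norm x) * cmod (f x)" using p by simp
    also have "\<dots> \<le> (1 + norm x) * (c / (1 + norm x) ^ Suc (Suc DIM(real^'n)))" using c p by (intro mult_left_mono) auto
    also have "\<dots> = c / (1 + norm x) ^ Suc DIM(real^'n)" using p by simp
    finally show "norm ((1 + norm x) *\<^sub>R f x) \<le> c / (1 + norm x) ^ Suc DIM(real^'n)" .
  qed
  show "\<exists>A. \<forall>x. cmod ((1 + norm x) *\<^sub>R f x) \<le> A"
    using schwartz_iter(3)[OF assms, of "[]" 1] by (auto simp: bounded_iff)
qed

lemma fourier_replicate_partial:
  fixes f :: "real^'n \<Rightarrow> complex"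
  assumes f: "schwartz f" and v: "v \<in> Basis"
  shows "fourier (partial_iter (replicate k v) f) \<xi> = (- (\<i> * complex_of_real (2 * pi * (v \<bullet> \<xi>)))) ^ k * fourier f \<xi>"
proof (induction k)
  case 0 then show ?case by simp
next
  case (Suc k)
  have vs: "set (replicate k v) \<subseteq> Basis" "set (v # replicate k v) \<subseteq> Basis" using v by auto
  obtain c where "0 \<le> c" and c: "\<And>x. cmod (partial_iter (v # replicate k v) f x) \<le> c / (1 + norm x) ^ Suc DIM(real^'n)"
  proof (rule schwartz_decay[OF f vs(2), of "Suc DIM(real^'n)"], goal_cases)
    case 1
    show ?case by (rule 1(1)[OF 1(2-)])
  qed
  have "fourier (partial_iter (v # replicate k v) f) \<xi> = - (\<i> * complex_of_real (2 * pi * (v \<bullet> \<xi>))) * fourier (partial_iter (replicate k v) f) \<xi>"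
    by (rule fourier_directional_derivative[OF schwartz_iter(2)[OF f vs(1) v] schwartz_measurable[OF f vs(1)] schwartz_measurable[OF f vs(2)] c schwartz_integrable[OF f vs(1)]])
      (use v in simp)
  then show ?case unfolding Suc.IH by (simp only: replicate_Suc power_Suc mult.assoc)
qed

text \<open>Iterated derivatives in a single coordinate direction suffice, since for each
  \<open>\<xi>\<close> some coordinate has modulus at least \<open>norm \<xi>\<close> divided by the
  dimension. Summing the constants \<open>d v\<close> removes the dependence on that
  direction.\<close>

lemma schwartz_fourier_decay:
  fixes f :: "real^'n \<Rightarrow> complex"
  assumes f: "schwartz f"
  obtains c where "\<And>\<xi>. cmod (fourier f \<xi>) \<le> c / (1 + norm \<xi>) ^ k"
proof -
  let ?N = "real DIM(real^'n)"
  define d where "d v = (\<integral>x. norm (partial_iter (replicate k v) f x) \<partial>lborel)" for v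
  have d0: "0 \<le> d v" for v by (simp add: d_def)
  have coord: "\<bar>v \<bullet> \<xi>\<bar> ^ k * cmod (fourier f \<xi>) \<le> d v" if v: "v \<in> Basis" for v \<xi>
  proof -
    have "\<bar>v \<bullet> \<xi>\<bar> ^ k * cmod (fourier f \<xi>) \<le> \<bar>2 * pi * (v \<bullet> \<xi>)\<bar> ^ k * cmod (fourier f \<xi>)"
    proof (intro mult_right_mono power_mono)
      have "1 * \<bar>v \<bullet> \<xi>\<bar> \<le> (2 * pi) * \<bar>v \<bullet> \<xi>\<bar>" using pi_gt3 by (intro mult_right_mono) auto
      then show "\<bar>v \<bullet> \<xi>\<bar> \<le> \<bar>2 * pi * (v \<bullet> \<xi>)\<bar>" by (simp add: abs_mult)
    qed auto
    also have "\<dots> = cmod (fourier (partial_iter (replicate k v) f) \<xi>)"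
      unfolding fourier_replicate_partial[OF f v] by (simp add: norm_mult norm_power abs_mult)
    also have "\<dots> \<le> d v" unfolding d_def by (rule norm_fourier_le)
    finally show ?thesis .
  qed
  define D where "D = ?N ^ k * (\<Sum>v\<in>(Basis :: (real^'n) set). d v)"
  have rad: "norm \<xi> ^ k * cmod (fourier f \<xi>) \<le> D" for \<xi>
  proof -
    obtain v where v: "v \<in> Basis" "norm \<xi> \<le> ?N * \<bar>v \<bullet> \<xi>\<bar>"
    proof -
      \<comment> \<open>Otherwise the sum of the moduli of the coordinates would be smaller than the
        norm.\<close>
      have "\<exists>v\<in>Basis. norm \<xi> / ?N \<le> \<bar>\<xi> \<bullet> v\<bar>"
      proof (rule ccontr)
        assume "\<not> ?thesis"
        then have "\<And>v. v \<in> Basis \<Longrightarrow> \<bar>\<xi> \<bullet> v\<bar> < norm \<xi> / ?N" by (meson not_le)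
        then have "(\<Sum>v\<in>(Basis::(real^'n) set). \<bar>\<xi> \<bullet> v\<bar>) < (\<Sum>v\<in>(Basis::(real^'n) set). norm \<xi> / ?N)"
          by (intro sum_strict_mono) auto
        moreover have "(\<Sum>v\<in>(Basis::(real^'n) set). norm \<xi> / ?N) = norm \<xi>" by simp
        ultimately show False using norm_le_l1[of \<xi>] by linarith
      qed
      then obtain v where v: "v \<in> Basis" "norm \<xi> / ?N \<le> \<bar>\<xi> \<bullet> v\<bar>" ..
      then have "norm \<xi> \<le> ?N * \<bar>v \<bullet> \<xi>\<bar>" by (simp add: pos_divide_le_eq inner_commute mult.commute)
      with v(1) show thesis by (rule that)
    qed
    have "norm \<xi> ^ k * cmod (fourier f \<xi>) \<le> (?N * \<bar>v \<bullet> \<xi>\<bar>) ^ k * cmod (fourier f \<xi>)"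
      using v by (intro mult_right_mono power_mono) auto
    also have "\<dots> = ?N ^ k * (\<bar>v \<bullet> \<xi>\<bar> ^ k * cmod (fourier f \<xi>))" by (simp only: power_mult_distrib mult.assoc)
    also have "\<dots> \<le> ?N ^ k * d v" using coord[OF v(1)] by (intro mult_left_mono) auto
    also have "\<dots> \<le> D" unfolding D_def using v(1) d0 by (intro mult_left_mono member_le_sum) auto
    finally show ?thesis .
  qed
  define E where "E = (\<integral>x. norm (f x) \<partial>lborel)"
  show ?thesis
  proof (rule that)
    fix \<xi> :: "real^'n"
    have p: "0 < (1 + norm \<xi>) ^ k" by (intro zero_less_power add_pos_nonneg) auto
    have "(1 + norm \<xi>) ^ k \<le> (2 * max 1 (norm \<xi>)) ^ k" by (rule power_mono) auto
    also have "\<dots> = 2 ^ k * max 1 (norm \<xi>) ^ k" by (rule power_mult_distrib)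
    also have "max 1 (norm \<xi>) ^ k \<le> 1 + norm \<xi> ^ k" by (auto simp: max_def)
    finally have "(1 + norm \<xi>) ^ k \<le> 2 ^ k * (1 + norm \<xi> ^ k)" by simp
    then have "(1 + norm \<xi>) ^ k * cmod (fourier f \<xi>) \<le> 2 ^ k * (1 + norm \<xi> ^ k) * cmod (fourier f \<xi>)"
      by (rule mult_right_mono) simp
    also have "\<dots> = 2 ^ k * (cmod (fourier f \<xi>) + norm \<xi> ^ k * cmod (fourier f \<xi>))" by (simp add: algebra_simps)
    also have "\<dots> \<le> 2 ^ k * (E + D)" unfolding E_def using rad[of \<xi>] norm_fourier_le[of f \<xi>] by (intro mult_left_mono add_mono) auto
    finally show "cmod (fourier f \<xi>) \<le> 2 ^ k * (E + D) / (1 + norm \<xi>) ^ k"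
      using p by (simp add: pos_le_divide_eq mult.commute)
  qed
qed

lemma schwartz_fourier_integrable:
  fixes f :: "real^'n \<Rightarrow> complex"
  assumes f: "schwartz f"
  shows "integrable lborel (fourier f)"
proof -
  have m: "f \<in> borel_measurable borel" using schwartz_measurable[OF f, of "[]"] by simp
  obtain c where c: "\<And>\<xi>. cmod (fourier f \<xi>) \<le> c / (1 + norm \<xi>) ^ Suc DIM(real^'n)"
  proof (rule schwartz_fourier_decay[OF f, of "Suc DIM(real^'n)"], goal_cases)
    case 1
    show ?case by (rule 1(1)[OF 1(2-)])
  qed
  show ?thesis by (rule integrable_decay[OF fourier_measurable[OF m] c])
qed

section \<open>Gaussians and Gamma integrals\<close>

text \<open>This is the characteristic function of the standard normal distribution after rescaling
  the variable.\<close>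

lemma gaussian_fourier_real:
  fixes t \<xi> :: real
  assumes t: "0 < t"
  shows "has_bochner_integral lborel (\<lambda>x. cis (2 * pi * (x * \<xi>)) * complex_of_real (exp (- pi * t * x\<^sup>2)))
    (complex_of_real (t powr (- 1 / 2) * exp (- pi * \<xi>\<^sup>2 / t)))"
proof -
  \<comment> \<open>With this scale the standard normal density at \<open>c * x\<close> has exponent
    \<open>- pi * t * x\<^sup>2\<close>; the frequency u below is chosen so that
    \<open>u * (c * x) = 2 * pi * (x * \<xi>)\<close>.\<close>
  define c where "c = sqrt (2 * pi * t)"
  have c: "0 < c" "c\<^sup>2 = 2 * pi * t" using t by (simp_all add: c_def)
  define u where "u = 2 * pi * \<xi> / c"
  have nd: "(\<lambda>x. normal_density 0 1 x) \<in> borel_measurable lborel" by measurable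
  have iexp: "integrable std_normal_distribution (\<lambda>x. iexp (u * x))"
  proof -
    interpret real_distribution std_normal_distribution by (rule real_dist_normal_dist)
    show ?thesis by (rule integrable_const_bound[of _ 1]) (auto simp: norm_exp_i_times)
  qed
  have int: "integrable lborel (\<lambda>x. normal_density 0 1 x *\<^sub>R iexp (u * x))"
    using iexp by (subst (asm) integrable_density) auto
  have "(\<integral>x. normal_density 0 1 x *\<^sub>R iexp (u * x) \<partial>lborel) = char std_normal_distribution u"
    unfolding char_def by (subst integral_density) auto
  then have "has_bochner_integral lborel (\<lambda>x. normal_density 0 1 x *\<^sub>R iexp (u * x)) (complex_of_real (exp (- (u\<^sup>2) / 2)))"
    using int by (simp add: has_bochner_integral_iff char_std_normal_distribution)
  then have "has_bochner_integral lborel (\<lambda>x. normal_density 0 1 (0 + c * x) *\<^sub>R iexp (u * (0 + c * x))) (complex_of_real (exp (- (u\<^sup>2) / 2)) /\<^sub>R \<bar>c\<bar>)"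
    using lborel_has_bochner_integral_real_affine_iff[of c "\<lambda>x. normal_density 0 1 x *\<^sub>R iexp (u * x)" _ 0] c by simp
  then have scaled: "has_bochner_integral lborel (\<lambda>x. sqrt (2 * pi) *\<^sub>R (normal_density 0 1 (0 + c * x) *\<^sub>R iexp (u * (0 + c * x)))) (sqrt (2 * pi) *\<^sub>R (complex_of_real (exp (- (u\<^sup>2) / 2)) /\<^sub>R \<bar>c\<bar>))"
    by (rule has_bochner_integral_scaleR_right)
  have integrand: "sqrt (2 * pi) *\<^sub>R (normal_density 0 1 (0 + c * x) *\<^sub>R iexp (u * (0 + c * x))) = cis (2 * pi * (x * \<xi>)) * complex_of_real (exp (- pi * t * x\<^sup>2))" for x
  proof -
    have 1: "u * (0 + c * x) = 2 * pi * (x * \<xi>)" using c(1) by (simp add: u_def)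
    have 2: "sqrt (2 * pi) * normal_density 0 1 (0 + c * x) = exp (- pi * t * x\<^sup>2)"
      using c(2) by (simp add: normal_density_def power_mult_distrib)
    have "sqrt (2 * pi) *\<^sub>R (normal_density 0 1 (0 + c * x) *\<^sub>R iexp (u * (0 + c * x))) = (sqrt (2 * pi) * normal_density 0 1 (0 + c * x)) *\<^sub>R iexp (u * (0 + c * x))"
      by (rule scaleR_scaleR)
    also have "\<dots> = exp (- pi * t * x\<^sup>2) *\<^sub>R iexp (2 * pi * (x * \<xi>))" unfolding 1 2 by (rule refl)
    also have "\<dots> = cis (2 * pi * (x * \<xi>)) * complex_of_real (exp (- pi * t * x\<^sup>2))"
      by (simp only: cis_conv_exp scaleR_conv_of_real mult.commute)
    finally show ?thesis .
  qed
  have "sqrt (2 * pi) *\<^sub>R (complex_of_real (exp (- (u\<^sup>2) / 2)) /\<^sub>R \<bar>c\<bar>) = complex_of_real (t powr (- 1 / 2) * exp (- pi * \<xi>\<^sup>2 / t))"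
  proof -
    have "u\<^sup>2 = (2 * pi * \<xi>)\<^sup>2 / (2 * pi * t)" by (simp only: u_def power_divide c(2))
    then have 1: "- (u\<^sup>2) / 2 = - pi * \<xi>\<^sup>2 / t" using t by (simp only:) (simp add: power2_eq_square)
    have 2: "sqrt (2 * pi) / c = t powr (- 1 / 2)"
    proof -
      have "c = sqrt (2 * pi) * sqrt t" unfolding c_def by (rule real_sqrt_mult)
      moreover have "t powr (- 1 / 2) = 1 / sqrt t" using t powr_half_sqrt[of t] powr_minus_divide[of t "1 / 2"] by simp
      ultimately show ?thesis by simp
    qed
    have "sqrt (2 * pi) *\<^sub>R (complex_of_real (exp (- (u\<^sup>2) / 2)) /\<^sub>R \<bar>c\<bar>) = complex_of_real (sqrt (2 * pi) / c * exp (- (u\<^sup>2) / 2))"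
      using c(1) by (simp only: scaleR_conv_of_real abs_of_pos of_real_mult of_real_divide of_real_inverse divide_inverse mult_ac)
    then show ?thesis unfolding 1 2 .
  qed
  with scaled show ?thesis unfolding integrand by (simp only:)
qed

text \<open>Both factors of the integrand are products over the coordinates, and
  \<open>lborel\<close> is the image of the product of one-dimensional Lebesgue measures, so the
  one-dimensional values multiply.\<close>

lemma gaussian_fourier:
  fixes \<xi> :: "'a::euclidean_space"
  assumes t: "0 < t"
  shows "has_bochner_integral lborel (\<lambda>x. cis (2 * pi * (x \<bullet> \<xi>)) * complex_of_real (exp (- pi * t * (norm x)\<^sup>2)))
    (complex_of_real (t powr (- real DIM('a) / 2) * exp (- pi * (norm \<xi>)\<^sup>2 / t)))"
proof -
  define f where "f b x = cis (2 * pi * (x * (\<xi> \<bullet> b))) * complex_of_real (exp (- pi * t * x\<^sup>2))" for b :: 'a and x :: real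
  define I where "I b = complex_of_real (t powr (- 1 / 2) * exp (- pi * (\<xi> \<bullet> b)\<^sup>2 / t))" for b
  have fI: "has_bochner_integral lborel (f b) (I b)" for b
    unfolding f_def I_def by (rule gaussian_fourier_real[OF t])
  have [measurable]: "f b \<in> borel_measurable borel" for b unfolding f_def by measurable
  interpret P: product_sigma_finite "\<lambda>b::'a. lborel :: real measure" by unfold_locales
  define F where "F x = (\<Prod>b\<in>Basis. f b (x \<bullet> b))" for x :: 'a
  have Fm: "F \<in> borel_measurable borel" unfolding F_def by measurable
  have sum_m: "(\<lambda>g. \<Sum>b\<in>Basis. g b *\<^sub>R b) \<in> (\<Pi>\<^sub>M b\<in>(Basis::'a set). (lborel::real measure)) \<rightarrow>\<^sub>M borel" by measurable
  have eq: "F (\<Sum>b\<in>Basis. g b *\<^sub>R b) = (\<Prod>b\<in>Basis. f b (g b))" for g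
    unfolding F_def by (rule prod.cong) simp_all
  have int: "integrable lborel F"
  proof -
    have "integrable (\<Pi>\<^sub>M b\<in>(Basis::'a set). lborel) (\<lambda>g. \<Prod>b\<in>Basis. f b (g b))"
      by (rule P.product_integrable_prod) (use fI in \<open>auto simp: has_bochner_integral_iff\<close>)
    then have "integrable (distr (\<Pi>\<^sub>M b\<in>(Basis::'a set). lborel) borel (\<lambda>g. \<Sum>b\<in>Basis. g b *\<^sub>R b)) F"
      by (subst integrable_distr_eq[OF sum_m Fm]) (simp add: eq)
    then show ?thesis by (simp only: lborel_eq[symmetric])
  qed
  have val: "(\<integral>x. F x \<partial>lborel) = (\<Prod>b\<in>Basis. I b)"
  proof -
    have "(\<integral>x. F x \<partial>lborel) = (\<integral>x. F x \<partial>(distr (\<Pi>\<^sub>M b\<in>(Basis::'a set). lborel) borel (\<lambda>g. \<Sum>b\<in>Basis. g b *\<^sub>R b)))"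
      by (simp only: lborel_eq[symmetric])
    also have "\<dots> = (\<integral>g. (\<Prod>b\<in>Basis. f b (g b)) \<partial>(\<Pi>\<^sub>M b\<in>(Basis::'a set). lborel))"
      by (subst integral_distr[OF sum_m Fm]) (simp add: eq)
    also have "\<dots> = (\<Prod>b\<in>Basis. \<integral>x. f b x \<partial>lborel)"
      by (rule P.product_integral_prod) (use fI in \<open>auto simp: has_bochner_integral_iff\<close>)
    also have "\<dots> = (\<Prod>b\<in>Basis. I b)"
      by (rule prod.cong) (use fI in \<open>auto simp: has_bochner_integral_iff\<close>)
    finally show ?thesis .
  qed
  have Fx: "F x = cis (2 * pi * (x \<bullet> \<xi>)) * complex_of_real (exp (- pi * t * (norm x)\<^sup>2))" for x
  proof -
    have 1: "x \<bullet> \<xi> = (\<Sum>b\<in>Basis. (x \<bullet> b) * (\<xi> \<bullet> b))" by (rule euclidean_inner)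
    have 2: "(norm x)\<^sup>2 = (\<Sum>b\<in>Basis. (x \<bullet> b)\<^sup>2)" by (subst power2_norm_eq_inner, subst euclidean_inner) (simp only: power2_eq_square)
    have "(\<Prod>b\<in>Basis. cis (2 * pi * ((x \<bullet> b) * (\<xi> \<bullet> b)))) = cis (2 * pi * (x \<bullet> \<xi>))"
      unfolding 1 cis_conv_exp sum_distrib_left of_real_sum by (rule exp_sum[symmetric]) simp
    moreover have "(\<Prod>b\<in>Basis. complex_of_real (exp (- pi * t * (x \<bullet> b)\<^sup>2))) = complex_of_real (exp (- pi * t * (norm x)\<^sup>2))"
      unfolding 2 sum_distrib_left by (simp only: exp_sum[OF finite_Basis] of_real_prod)
    ultimately show ?thesis unfolding F_def f_def prod.distrib by simp
  qed
  have "(\<Prod>b\<in>Basis. I b) = complex_of_real (t powr (- real DIM('a) / 2) * exp (- pi * (norm \<xi>)\<^sup>2 / t))"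
  proof -
    have 1: "(\<Prod>b\<in>(Basis::'a set). t powr (- 1 / 2)) = t powr (- real DIM('a) / 2)"
      using t by (simp add: powr_realpow[symmetric] powr_powr)
    have 2: "(norm \<xi>)\<^sup>2 = (\<Sum>b\<in>Basis. (\<xi> \<bullet> b)\<^sup>2)" by (subst power2_norm_eq_inner, subst euclidean_inner) (simp only: power2_eq_square)
    have 3: "(\<Prod>b\<in>Basis. exp (- pi * (\<xi> \<bullet> b)\<^sup>2 / t)) = exp (- pi * (norm \<xi>)\<^sup>2 / t)"
      unfolding 2 sum_distrib_left sum_divide_distrib by (rule exp_sum[symmetric]) simp
    show ?thesis unfolding I_def of_real_prod[symmetric] prod.distrib 1 3 ..
  qed
  with val int show ?thesis unfolding Fx[abs_def, symmetric] Fx[symmetric] by (simp add: has_bochner_integral_iff)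
qed

lemma has_bochner_integral_Gamma:
  fixes p \<mu> :: real
  assumes p: "0 < p" and l: "0 < \<mu>"
  shows "has_bochner_integral lborel (\<lambda>t. indicator {0<..} t * (t powr (p - 1) * exp (- \<mu> * t))) (Gamma p * \<mu> powr (- p))"
proof -
  have "has_bochner_integral lborel (\<lambda>t. indicator {0..} t * t powr (p - 1) / exp t) (Gamma p)"
    by (rule has_bochner_integral_nn_integral) (use p Gamma_conv_nn_integral_real[OF p] in auto)
  then have "has_bochner_integral lborel (\<lambda>t. indicator {0..} (0 + \<mu> * t) * (0 + \<mu> * t) powr (p - 1) / exp (0 + \<mu> * t)) (Gamma p /\<^sub>R \<bar>\<mu>\<bar>)"
    using lborel_has_bochner_integral_real_affine_iff[of \<mu> "\<lambda>t. indicator {0..} t * t powr (p - 1) / exp t" "Gamma p" 0] l by simp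
  then have "has_bochner_integral lborel (\<lambda>t. \<mu> powr (1 - p) * (indicator {0..} (0 + \<mu> * t) * (0 + \<mu> * t) powr (p - 1) / exp (0 + \<mu> * t))) (\<mu> powr (1 - p) * (Gamma p /\<^sub>R \<bar>\<mu>\<bar>))"
    by (rule has_bochner_integral_mult_right)
  moreover have "\<mu> powr (1 - p) * (indicator {0..} (0 + \<mu> * t) * (0 + \<mu> * t) powr (p - 1) / exp (0 + \<mu> * t)) = indicator {0<..} t * (t powr (p - 1) * exp (- \<mu> * t))" for t
  proof (cases "0 < t")
    case True
    have "\<mu> powr (1 - p) * (\<mu> * t) powr (p - 1) = t powr (p - 1)"
      using True l by (simp add: powr_mult mult.assoc[symmetric] powr_add[symmetric])
    then show ?thesis using True l by (simp add: exp_minus divide_inverse mult.assoc[symmetric])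
  next
    \<comment> \<open>At \<open>t = 0\<close> the two indicators differ, but
      \<open>0 powr (p - 1) = 0\<close>.\<close>
    case False
    then show ?thesis using l by (cases "t = 0") (auto simp: indicator_def zero_le_mult_iff)
  qed
  moreover have "\<mu> powr (1 - p) * (Gamma p /\<^sub>R \<bar>\<mu>\<bar>) = Gamma p * \<mu> powr (- p)"
    using l by (simp add: powr_diff powr_minus_divide field_simps)
  ultimately show ?thesis by (simp only:)
qed

text \<open>The substitution \<open>t = 1 / x\<close> reduces it to the preceding Gamma integral:
  the Jacobian \<open>1 / x\<^sup>2\<close> turns the power \<open>x powr (q + 1)\<close> into
  \<open>x powr (q - 1)\<close>.\<close>

lemma has_bochner_integral_inverse_Gamma:
  fixes q \<mu> :: real
  assumes q: "0 < q" and l: "0 < \<mu>"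
  shows "has_bochner_integral lborel (\<lambda>t. indicator {0<..} t * (t powr (- q - 1) * exp (- \<mu> / t))) (Gamma q * \<mu> powr (- q))"
proof -
  let ?S = "{0<..} :: real set"
  let ?F = "\<lambda>u. u powr (q - 1) * exp (- \<mu> * u)" and ?f = "\<lambda>t. t powr (- q - 1) * exp (- \<mu> / t)"
  have G: "integrable lborel (\<lambda>u. indicator ?S u *\<^sub>R ?F u)" "(\<integral>u. indicator ?S u *\<^sub>R ?F u \<partial>lborel) = Gamma q * \<mu> powr (- q)"
    using has_bochner_integral_Gamma[OF q l] by (simp_all add: has_bochner_integral_iff)
  \<comment> \<open>The change of variables takes place for the completed measure, so the integrals
    are transferred to it and back.\<close>
  have absF: "?F absolutely_integrable_on ?S"
    unfolding set_integrable_def using G(1) by (subst integrable_completion) auto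
  have valF: "integral ?S ?F = Gamma q * \<mu> powr (- q)"
    using set_lebesgue_integral_eq_integral(2)[OF absF] G(2) unfolding set_lebesgue_integral_def
    by (subst (asm) integral_completion) auto
  have e: "\<bar>- 1 / x\<^sup>2\<bar> * ?f (1 / x) = ?F x" if "x \<in> ?S" for x
  proof -
    have x: "0 < x" using that by simp
    have "(1 / x) powr (- q - 1) = x powr (q + 1)" using x by (simp add: powr_divide powr_minus_divide powr_diff powr_add)
    moreover have "x powr (q - 1) = x powr (q + 1) / x\<^sup>2"
    proof -
      have "x powr (q - 1) = x powr ((q + 1) - 2)" by (rule arg_cong[where f = "\<lambda>r. x powr r"]) simp
      also have "\<dots> = x powr (q + 1) / x powr 2" by (rule powr_diff)
      also have "x powr 2 = x\<^sup>2" using x powr_realpow[of x 2] by simp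
      finally show ?thesis .
    qed
    ultimately show ?thesis using x by simp
  qed
  have img: "(\<lambda>x. 1 / x) ` ?S = ?S"
  proof (intro equalityI subsetI)
    fix x assume "x \<in> ?S"
    then show "x \<in> (\<lambda>x. 1 / x) ` ?S" by (intro image_eqI[of _ _ "1 / x"]) auto
  qed auto
  have cov: "(\<lambda>x. \<bar>- 1 / x\<^sup>2\<bar> * ?f (1 / x)) absolutely_integrable_on ?S \<and> integral ?S (\<lambda>x. \<bar>- 1 / x\<^sup>2\<bar> * ?f (1 / x)) = Gamma q * \<mu> powr (- q)
     \<longleftrightarrow> ?f absolutely_integrable_on ((\<lambda>x. 1 / x) ` ?S) \<and> integral ((\<lambda>x. 1 / x) ` ?S) ?f = Gamma q * \<mu> powr (- q)"
  proof (rule has_absolute_integral_change_of_variables_1')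
    show "?S \<in> sets lebesgue" by simp
    show "((\<lambda>x. 1 / x) has_real_derivative - 1 / x\<^sup>2) (at x within ?S)" if "x \<in> ?S" for x
      using that by (auto intro!: derivative_eq_intros simp: power2_eq_square)
    show "inj_on (\<lambda>x. 1 / x) ?S" by (auto simp: inj_on_def)
  qed
  have "(\<lambda>x. \<bar>- 1 / x\<^sup>2\<bar> * ?f (1 / x)) absolutely_integrable_on ?S"
    using absF by (rule absolutely_integrable_spike[OF _ negligible_empty]) (use e in auto)
  moreover have "integral ?S (\<lambda>x. \<bar>- 1 / x\<^sup>2\<bar> * ?f (1 / x)) = Gamma q * \<mu> powr (- q)"
    unfolding valF[symmetric] by (rule Henstock_Kurzweil_Integration.integral_cong) (rule e)
  ultimately have abs: "?f absolutely_integrable_on ?S" and val: "integral ?S ?f = Gamma q * \<mu> powr (- q)"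
    using cov unfolding img by simp_all
  have fm: "(\<lambda>t. indicator ?S t *\<^sub>R ?f t) \<in> borel_measurable lborel" by measurable
  have "integrable lborel (\<lambda>t. indicator ?S t *\<^sub>R ?f t)"
    using abs unfolding set_integrable_def by (subst (asm) integrable_completion[OF fm])
  moreover have "(\<integral>t. indicator ?S t *\<^sub>R ?f t \<partial>lborel) = Gamma q * \<mu> powr (- q)"
    using set_lebesgue_integral_eq_integral(2)[OF abs] val unfolding set_lebesgue_integral_def
    by (subst (asm) integral_completion[OF fm]) simp
  ultimately show ?thesis by (simp add: has_bochner_integral_iff)
qed

section \<open>Fourier transform of the Riesz kernel\<close>

text \<open>The kernel is nonnegative with mass \<open>m y\<close>, so integrability of
  \<open>m y *\<^sub>R w y\<close> amounts to absolute integrability on the product, and Fubini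
  applies. The mass is prescribed almost everywhere only, because the Gamma integrals are available
  just for \<open>y \<noteq> 0\<close>.\<close>

lemma integral_kernel_swap:
  fixes k :: "'a::euclidean_space \<Rightarrow> real \<Rightarrow> real" and w :: "'a \<Rightarrow> complex"
  assumes k_meas [measurable]: "(\<lambda>z. k (fst z) (snd z)) \<in> borel_measurable (lborel \<Otimes>\<^sub>M lborel)"
    and w_meas [measurable]: "w \<in> borel_measurable lborel"
    and k0: "\<And>y t. 0 \<le> k y t"
    and k: "AE y in lborel. has_bochner_integral lborel (k y) (m y)"
    and mw: "integrable lborel (\<lambda>y. m y *\<^sub>R w y)"
  shows "(\<integral>t. (\<integral>y. k y t *\<^sub>R w y \<partial>lborel) \<partial>lborel) = (\<integral>y. m y *\<^sub>R w y \<partial>lborel)"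
proof -
  let ?f = "\<lambda>z. k (fst z) (snd z) *\<^sub>R w (fst z)"
  have fm: "?f \<in> borel_measurable (lborel \<Otimes>\<^sub>M lborel)" by measurable
  have int: "integrable (lborel \<Otimes>\<^sub>M lborel) ?f"
  proof (rule lborel_pair.Fubini_integrable[OF fm])
    have gm: "(\<lambda>y. \<integral>t. norm (?f (y, t)) \<partial>lborel) \<in> borel_measurable lborel"
      by (rule lborel.borel_measurable_lebesgue_integral) measurable
    have ae: "AE y in lborel. norm (m y *\<^sub>R w y) = (\<integral>t. norm (?f (y, t)) \<partial>lborel)"
      using k
    proof eventually_elim
      case (elim y)
      have m0: "0 \<le> m y"
        using elim k0 unfolding has_bochner_integral_iff by (metis integral_nonneg_AE AE_I2)
      have "(\<integral>t. norm (?f (y, t)) \<partial>lborel) = (\<integral>t. k y t * norm (w y) \<partial>lborel)"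
        by (rule Bochner_Integration.integral_cong) (simp_all add: k0)
      also have "\<dots> = m y * norm (w y)" using elim by (simp add: has_bochner_integral_iff)
      finally show ?case using m0 by (simp only: norm_scaleR real_norm_def abs_of_nonneg)
    qed
    show "integrable lborel (\<lambda>y. \<integral>t. norm (?f (y, t)) \<partial>lborel)"
      using integrable_norm[OF mw] integrable_cong_AE[OF _ gm ae] borel_measurable_integrable[OF integrable_norm[OF mw]] by blast
    show "AE y in lborel. integrable lborel (\<lambda>t. ?f (y, t))"
      using k by eventually_elim (simp add: has_bochner_integral_iff)
  qed
  then have "integrable (lborel \<Otimes>\<^sub>M lborel) (case_prod (\<lambda>y t. k y t *\<^sub>R w y))" by (simp only: case_prod_unfold)
  from lborel_pair.Fubini_integral[OF this]
  have "(\<integral>t. (\<integral>y. k y t *\<^sub>R w y \<partial>lborel) \<partial>lborel) = (\<integral>y. (\<integral>t. k y t *\<^sub>R w y \<partial>lborel) \<partial>lborel)" .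
  also have "\<dots> = (\<integral>y. m y *\<^sub>R w y \<partial>lborel)"
  proof (rule integral_cong_AE)
    show "(\<lambda>y. \<integral>t. k y t *\<^sub>R w y \<partial>lborel) \<in> borel_measurable lborel"
      by (rule lborel.borel_measurable_lebesgue_integral) measurable
    show "(\<lambda>y. m y *\<^sub>R w y) \<in> borel_measurable lborel" using mw by (rule borel_measurable_integrable)
    show "AE y in lborel. (\<integral>t. k y t *\<^sub>R w y \<partial>lborel) = m y *\<^sub>R w y"
      using k by eventually_elim (simp add: has_bochner_integral_iff)
  qed
  finally show ?thesis .
qed

lemma fourier_multiplication_formula:
  fixes f g :: "real^'n \<Rightarrow> complex"
  assumes f: "integrable lborel f" and g: "integrable lborel g"
  shows "(\<integral>y. fourier f y * g y \<partial>lborel) = (\<integral>x. f x * fourier g x \<partial>lborel)"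
proof -
  have [measurable]: "f \<in> borel_measurable borel" "g \<in> borel_measurable borel"
    using borel_measurable_integrable[OF f] borel_measurable_integrable[OF g] by simp_all
  let ?F = "\<lambda>z. cis (2 * pi * (fst z \<bullet> snd z)) * f (fst z) * g (snd z)"
  have fm: "?F \<in> borel_measurable (lborel \<Otimes>\<^sub>M lborel)" by measurable
  have nF: "norm (?F (x, y)) = norm (f x) * norm (g y)" for x y by (simp add: norm_mult)
  have int: "integrable (lborel \<Otimes>\<^sub>M lborel) ?F"
  proof (rule lborel_pair.Fubini_integrable[OF fm])
    show "integrable lborel (\<lambda>x. \<integral>y. norm (?F (x, y)) \<partial>lborel)"
      unfolding nF using f g by simp
    show "AE x in lborel. integrable lborel (\<lambda>y. ?F (x, y))"
    proof (rule AE_I2)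
      fix x
      show "integrable lborel (\<lambda>y. ?F (x, y))"
      proof (rule Bochner_Integration.integrable_bound[of _ "\<lambda>y. norm (f x) * norm (g y)"])
        show "integrable lborel (\<lambda>y. norm (f x) * norm (g y))" using g by simp
        show "(\<lambda>y. ?F (x, y)) \<in> borel_measurable lborel" unfolding fst_conv snd_conv by measurable
      qed (simp add: norm_mult)
    qed
  qed
  then have "integrable (lborel \<Otimes>\<^sub>M lborel) (case_prod (\<lambda>x y. cis (2 * pi * (x \<bullet> y)) * f x * g y))" by (simp only: case_prod_unfold)
  from lborel_pair.Fubini_integral[OF this]
  have "(\<integral>y. (\<integral>x. cis (2 * pi * (x \<bullet> y)) * f x * g y \<partial>lborel) \<partial>lborel) = (\<integral>x. (\<integral>y. cis (2 * pi * (x \<bullet> y)) * f x * g y \<partial>lborel) \<partial>lborel)" .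
  moreover have "(\<integral>x. cis (2 * pi * (x \<bullet> y)) * f x * g y \<partial>lborel) = fourier f y * g y" for y
    unfolding fourier_def using fourier_integrand[OF f] by simp
  moreover have "(\<integral>y. cis (2 * pi * (x \<bullet> y)) * f x * g y \<partial>lborel) = f x * fourier g x" for x
  proof -
    have "(\<integral>y. cis (2 * pi * (x \<bullet> y)) * f x * g y \<partial>lborel) = (\<integral>y. f x * (cis (2 * pi * (y \<bullet> x)) * g y) \<partial>lborel)"
      by (simp only: inner_commute mult_ac)
    then show ?thesis unfolding fourier_def by simp
  qed
  ultimately show ?thesis by (simp only:)
qed

lemma fourier_gaussian_pairing:
  fixes f :: "real^'n \<Rightarrow> complex"
  assumes f: "integrable lborel f" and t: "0 < t"
  shows "(\<integral>y. exp (- (pi * (norm y)\<^sup>2) * t) *\<^sub>R fourier f y \<partial>lborel)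
     = t powr (- real CARD('n) / 2) *\<^sub>R (\<integral>x. exp (- (pi * (norm x)\<^sup>2) / t) *\<^sub>R f x \<partial>lborel)"
proof -
  let ?g = "\<lambda>y :: real^'n. complex_of_real (exp (- pi * t * (norm y)\<^sup>2))"
  have g: "integrable lborel ?g"
    using gaussian_fourier[OF t, of "0 :: real^'n"] by (simp add: has_bochner_integral_iff)
  have Fg: "fourier ?g x = complex_of_real (t powr (- real CARD('n) / 2) * exp (- pi * (norm x)\<^sup>2 / t))" for x
    unfolding fourier_def using gaussian_fourier[OF t, of x] by (simp add: has_bochner_integral_iff)
  have "(\<integral>y. exp (- (pi * (norm y)\<^sup>2) * t) *\<^sub>R fourier f y \<partial>lborel) = (\<integral>y. fourier f y * ?g y \<partial>lborel)"
    by (rule Bochner_Integration.integral_cong) (simp_all add: scaleR_conv_of_real mult_ac)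
  also have "\<dots> = (\<integral>x. f x * fourier ?g x \<partial>lborel)" by (rule fourier_multiplication_formula[OF f g])
  also have "\<dots> = (\<integral>x. t powr (- real CARD('n) / 2) *\<^sub>R (exp (- (pi * (norm x)\<^sup>2) / t) *\<^sub>R f x) \<partial>lborel)"
    unfolding Fg by (rule Bochner_Integration.integral_cong) (simp_all add: scaleR_conv_of_real mult_ac)
  finally show ?thesis by (simp only: integral_scaleR_right)
qed

lemma norm_square_powr:
  fixes x :: "'a::real_normed_vector"
  shows "(pi * (norm x)\<^sup>2) powr (- p) = pi powr (- p) * norm x powr (- (2 * p))"
proof (cases "x = 0")
  case False
  then have "(norm x)\<^sup>2 = norm x powr 2" using powr_realpow[of "norm x" 2] by simp
  then have "((norm x)\<^sup>2) powr (- p) = norm x powr (2 * - p)" by (simp only: powr_powr)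
  moreover have "(pi * (norm x)\<^sup>2) powr (- p) = pi powr (- p) * ((norm x)\<^sup>2) powr (- p)" by (simp add: powr_mult)
  ultimately show ?thesis by simp
qed simp

lemma riesz_weight_integrable:
  fixes h :: "'a::euclidean_space \<Rightarrow> complex"
  assumes b: "0 \<le> b" "b < real DIM('a)" and h: "integrable lborel h" and hA: "\<And>x. cmod (h x) \<le> A"
  shows "integrable lborel (\<lambda>x. norm x powr (- b) *\<^sub>R h x)"
proof -
  obtain c where "0 \<le> c" and c: "\<And>h :: 'a \<Rightarrow> complex. \<And>A Q. integrable lborel h \<Longrightarrow> (\<And>x. cmod (h x) \<le> A) \<Longrightarrow>
     integrable lborel (\<lambda>x. norm (x - Q) powr (- b) * norm (h x)) \<and>
     (\<integral>x. norm (x - Q) powr (- b) * norm (h x) \<partial>lborel) \<le> c * A + (\<integral>x. norm (h x) \<partial>lborel)"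
  proof (rule riesz_integral_bound[OF b], goal_cases)
    case 1
    show ?case by (rule 1(1)[OF 1(2-)])
  qed
  have [measurable]: "h \<in> borel_measurable borel" using borel_measurable_integrable[OF h] by simp
  have "integrable lborel (\<lambda>x. norm (x - 0) powr (- b) * norm (h x))" using c[OF h hA] by (rule conjunct1)
  then show ?thesis by (rule Bochner_Integration.integrable_bound) auto
qed

text \<open>Both kernels are superpositions of Gaussians of all widths t, with the weights of the two Gamma
  integrals, and the Fourier transform exchanges the widths t and 1/t.\<close>

theorem riesz_fourier:
  fixes f :: "real^'n \<Rightarrow> complex"
  assumes s: "0 < s" "2 * s < real CARD('n)"
    and f: "integrable lborel f" and fA: "\<And>x. cmod (f x) \<le> A" and Ff: "integrable lborel (fourier f)"
  shows "(\<integral>y. complex_of_real (riesz_kernel s y) * fourier f y \<partial>lborel) = (\<integral>\<xi>. complex_of_real (norm \<xi> powr (- 2 * s)) * f \<xi> \<partial>lborel)"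
proof -
  \<comment> \<open>Chosen so that \<open>norm y powr (- (2 * p))\<close> is the Riesz kernel up to
    a constant.\<close>
  define p where "p = real CARD('n) / 2 - s"
  have p: "0 < p" using s by (simp add: p_def)
  define k1 where "k1 y t = indicator {0<..} t * (t powr (p - 1) * exp (- (pi * (norm y)\<^sup>2) * t))" for y :: "real^'n" and t
  define k2 where "k2 y t = indicator {0<..} t * (t powr (- s - 1) * exp (- (pi * (norm y)\<^sup>2) / t))" for y :: "real^'n" and t
  have nz: "AE y in lborel. y \<noteq> (0 :: real^'n)" by (rule AE_lborel_singleton)
  have "(\<integral>t. (\<integral>y. k1 y t *\<^sub>R fourier f y \<partial>lborel) \<partial>lborel) = (\<integral>y. (Gamma p * (pi * (norm y)\<^sup>2) powr (- p)) *\<^sub>R fourier f y \<partial>lborel)"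
  proof (rule integral_kernel_swap)
    show "(\<lambda>z. k1 (fst z) (snd z)) \<in> borel_measurable (lborel \<Otimes>\<^sub>M lborel)" unfolding k1_def by measurable
    show "fourier f \<in> borel_measurable lborel" using Ff by (rule borel_measurable_integrable)
    show "0 \<le> k1 y t" for y t by (simp add: k1_def)
    show "AE y in lborel. has_bochner_integral lborel (k1 y) (Gamma p * (pi * (norm y)\<^sup>2) powr (- p))"
      using nz by eventually_elim (unfold k1_def[abs_def], rule has_bochner_integral_Gamma[OF p], simp)
    have "integrable lborel (\<lambda>y. (Gamma p * pi powr (- p)) *\<^sub>R (norm y powr (- (2 * p)) *\<^sub>R fourier f y))"
      by (intro integrable_scaleR_right riesz_weight_integrable[OF _ _ Ff norm_fourier_le]) (use p s in \<open>auto simp: p_def\<close>)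
    then show "integrable lborel (\<lambda>y. (Gamma p * (pi * (norm y)\<^sup>2) powr (- p)) *\<^sub>R fourier f y)"
      by (simp only: norm_square_powr scaleR_scaleR mult.assoc)
  qed
  moreover have "(\<integral>t. (\<integral>y. k2 y t *\<^sub>R f y \<partial>lborel) \<partial>lborel) = (\<integral>y. (Gamma s * (pi * (norm y)\<^sup>2) powr (- s)) *\<^sub>R f y \<partial>lborel)"
  proof (rule integral_kernel_swap)
    show "(\<lambda>z. k2 (fst z) (snd z)) \<in> borel_measurable (lborel \<Otimes>\<^sub>M lborel)" unfolding k2_def by measurable
    show "f \<in> borel_measurable lborel" using f by (rule borel_measurable_integrable)
    show "0 \<le> k2 y t" for y t by (simp add: k2_def)
    show "AE y in lborel. has_bochner_integral lborel (k2 y) (Gamma s * (pi * (norm y)\<^sup>2) powr (- s))"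
      using nz by eventually_elim (unfold k2_def[abs_def], rule has_bochner_integral_inverse_Gamma[OF s(1)], simp)
    have "integrable lborel (\<lambda>y. (Gamma s * pi powr (- s)) *\<^sub>R (norm y powr (- (2 * s)) *\<^sub>R f y))"
      by (intro integrable_scaleR_right riesz_weight_integrable[OF _ _ f fA]) (use s in auto)
    then show "integrable lborel (\<lambda>y. (Gamma s * (pi * (norm y)\<^sup>2) powr (- s)) *\<^sub>R f y)"
      by (simp only: norm_square_powr scaleR_scaleR mult.assoc)
  qed
  moreover have "(\<integral>y. k1 y t *\<^sub>R fourier f y \<partial>lborel) = (\<integral>y. k2 y t *\<^sub>R f y \<partial>lborel)" for t
  proof (cases "0 < t")
    case True
    have "(\<integral>y. k1 y t *\<^sub>R fourier f y \<partial>lborel) = t powr (p - 1) *\<^sub>R (\<integral>y. exp (- (pi * (norm y)\<^sup>2) * t) *\<^sub>R fourier f y \<partial>lborel)"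
      unfolding k1_def using True by (simp add: scaleR_scaleR[symmetric] del: scaleR_scaleR)
    also have "\<dots> = (t powr (p - 1) * t powr (- real CARD('n) / 2)) *\<^sub>R (\<integral>y. exp (- (pi * (norm y)\<^sup>2) / t) *\<^sub>R f y \<partial>lborel)"
      unfolding fourier_gaussian_pairing[OF f True] by (rule scaleR_scaleR)
    \<comment> \<open>The normalisation of the transformed Gaussian converts the weight of one Gamma
      integral into that of the other.\<close>
    also have "t powr (p - 1) * t powr (- real CARD('n) / 2) = t powr (- s - 1)"
      by (simp add: powr_add[symmetric] p_def)
    also have "t powr (- s - 1) *\<^sub>R (\<integral>y. exp (- (pi * (norm y)\<^sup>2) / t) *\<^sub>R f y \<partial>lborel) = (\<integral>y. k2 y t *\<^sub>R f y \<partial>lborel)"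
      unfolding k2_def using True by (simp add: scaleR_scaleR[symmetric] del: scaleR_scaleR)
    finally show ?thesis .
  next
    case False then show ?thesis by (simp add: k1_def k2_def)
  qed
  ultimately have eq: "(\<integral>y. (Gamma p * (pi * (norm y)\<^sup>2) powr (- p)) *\<^sub>R fourier f y \<partial>lborel) = (\<integral>y. (Gamma s * (pi * (norm y)\<^sup>2) powr (- s)) *\<^sub>R f y \<partial>lborel)"
    by (simp only:)
  define q where "q = Gamma s * pi powr (- s)"
  have q: "q \<noteq> 0" unfolding q_def using Gamma_real_pos[OF s(1)] by simp
  \<comment> \<open>This is the origin of \<open>riesz_const\<close>: it is
    \<open>Gamma p * pi powr (- p)\<close> divided by \<open>Gamma s * pi powr (- s)\<close>, the
    quotient of the constants of the two Gamma integrals.\<close>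
  have rk: "riesz_kernel s y = inverse q * (Gamma p * (pi * (norm y)\<^sup>2) powr (- p))" for y :: "real^'n"
  proof -
    have 1: "pi powr (2 * s - real CARD('n) / 2) = pi powr (- p) / pi powr (- s)"
      by (simp add: powr_diff[symmetric] p_def)
    have 2: "- (real CARD('n) - 2 * s) = - (2 * p)" by (simp add: p_def)
    show ?thesis unfolding riesz_kernel_def riesz_const_def norm_square_powr q_def 1 2 p_def[symmetric]
      by (simp add: divide_inverse mult_ac)
  qed
  have "(\<integral>y. complex_of_real (riesz_kernel s y) * fourier f y \<partial>lborel) = (\<integral>y. inverse q *\<^sub>R ((Gamma p * (pi * (norm y)\<^sup>2) powr (- p)) *\<^sub>R fourier f y) \<partial>lborel)"
    unfolding rk scaleR_scaleR by (simp only: scaleR_conv_of_real)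
  also have "\<dots> = inverse q *\<^sub>R (\<integral>y. (Gamma s * (pi * (norm y)\<^sup>2) powr (- s)) *\<^sub>R f y \<partial>lborel)"
    unfolding eq[symmetric] by (rule integral_scaleR_right)
  also have "\<dots> = (\<integral>y. inverse q *\<^sub>R ((Gamma s * (pi * (norm y)\<^sup>2) powr (- s)) *\<^sub>R f y) \<partial>lborel)"
    by (rule integral_scaleR_right[symmetric])
  also have "\<dots> = (\<integral>\<xi>. complex_of_real (norm \<xi> powr (- 2 * s)) * f \<xi> \<partial>lborel)"
  proof (rule Bochner_Integration.integral_cong)
    fix y :: "real^'n"
    have "inverse q * (Gamma s * (pi * (norm y)\<^sup>2) powr (- s)) = (inverse q * q) * norm y powr (- (2 * s))"
      unfolding norm_square_powr q_def by (simp only: mult_ac)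
    then have "inverse q * (Gamma s * (pi * (norm y)\<^sup>2) powr (- s)) = norm y powr (- 2 * s)" using q by simp
    then show "inverse q *\<^sub>R ((Gamma s * (pi * (norm y)\<^sup>2) powr (- s)) *\<^sub>R f y) = complex_of_real (norm y powr (- 2 * s)) * f y"
      unfolding scaleR_scaleR by (simp only: scaleR_conv_of_real)
  qed simp
  finally show ?thesis .
qed

section \<open>Plane waves and the conclusion\<close>

lemma norm_cis_diff_le: "cmod (cis a - cis b) \<le> \<bar>a - b\<bar>"
proof -
  have "cis a - cis b = cis b * (cis (a - b) - 1)" by (simp add: right_diff_distrib cis_mult)
  then have "cmod (cis a - cis b) = cmod (cis (a - b) - 1)" by (simp only: norm_mult norm_cis mult_1)
  also have "\<dots> = cmod (iexp (a - b) - 1)" by (simp only: cis_conv_exp)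
  also have "\<dots> \<le> \<bar>a - b\<bar>" using iexp_approx1[of "a - b" 0] by simp
  finally show ?thesis .
qed

text \<open>A point off K has positive distance from K, so on K its kernel agrees with a truncated
  one. This permits pulling the constant of the Riesz kernel out of the pairing in
  \<open>single_layer\<close>.\<close>

lemma (in lipschitz_functional) kernel_lipschitz:
  assumes a: "0 \<le> a" and x: "x \<notin> K"
  obtains L where "L-lipschitz_on K (\<lambda>Q. complex_of_real (norm (x - Q) powr (- a)))"
proof -
  obtain k where k: "x \<in> far (1 / real (Suc k))"
    using eventually_happens[OF eventually_far[OF x]] by auto
  have \<epsilon>: "0 < 1 / real (Suc k)" by simp
  interpret G: lipschitz_family K T C "\<lambda>x Q. complex_of_real (max (1 / real (Suc k)) (norm (x - Q)) powr (- a))"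
      "(1 / real (Suc k)) powr (- a) + a * (1 / real (Suc k)) powr (- a - 1)"
    by (rule truncated_family[OF a \<epsilon>])
  show ?thesis
  proof (rule that, rule lipschitz_onI)
    show "0 \<le> (1 / real (Suc k)) powr (- a) + a * (1 / real (Suc k)) powr (- a - 1)" by (rule G.B_nonneg)
    fix P Q assume PQ: "P \<in> K" "Q \<in> K"
    show "dist (complex_of_real (norm (x - P) powr (- a))) (complex_of_real (norm (x - Q) powr (- a)))
        \<le> ((1 / real (Suc k)) powr (- a) + a * (1 / real (Suc k)) powr (- a - 1)) * dist P Q"
      using lipschitz_onD[OF G.G_lipschitz[of x] PQ] unfolding truncated_eq_far[OF k PQ(1)] truncated_eq_far[OF k PQ(2)] .
  qed
qed

lemma fourier_shift:
  "fourier f (y + Q) = fourier (\<lambda>x. cis (2 * pi * (x \<bullet> Q)) * f x) y"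
  unfolding fourier_def
  by (rule Bochner_Integration.integral_cong)
    (simp_all add: cis_mult mult.assoc[symmetric] inner_add_right distrib_left)

text \<open>Moving the pole from Q to the origin translates the transform, that is, multiplies f by
  a plane wave; \<open>riesz_fourier\<close> is then applied to the modulated function.\<close>

lemma riesz_potential_fourier:
  fixes f :: "real^'n \<Rightarrow> complex"
  assumes s: "0 < s" "2 * s < real CARD('n)" and f: "schwartz f"
  shows "complex_of_real (riesz_const CARD('n) s) * riesz_potential (real CARD('n) - 2 * s) (fourier f) Q
    = (\<integral>\<xi>. complex_of_real (norm \<xi> powr (- 2 * s)) * (cis (2 * pi * (\<xi> \<bullet> Q)) * f \<xi>) \<partial>lborel)"
proof -
  have nil: "set [] \<subseteq> (Basis :: (real^'n) set)" by simp
  have fi: "integrable lborel f" using schwartz_integrable[OF f nil] by simp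
  obtain A where "0 \<le> A" and A0: "\<And>x. cmod (partial_iter [] f x) \<le> A / (1 + norm x) ^ 0"
  proof (rule schwartz_decay[OF f nil, of 0], goal_cases)
    case 1
    show ?case by (rule 1(1)[OF 1(2-)])
  qed
  then have A: "cmod (f x) \<le> A" for x using A0[of x] by simp
  have Fi: "integrable lborel (fourier f)" by (rule schwartz_fourier_integrable[OF f])
  have [measurable]: "fourier f \<in> borel_measurable borel" using borel_measurable_integrable[OF Fi] by simp
  let ?g = "\<lambda>x. cis (2 * pi * (x \<bullet> Q)) * f x"
  have Fg: "fourier ?g = (\<lambda>y. fourier f (y + Q))" by (rule ext) (rule fourier_shift[symmetric])
  have Fgi: "integrable lborel (fourier ?g)"
  proof -
    have "integrable (distr lborel borel ((+) Q)) (fourier f)" using Fi by (simp add: lborel_distr_plus)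
    then have "integrable lborel (\<lambda>y. fourier f (Q + y))" by (rule integrable_distr[rotated]) simp
    then show ?thesis unfolding Fg by (simp add: add.commute)
  qed
  have rm: "(\<lambda>x. complex_of_real (riesz_kernel s (x - Q)) * fourier f x) \<in> borel_measurable borel"
    unfolding riesz_kernel_def by measurable
  have "complex_of_real (riesz_const CARD('n) s) * riesz_potential (real CARD('n) - 2 * s) (fourier f) Q
      = (\<integral>x. complex_of_real (riesz_const CARD('n) s) * (complex_of_real (norm (x - Q) powr (- (real CARD('n) - 2 * s))) * fourier f x) \<partial>lborel)"
    unfolding riesz_potential_def by (rule integral_mult_right_zero[symmetric])
  also have "\<dots> = (\<integral>x. complex_of_real (riesz_kernel s (x - Q)) * fourier f x \<partial>lborel)"
    unfolding riesz_kernel_def of_real_mult mult.assoc by (rule refl)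
  also have "\<dots> = (\<integral>y. complex_of_real (riesz_kernel s (y + Q - Q)) * fourier f (y + Q) \<partial>lborel)"
    by (rule lborel_integral_translate[OF rm, symmetric])
  also have "\<dots> = (\<integral>y. complex_of_real (riesz_kernel s y) * fourier ?g y \<partial>lborel)" unfolding Fg by simp
  also have "\<dots> = (\<integral>\<xi>. complex_of_real (norm \<xi> powr (- 2 * s)) * ?g \<xi> \<partial>lborel)"
    by (rule riesz_fourier[OF s fourier_integrand[OF fi] _ Fgi, of A]) (simp add: norm_mult A)
  finally show ?thesis .
qed

lemma (in lipschitz_functional) plane_wave_lipschitz:
  "(2 * pi * norm \<xi>)-lipschitz_on K (\<lambda>Q. cis (2 * pi * (\<xi> \<bullet> Q)))"
proof (rule lipschitz_onI)
  show "0 \<le> 2 * pi * norm \<xi>" by simp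
  fix P Q
  have "cmod (cis (2 * pi * (\<xi> \<bullet> P)) - cis (2 * pi * (\<xi> \<bullet> Q))) \<le> \<bar>2 * pi * (\<xi> \<bullet> P) - 2 * pi * (\<xi> \<bullet> Q)\<bar>"
    by (rule norm_cis_diff_le)
  also have "2 * pi * (\<xi> \<bullet> P) - 2 * pi * (\<xi> \<bullet> Q) = 2 * pi * (\<xi> \<bullet> (P - Q))"
    by (simp add: inner_diff_right right_diff_distrib)
  also have "\<bar>\<dots>\<bar> = 2 * pi * \<bar>\<xi> \<bullet> (P - Q)\<bar>" by (simp add: abs_mult)
  also have "\<dots> \<le> 2 * pi * (norm \<xi> * norm (P - Q))"
    by (intro mult_left_mono Cauchy_Schwarz_ineq2) simp
  finally show "dist (cis (2 * pi * (\<xi> \<bullet> P))) (cis (2 * pi * (\<xi> \<bullet> Q))) \<le> 2 * pi * norm \<xi> * dist P Q"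
    by (simp add: dist_norm mult.assoc)
qed

text \<open>The plane waves are divided by 1 + norm xi because their Lipschitz constants are not bounded in xi.\<close>

lemma (in lipschitz_functional) plane_wave_family:
  assumes R: "0 \<le> R" "\<And>Q. Q \<in> K \<Longrightarrow> norm Q \<le> R"
  shows "lipschitz_family K T C (\<lambda>\<xi> Q. complex_of_real (inverse (1 + norm \<xi>)) * cis (2 * pi * (\<xi> \<bullet> Q))) (1 + 2 * pi * (1 + R))"
proof
  \<comment> \<open>The summand 1 covers the modulus and the variation of
    \<open>inverse (1 + norm \<xi>)\<close>, \<open>2 * pi\<close> the Lipschitz constant in Q after
    rescaling, and \<open>2 * pi * R\<close> the variation of the phase in
    \<open>\<xi>\<close>.\<close>
  let ?B = "1 + 2 * pi * (1 + R)"
  have p: "0 < 1 + norm \<xi>" for \<xi> :: 'a by (rule add_pos_nonneg) auto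
  have i1: "inverse (1 + norm \<xi>) \<le> 1" for \<xi> :: 'a by (simp add: inverse_le_1_iff)
  have i0: "0 \<le> inverse (1 + norm \<xi>)" for \<xi> :: 'a using p[of \<xi>] by simp
  have n: "norm (complex_of_real (inverse (1 + norm \<xi>))) = inverse (1 + norm \<xi>)" for \<xi> :: 'a
    using i0[of \<xi>] by (simp only: norm_of_real abs_of_nonneg)
  show B0: "0 \<le> ?B" using R(1) by (simp add: add_nonneg_nonneg)
  have B1: "1 \<le> ?B" "2 * pi \<le> ?B" using R(1) by (simp_all add: distrib_left add_increasing)
  show "cmod (complex_of_real (inverse (1 + norm \<xi>)) * cis (2 * pi * (\<xi> \<bullet> P))) \<le> ?B" for \<xi> P :: 'a
    unfolding norm_mult n norm_cis using i1[of \<xi>] B1(1) by simp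
  show "?B-lipschitz_on K (\<lambda>Q. complex_of_real (inverse (1 + norm \<xi>)) * cis (2 * pi * (\<xi> \<bullet> Q)))" for \<xi> :: 'a
  proof (rule lipschitz_onI[OF _ B0])
    fix P Q assume PQ: "P \<in> K" "Q \<in> K"
    have "dist (complex_of_real (inverse (1 + norm \<xi>)) * cis (2 * pi * (\<xi> \<bullet> P))) (complex_of_real (inverse (1 + norm \<xi>)) * cis (2 * pi * (\<xi> \<bullet> Q)))
       = inverse (1 + norm \<xi>) * dist (cis (2 * pi * (\<xi> \<bullet> P))) (cis (2 * pi * (\<xi> \<bullet> Q)))"
      unfolding dist_norm right_diff_distrib[symmetric] norm_mult n by (rule refl)
    also have "\<dots> \<le> inverse (1 + norm \<xi>) * (2 * pi * norm \<xi> * dist P Q)"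
      by (rule mult_left_mono[OF lipschitz_onD[OF plane_wave_lipschitz PQ] i0])
    also have "\<dots> = inverse (1 + norm \<xi>) * norm \<xi> * (2 * pi * dist P Q)" by simp
    also have "\<dots> \<le> 1 * (2 * pi * dist P Q)"
      using p[of \<xi>] by (intro mult_right_mono) (auto simp: field_simps)
    also have "\<dots> \<le> ?B * dist P Q" using B1(2) by (simp only: mult_1 mult_right_mono zero_le_dist)
    finally show "dist (complex_of_real (inverse (1 + norm \<xi>)) * cis (2 * pi * (\<xi> \<bullet> P))) (complex_of_real (inverse (1 + norm \<xi>)) * cis (2 * pi * (\<xi> \<bullet> Q))) \<le> ?B * dist P Q" .
  qed
  show "cmod (complex_of_real (inverse (1 + norm \<xi>)) * cis (2 * pi * (\<xi> \<bullet> P)) - complex_of_real (inverse (1 + norm \<eta>)) * cis (2 * pi * (\<eta> \<bullet> P))) \<le> ?B * dist \<xi> \<eta>"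
    if P: "P \<in> K" for \<xi> \<eta> P :: 'a
  proof -
    let ?e = "cis (2 * pi * (\<xi> \<bullet> P))" and ?f = "cis (2 * pi * (\<eta> \<bullet> P))"
    let ?c = "complex_of_real (inverse (1 + norm \<xi>))" and ?d = "complex_of_real (inverse (1 + norm \<eta>))"
    have "?c * ?e - ?d * ?f = ?c * (?e - ?f) + (?c - ?d) * ?f" by (simp add: algebra_simps)
    then have "cmod (?c * ?e - ?d * ?f) \<le> cmod (?c * (?e - ?f)) + cmod ((?c - ?d) * ?f)" by (simp only: norm_triangle_ineq)
    also have "cmod (?c * (?e - ?f)) \<le> 1 * (2 * pi * R * dist \<xi> \<eta>)"
      unfolding norm_mult n
    proof (rule mult_mono[OF i1])
      have "cmod (?e - ?f) \<le> \<bar>2 * pi * (\<xi> \<bullet> P) - 2 * pi * (\<eta> \<bullet> P)\<bar>" by (rule norm_cis_diff_le)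
      also have "2 * pi * (\<xi> \<bullet> P) - 2 * pi * (\<eta> \<bullet> P) = 2 * pi * ((\<xi> - \<eta>) \<bullet> P)"
        by (simp add: inner_diff_left right_diff_distrib)
      also have "\<bar>\<dots>\<bar> = 2 * pi * \<bar>(\<xi> - \<eta>) \<bullet> P\<bar>" by (simp add: abs_mult)
      also have "\<dots> \<le> 2 * pi * (norm (\<xi> - \<eta>) * norm P)" by (intro mult_left_mono Cauchy_Schwarz_ineq2) simp
      also have "\<dots> \<le> 2 * pi * (norm (\<xi> - \<eta>) * R)" by (intro mult_left_mono R(2)[OF P]) auto
      finally show "cmod (?e - ?f) \<le> 2 * pi * R * dist \<xi> \<eta>" by (simp add: dist_norm mult_ac)
    qed auto
    also have "cmod ((?c - ?d) * ?f) \<le> dist \<xi> \<eta>"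
    proof -
      have "inverse (1 + norm \<xi>) - inverse (1 + norm \<eta>) = inverse (1 + norm \<xi>) * (norm \<eta> - norm \<xi>) * inverse (1 + norm \<eta>)"
        using p[of \<xi>] p[of \<eta>] inverse_diff_inverse[of "1 + norm \<xi>" "1 + norm \<eta>"] by (simp add: algebra_simps)
      then have "\<bar>inverse (1 + norm \<xi>) - inverse (1 + norm \<eta>)\<bar> = inverse (1 + norm \<xi>) * \<bar>norm \<eta> - norm \<xi>\<bar> * inverse (1 + norm \<eta>)"
        using i0[of \<xi>] i0[of \<eta>] by (simp only: abs_mult abs_of_nonneg)
      also have "\<dots> \<le> 1 * dist \<xi> \<eta> * 1"
        using i0 i1 norm_triangle_ineq3[of \<eta> \<xi>] by (intro mult_mono) (auto simp: dist_norm norm_minus_commute)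
      finally show ?thesis unfolding norm_mult norm_cis of_real_diff[symmetric] norm_of_real by simp
    qed
    finally have "cmod (?c * ?e - ?d * ?f) \<le> 1 * (2 * pi * R * dist \<xi> \<eta>) + dist \<xi> \<eta>" by simp
    also have "\<dots> = (2 * pi * R + 1) * dist \<xi> \<eta>" by (simp add: distrib_right)
    also have "\<dots> \<le> ?B * dist \<xi> \<eta>" by (intro mult_right_mono) (simp_all add: distrib_left)
    finally show ?thesis .
  qed
qed

text \<open>The weight \<open>1 + norm \<xi>\<close> is moved from the plane waves to g, whence the
  form of the integrability assumption; by homogeneity of T it cancels again on both sides.\<close>

lemma (in lipschitz_functional) plane_wave_pairing:
  fixes g :: "'a \<Rightarrow> complex"
  assumes w: "integrable lborel (\<lambda>\<xi>. (1 + norm \<xi>) *\<^sub>R g \<xi>)"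
  shows "integrable lborel (\<lambda>\<xi>. g \<xi> * T (\<lambda>Q. cis (2 * pi * (\<xi> \<bullet> Q))))"
    and "T (\<lambda>Q. \<integral>\<xi>. g \<xi> * cis (2 * pi * (\<xi> \<bullet> Q)) \<partial>lborel) = (\<integral>\<xi>. g \<xi> * T (\<lambda>Q. cis (2 * pi * (\<xi> \<bullet> Q))) \<partial>lborel)"
proof -
  obtain R where "0 < R" and R: "\<And>Q. Q \<in> K \<Longrightarrow> norm Q \<le> R"
    using compact_imp_bounded[OF compact_K] unfolding bounded_pos by auto
  then have R0: "0 \<le> R" by simp
  interpret G: lipschitz_family K T C "\<lambda>\<xi> Q. complex_of_real (inverse (1 + norm \<xi>)) * cis (2 * pi * (\<xi> \<bullet> Q))" "1 + 2 * pi * (1 + R)"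
    by (rule plane_wave_family[OF R0 R])
  have p: "complex_of_real (1 + norm \<xi>) \<noteq> 0" for \<xi> :: 'a
    using add_pos_nonneg[OF zero_less_one norm_ge_zero[of \<xi>]] by (simp only: of_real_eq_0_iff)
  have c: "((1 + norm \<xi>) *\<^sub>R g \<xi>) * (complex_of_real (inverse (1 + norm \<xi>)) * z) = g \<xi> * z" for \<xi> z
    using p[of \<xi>] unfolding scaleR_conv_of_real of_real_inverse by (simp add: field_simps)
  have TG: "T (\<lambda>Q. complex_of_real (inverse (1 + norm \<xi>)) * cis (2 * pi * (\<xi> \<bullet> Q))) = complex_of_real (inverse (1 + norm \<xi>)) * T (\<lambda>Q. cis (2 * pi * (\<xi> \<bullet> Q)))" for \<xi>
    by (rule T_cmult[OF plane_wave_lipschitz])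
  have idm: "(\<lambda>x. x) \<in> borel_measurable (borel :: 'a measure)" by simp
  show "integrable lborel (\<lambda>\<xi>. g \<xi> * T (\<lambda>Q. cis (2 * pi * (\<xi> \<bullet> Q))))"
    using G.integrable_family_pairing[OF w idm] unfolding TG c .
  show "T (\<lambda>Q. \<integral>\<xi>. g \<xi> * cis (2 * pi * (\<xi> \<bullet> Q)) \<partial>lborel) = (\<integral>\<xi>. g \<xi> * T (\<lambda>Q. cis (2 * pi * (\<xi> \<bullet> Q))) \<partial>lborel)"
    using G.pairing_integral[OF w] unfolding TG c .
qed

theorem theorem4p2:
  fixes \<Omega> :: "(real^'n) set" and s :: real and \<phi> :: "(real^'n \<Rightarrow> complex) \<Rightarrow> complex"
  assumes "CARD('n) \<ge> 2"
    and "lipschitz_domain \<Omega>"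
    and "1/2 < s" and "s < 1"
    and "\<phi> \<in> neg_sobolev_bdry \<Omega> (s - 1/2)"
  shows "distr_fourier_is
           (\<lambda>x. if x \<in> frontier \<Omega> then 0 else single_layer \<Omega> s \<phi> x)
           (\<lambda>\<xi>. complex_of_real (norm \<xi> powr (- 2 * s)) * \<phi> (\<lambda>Q. cis (2 * pi * (\<xi> \<bullet> Q))))"
proof -
  have n: "2 \<le> CARD('n)" and \<alpha>: "0 \<le> s - 1/2" "s - 1/2 < 1/2" using assms by auto
  obtain C where "lipschitz_functional (frontier \<Omega>) \<phi> C"
    using neg_sobolev_lipschitz_functional[OF assms(2) n \<alpha> assms(5)] by (rule exE)
  then interpret lipschitz_functional "frontier \<Omega>" \<phi> C .
  \<comment> \<open>With n the dimension, \<open>a + 1 < n\<close> is the condition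
    \<open>1/2 < s\<close>, and \<open>0 < a\<close> follows from
    \<open>2 * s < 2 \<le> n\<close>.\<close>
  define a where "a = real CARD('n) - 2 * s"
  have a: "0 < a" "a + 1 < real DIM(real^'n)" and a0: "0 \<le> a" using assms n by (auto simp: a_def)
  have s: "0 < s" "2 * s < real CARD('n)" using assms n by auto
  have s': "0 \<le> 2 * s" "2 * s < real DIM(real^'n)" using s by auto
  define c where "c = complex_of_real (riesz_const CARD('n) s)"
  have u: "(if x \<in> frontier \<Omega> then 0 else single_layer \<Omega> s \<phi> x) = c * layer_potential a x" for x
  proof (cases "x \<in> frontier \<Omega>")
    case True then show ?thesis by (simp add: layer_potential_def)
  next
    case False
    obtain L where L: "L-lipschitz_on (frontier \<Omega>) (\<lambda>Q. complex_of_real (norm (x - Q) powr (- a)))"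
    proof (rule kernel_lipschitz[OF a0 False], goal_cases)
    case 1
    show ?case by (rule 1(1)[OF 1(2-)])
  qed
    have "single_layer \<Omega> s \<phi> x = \<phi> (\<lambda>Q. c * complex_of_real (norm (x - Q) powr (- a)))"
      unfolding single_layer_def riesz_kernel_def c_def a_def of_real_mult by (rule refl)
    also have "\<dots> = c * \<phi> (\<lambda>Q. complex_of_real (norm (x - Q) powr (- a)))" by (rule T_cmult[OF L])
    finally show ?thesis using False by (simp add: layer_potential_def)
  qed
  show ?thesis
    unfolding distr_fourier_is_def u
  proof (intro allI impI)
    fix \<psi> :: "real^'n \<Rightarrow> complex" assume \<psi>: "schwartz \<psi>"
    have h: "integrable lborel (fourier \<psi>)" by (rule schwartz_fourier_integrable[OF \<psi>])
    have null: "frontier \<Omega> \<in> null_sets lborel" by (rule negligible_frontier_lipschitz_domain[OF assms(2) n])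
    obtain A where A: "\<And>x. cmod ((1 + norm x) *\<^sub>R \<psi> x) \<le> A" using schwartz_weighted(2)[OF \<psi>] by auto
    \<comment> \<open>The singular weight is absorbed into the density that multiplies the plane
      waves; it is integrable near the origin because 2s is below the dimension.\<close>
    define g where "g \<xi> = complex_of_real (norm \<xi> powr (- 2 * s)) * \<psi> \<xi>" for \<xi>
    have "integrable lborel (\<lambda>x. norm x powr (- (2 * s)) *\<^sub>R ((1 + norm x) *\<^sub>R \<psi> x))"
      by (rule riesz_weight_integrable[OF s' schwartz_weighted(1)[OF \<psi>] A])
    moreover have "norm x powr (- (2 * s)) *\<^sub>R ((1 + norm x) *\<^sub>R \<psi> x) = (1 + norm x) *\<^sub>R g x" for x
      unfolding g_def by (simp add: scaleR_conv_of_real mult_ac)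
    ultimately have w: "integrable lborel (\<lambda>\<xi>. (1 + norm \<xi>) *\<^sub>R g \<xi>)" by (simp only:)
    have mg: "complex_of_real (norm \<xi> powr (- 2 * s)) * \<phi> (\<lambda>Q. cis (2 * pi * (\<xi> \<bullet> Q))) * \<psi> \<xi> = g \<xi> * \<phi> (\<lambda>Q. cis (2 * pi * (\<xi> \<bullet> Q)))" for \<xi>
      unfolding g_def by (simp only: mult_ac)
    have int_u: "integrable lborel (\<lambda>x. c * layer_potential a x * fourier \<psi> x)"
      using layer_potential_integrable[OF a h norm_fourier_le] by (simp add: mult.assoc)
    obtain L where B: "L-lipschitz_on UNIV (riesz_potential a (fourier \<psi>))"
      using riesz_potential_bounds[OF a] h norm_fourier_le unfolding riesz_potential_bounded_def by metis
    have BK: "L-lipschitz_on (frontier \<Omega>) (riesz_potential a (fourier \<psi>))"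
      by (rule lipschitz_on_subset[OF B]) simp
    have "(\<integral>x. c * layer_potential a x * fourier \<psi> x \<partial>lborel) = c * (\<integral>x. layer_potential a x * fourier \<psi> x \<partial>lborel)"
      by (simp add: mult.assoc)
    also have "\<dots> = c * \<phi> (riesz_potential a (fourier \<psi>))"
      unfolding layer_potential_pairing[OF a null h norm_fourier_le] by (rule refl)
    also have "\<dots> = \<phi> (\<lambda>Q. c * riesz_potential a (fourier \<psi>) Q)" by (rule T_cmult[OF BK, symmetric])
    \<comment> \<open>The identity holds at every Q in space, not just on the boundary, so it is an
      equality of functions and may be substituted under \<open>\<phi>\<close>.\<close>
    also have "(\<lambda>Q. c * riesz_potential a (fourier \<psi>) Q) = (\<lambda>Q. \<integral>\<xi>. g \<xi> * cis (2 * pi * (\<xi> \<bullet> Q)) \<partial>lborel)"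
      unfolding c_def a_def riesz_potential_fourier[OF s \<psi>] g_def by (simp only: mult_ac)
    also have "\<phi> \<dots> = (\<integral>\<xi>. g \<xi> * \<phi> (\<lambda>Q. cis (2 * pi * (\<xi> \<bullet> Q))) \<partial>lborel)"
      by (rule plane_wave_pairing(2)[OF w])
    finally have eq: "(\<integral>x. c * layer_potential a x * fourier \<psi> x \<partial>lborel) = (\<integral>\<xi>. g \<xi> * \<phi> (\<lambda>Q. cis (2 * pi * (\<xi> \<bullet> Q))) \<partial>lborel)" .
    show "integrable lborel (\<lambda>x. c * layer_potential a x * fourier \<psi> x) \<and>
      integrable lborel (\<lambda>\<xi>. complex_of_real (norm \<xi> powr (- 2 * s)) * \<phi> (\<lambda>Q. cis (2 * pi * (\<xi> \<bullet> Q))) * \<psi> \<xi>) \<and>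
      (\<integral>x. c * layer_potential a x * fourier \<psi> x \<partial>lborel) = (\<integral>\<xi>. complex_of_real (norm \<xi> powr (- 2 * s)) * \<phi> (\<lambda>Q. cis (2 * pi * (\<xi> \<bullet> Q))) * \<psi> \<xi> \<partial>lborel)"
      unfolding mg using int_u plane_wave_pairing(1)[OF w] eq by (intro conjI)
  qed
qed

end
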